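(* Let $\rho=\{\rho_1,\dots,\rho_r\}$ be a non-crossing partition of the set $\{1,2,\dots,n\}$ and for every $1\le s\le r$ let $\pi^s$ be a partition of the set $\rho_s$. Then $$\Sigma\Big(\prod_s\pi^s\Big)=\prod_{1\le s\le r}\Sigma_{\pi^s},$$ where on the left-hand side $\prod_s\pi^s$ is the $\rho$-ordered product of partitions and $\Sigma$ is extended linearly to formal linear combinations of partitions, and on the right-hand side the product is the usual product of commuting elements of $\mathbb{C}(\widetilde{S}_\infty)$.
   Context: Partial permutations: for a finite set $A$, a partial permutation of $A$ is a pair $(d,w)$ with $d\subseteq A$ (the support) and $w:A\to A$ a bijection with $w(x)=x$ for $x\in A\setminus d$. They form a semigroup $\widetilde{S}_A$ under $(d_1,w_1)(d_2,w_2)=(d_1\cup d_2,w_1w_2)$; $\mathbb{C}(\widetilde{S}_A)$ is its semigroup algebra. For $A\subseteq B$ there is a homomorphism $\theta^B_A:\mathbb{C}(\widetilde{S}_B)\to\mathbb{C}(\widetilde{S}_A)$ sending $(d,w)$ to $(d,w|_A)$ if $d\subseteq A$ and to $0$ otherwise. $\mathbb{C}(\widetilde{S}_\infty)$ is the projective limit of the algebras $\mathbb{C}(\widetilde{S}_{\{1,\dots,q\}})$, $q\to\infty$, along these maps. Normalized conjugacy class indicators: for integers $k_1,\dots,k_m\ge1$, in $\mathbb{C}(\widetilde{S}_A)$ put $\Sigma_{k_1,\dots,k_m}=\sum_a (a_{1,1},\dots,a_{1,k_1})\cdots(a_{m,1},\dots,a_{m,k_m})$, the sum over all injective families $a=(a_{r,s})_{1\le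 r\le m,1\le s\le k_r}$ of elements of $A$; each summand is a product of disjoint cycles regarded as a partial permutation with support $\{a_{r,s}\}$. If some $k_i=0$ then $\Sigma_{k_1,\dots,k_m}=0$. These are compatible with the maps $\theta^B_A$ and define $\Sigma_{k_1,\dots,k_m}\in\mathbb{C}(\widetilde{S}_\infty)$; these elements commute. Partition-indexed indicators: let $\pi$ be a partition of $\{1,\dots,n\}$. For a block with elements $x_1<\dots<x_l$ put $\pi_{\mathrm{fat}}(x_t')=x_{t+1}$ (with $x_{l+1}=x_1$); this defines a bijection $\pi_{\mathrm{fat}}:\{1',\dots,n'\}\to\{1,\dots,n\}$. Let $c:\{1,\dots,n\}\to\{1',\dots,n'\}$, $c(k)=(k-1)'$ for $k\ge2$, $c(1)=n'$. Decompose the permutation $\pi_{\mathrm{fat}}\circ c$ of $\{1,\dots,n\}$ into disjoint cycles $b_1,\dots,b_t$ (fixed points included), $b_s=(b_{s,1},\dots,b_{s,j_s})$ where $b_{s,i}\mapsto b_{s,i+1}$ and $b_{s,j_s+1}=b_{s,1}$. The number of clockwise winds of $b_s$ is the number of $1\le i\le j_s$ with $b_{s,i}\le b_{s,i+1}$, and $k_s:=j_s-(\text{number of clockwise winds of }b_s)$. Then $\Sigma_\pi=\Sigma(\pi):=\Sigma_{k_1,\dots,k_t}\in\mathbb{C}(\widetilde{S}_\infty)$. For a partition of another finite ordered set, relabel by the order-preserving bijection. Order on partitions: $\pi\le\sigma$ iff every block of $\pi$ is contained in a block of $\sigma$. Kreweras complement: for a non-crossing partition $\tau$ of $\{1,\dots,n\}$,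 $\tau_{\mathrm{comp}}$ is the largest non-crossing partition of $\{1',\dots,n'\}$ such that $\tau\cup\tau_{\mathrm{comp}}$ is a non-crossing partition of $1<1'<2<2'<\dots<n<n'$, viewed as a partition of $\{1,\dots,n\}$ via $i'\leftrightarrow i$. This is a bijection of the set of non-crossing partitions, and $\rho_{\mathrm{comp}^{-1}}$ denotes the partition $\tau$ with $\tau_{\mathrm{comp}}=\rho$. $\rho$-ordered product: $\prod_s\pi^s:=\sum_\sigma\sigma$ (formal sum), over all partitions $\sigma$ of $\{1,\dots,n\}$ such that (1) for every $s$ and all $a,b\in\rho_s$: $a,b$ are in the same block of $\sigma$ iff they are in the same block of $\pi^s$; (2) $\sigma\ge\rho_{\mathrm{comp}^{-1}}$. *)

theory Defs
  imports
    Complex_Main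
    "HOL-Library.Poly_Mapping"
    "HOL-Library.Disjoint_Sets"
    "HOL-Library.FuncSet"
    "HOL-Combinatorics.Cycles"
    "HOL-Combinatorics.Orbits"
begin

section \<open>Partial permutations\<close>

text \<open>
  The bijection \<open>w : A \<rightarrow> A\<close> of a partial permutation \<open>(d, w)\<close> is the identity outside \<open>d\<close>; it is
  stored as a function on the whole type that is the identity outside \<open>d\<close>. Thus a pair does not
  record \<open>A\<close>, the restriction \<open>w|\<^sub>A\<close> with \<open>d \<subseteq> A\<close> is represented by the same pair, and the
  partial permutations of \<open>A\<close> are those with support contained in \<open>A\<close>.
\<close>

typedef 'a pperm = "{(d :: 'a set, w :: 'a \<Rightarrow> 'a). finite d \<and> w permutes d}"
  by (rule exI[of _ "({}, id)"]) (simp add: permutes_id)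

setup_lifting type_definition_pperm

lift_definition supp :: "'a pperm \<Rightarrow> 'a set" is fst .

text \<open>
  The semigroup of partial permutations is written additively (although it is not commutative):
  this is what makes the convolution product of the type of finitely supported functions,
  which is defined for an additive monoid of exponents, the semigroup algebra. So
  \<open>(d\<^sub>1, w\<^sub>1) + (d\<^sub>2, w\<^sub>2)\<close> is the product \<open>(d\<^sub>1 \<union> d\<^sub>2, w\<^sub>1 w\<^sub>2)\<close>, and \<open>0\<close> is the
  neutral element \<open>({}, id)\<close>.
\<close>

instantiation pperm :: (type) monoid_add
begin

lift_definition zero_pperm :: "'a pperm" is "({}, id)"
  by (simp add: permutes_id)

lift_definition plus_pperm :: "'a pperm \<Rightarrow> 'a pperm \<Rightarrow> 'a pperm"
  is "\<lambda>(d1, w1) (d2, w2). (d1 \<union> d2, w1 \<circ> w2)"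
  by (auto intro!: permutes_compose intro: permutes_subset)

instance
  by standard (transfer; auto simp: comp_assoc)+

end

lemma supp_zero [simp]: "supp 0 = {}"
  by transfer simp

lemma supp_plus [simp]: "supp (p + q) = supp p \<union> supp q"
  by transfer auto

lift_definition cycle_pperm :: "'a list \<Rightarrow> 'a pperm" is "\<lambda>cs. (set cs, cycle_of_list cs)"
  by (simp add: cycle_permutes)

lemma supp_cycle_pperm [simp]: "supp (cycle_pperm cs) = set cs"
  by transfer simp


section \<open>The semigroup algebras and their projective limit\<close>

definition pperm_algebra :: "'a set \<Rightarrow> ('a pperm \<Rightarrow>\<^sub>0 complex) set" where
  "pperm_algebra A = {f. \<forall>p \<in> Poly_Mapping.keys f. supp p \<subseteq> A}"

definition scale :: "complex \<Rightarrow> ('a \<Rightarrow>\<^sub>0 complex) \<Rightarrow> ('a \<Rightarrow>\<^sub>0 complex)" where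
  "scale c f = Poly_Mapping.map ((*) c) f"

text \<open>
  The linear extension of \<open>(d, w) \<mapsto> (d, w|\<^sub>A)\<close> if \<open>d \<subseteq> A\<close>, and \<open>(d, w) \<mapsto> 0\<close> otherwise. By the
  encoding above it does not depend on the larger set \<open>B\<close>.
\<close>

definition theta :: "'a set \<Rightarrow> ('a pperm \<Rightarrow>\<^sub>0 complex) \<Rightarrow> ('a pperm \<Rightarrow>\<^sub>0 complex)" where
  "theta A f = (\<Sum>p \<in> Poly_Mapping.keys f.
     if supp p \<subseteq> A then Poly_Mapping.single p (Poly_Mapping.lookup f p) else 0)"

lemma lookup_scale [simp]: "Poly_Mapping.lookup (scale c f) p = c * Poly_Mapping.lookup f p"
  unfolding scale_def by (simp add: Poly_Mapping.map.rep_eq when_def)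

lemma lookup_theta:
  "Poly_Mapping.lookup (theta A f) p = (if supp p \<subseteq> A then Poly_Mapping.lookup f p else 0)"
proof -
  have "Poly_Mapping.lookup (theta A f) p =
     (\<Sum>q \<in> Poly_Mapping.keys f. if q = p then (if supp p \<subseteq> A then Poly_Mapping.lookup f p else 0) else 0)"
    unfolding theta_def Poly_Mapping.lookup_sum
    by (intro sum.cong) (auto simp: lookup_single)
  also have "\<dots> = (if supp p \<subseteq> A then Poly_Mapping.lookup f p else 0)"
    by (auto simp: sum.delta in_keys_iff)
  finally show ?thesis .
qed

lemma theta_zero [simp]: "theta A 0 = 0"
  by (simp add: theta_def)

lemma theta_add: "theta A (f + g) = theta A f + theta A g"
  by (rule poly_mapping_eqI) (simp add: lookup_theta lookup_add)

lemma theta_uminus: "theta A (- f) = - theta A f"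
  by (rule poly_mapping_eqI) (simp add: lookup_theta)

lemma theta_minus: "theta A (f - g) = theta A f - theta A g"
  by (rule poly_mapping_eqI) (simp add: lookup_theta lookup_minus)

lemma theta_scale: "theta A (scale c f) = scale c (theta A f)"
  by (rule poly_mapping_eqI) (simp add: lookup_theta)

lemma theta_sum: "theta A (\<Sum>i\<in>I. f i) = (\<Sum>i\<in>I. theta A (f i))"
  by (induction I rule: infinite_finite_induct) (simp_all add: theta_add)

lemma theta_single:
  "theta A (Poly_Mapping.single p c) = (if supp p \<subseteq> A then Poly_Mapping.single p c else 0)"
  by (rule poly_mapping_eqI) (auto simp: lookup_theta lookup_single when_def)

lemma theta_one [simp]: "theta A 1 = 1"
  by (simp add: theta_single flip: single_one)

lemma theta_mult: "theta A (f * g) = theta A f * theta A g"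
proof -
  have *: "h = (\<Sum>p \<in> Poly_Mapping.keys h. Poly_Mapping.single p (Poly_Mapping.lookup h p))"
    for h :: "'a pperm \<Rightarrow>\<^sub>0 complex"
  proof -
    have "theta UNIV h = h"
      by (rule poly_mapping_eqI) (simp add: lookup_theta)
    then show ?thesis by (simp add: theta_def)
  qed
  have eq: "theta A (Poly_Mapping.single p c * Poly_Mapping.single q d) =
      theta A (Poly_Mapping.single p c) * theta A (Poly_Mapping.single q d)" for p q c d
    by (simp add: mult_single theta_single)
  show ?thesis
    by (subst (1 2) *[of f], subst (1 2) *[of g])
      (simp only: sum_distrib_left sum_distrib_right theta_sum eq)
qed

lemma in_pperm_algebra_iff: "f \<in> pperm_algebra A \<longleftrightarrow> theta A f = f"
  by (auto simp: pperm_algebra_def poly_mapping_eq_iff fun_eq_iff lookup_theta in_keys_iff)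

typedef pperm_limit =
  "{x :: nat \<Rightarrow> (nat pperm \<Rightarrow>\<^sub>0 complex).
     (\<forall>q. x q \<in> pperm_algebra {1..q}) \<and> (\<forall>p q. p \<le> q \<longrightarrow> theta {1..p} (x q) = x p)}"
  by (rule exI[of _ "\<lambda>_. 0"]) (simp add: pperm_algebra_def)

setup_lifting type_definition_pperm_limit

instantiation pperm_limit :: ring_1
begin

lift_definition zero_pperm_limit :: pperm_limit is "\<lambda>_. 0"
  by (simp add: in_pperm_algebra_iff)

lift_definition one_pperm_limit :: pperm_limit is "\<lambda>_. 1"
  by (simp add: in_pperm_algebra_iff)

lift_definition plus_pperm_limit :: "pperm_limit \<Rightarrow> pperm_limit \<Rightarrow> pperm_limit"
  is "\<lambda>x y q. x q + y q"
  by (simp add: in_pperm_algebra_iff theta_add)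

lift_definition uminus_pperm_limit :: "pperm_limit \<Rightarrow> pperm_limit" is "\<lambda>x q. - x q"
  by (simp add: in_pperm_algebra_iff theta_uminus)

lift_definition minus_pperm_limit :: "pperm_limit \<Rightarrow> pperm_limit \<Rightarrow> pperm_limit"
  is "\<lambda>x y q. x q - y q"
  by (simp add: in_pperm_algebra_iff theta_minus)

lift_definition times_pperm_limit :: "pperm_limit \<Rightarrow> pperm_limit \<Rightarrow> pperm_limit"
  is "\<lambda>x y q. x q * y q"
  by (simp add: in_pperm_algebra_iff theta_mult)

instance
proof
  show "(0::pperm_limit) \<noteq> 1"
    by transfer (simp add: fun_eq_iff)
qed (transfer; simp add: algebra_simps fun_eq_iff)+

end

lift_definition limit_scale :: "complex \<Rightarrow> pperm_limit \<Rightarrow> pperm_limit" is "\<lambda>c x q. scale c (x q)"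
  by (simp add: in_pperm_algebra_iff theta_scale)


section \<open>Normalized conjugacy class indicators\<close>

definition family_index :: "nat list \<Rightarrow> (nat \<times> nat) set" where
  "family_index ks = {(r, s). r < length ks \<and> s < ks ! r}"

definition injective_families :: "nat list \<Rightarrow> 'a set \<Rightarrow> (nat \<times> nat \<Rightarrow> 'a) set" where
  "injective_families ks A = {a \<in> family_index ks \<rightarrow>\<^sub>E A. inj_on a (family_index ks)}"

text \<open>The list sum is the product of the cycles in the additively written semigroup.\<close>

definition family_pperm :: "nat list \<Rightarrow> (nat \<times> nat \<Rightarrow> 'a) \<Rightarrow> 'a pperm" where
  "family_pperm ks a =
     sum_list (map (\<lambda>r. cycle_pperm (map (\<lambda>s. a (r, s)) [0..<ks ! r])) [0..<length ks])"

definition class_indicator_on :: "'a set \<Rightarrow> nat list \<Rightarrow> ('a pperm \<Rightarrow>\<^sub>0 complex)" where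
  "class_indicator_on A ks =
     (if 0 \<in> set ks then 0
      else \<Sum>a \<in> injective_families ks A. Poly_Mapping.single (family_pperm ks a) 1)"

lemma supp_sum_list: "supp (sum_list ps) = (\<Union>p \<in> set ps. supp p)"
  by (induction ps) auto

lemma supp_family_pperm: "supp (family_pperm ks a) = a ` family_index ks"
  by (force simp: family_pperm_def supp_sum_list family_index_def)

lemma finite_family_index: "finite (family_index ks)"
proof -
  have "family_index ks = Sigma {..<length ks} (\<lambda>r. {..<ks ! r})"
    by (auto simp: family_index_def)
  then show ?thesis by simp
qed

lemma theta_class_indicator_on:
  assumes "finite B" "A \<subseteq> B"
  shows "theta A (class_indicator_on B ks) = class_indicator_on A ks"
proof (cases "0 \<in> set ks")
  case False
  let ?I = "injective_families ks"
  have fin: "finite (?I B)"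
    unfolding injective_families_def
    using finite_PiE[OF finite_family_index, of ks "\<lambda>_. B"] assms(1) by simp
  have sub: "{a \<in> ?I B. a ` family_index ks \<subseteq> A} = ?I A"
    using assms(2) by (auto simp: injective_families_def PiE_def Pi_def)
  have "theta A (class_indicator_on B ks) =
      (\<Sum>a \<in> ?I B. if a ` family_index ks \<subseteq> A then Poly_Mapping.single (family_pperm ks a) 1 else 0)"
    using False by (simp add: class_indicator_on_def theta_sum theta_single supp_family_pperm)
  also have "\<dots> = (\<Sum>a \<in> {a \<in> ?I B. a ` family_index ks \<subseteq> A}. Poly_Mapping.single (family_pperm ks a) 1)"
    using fin by (simp add: sum.inter_filter)
  also have "\<dots> = class_indicator_on A ks"
    using False by (simp add: sub class_indicator_on_def)
  finally show ?thesis .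
qed (simp add: class_indicator_on_def)

lift_definition class_indicator :: "nat list \<Rightarrow> pperm_limit"
  is "\<lambda>ks q. class_indicator_on {1..q} ks"
  by (simp add: in_pperm_algebra_iff theta_class_indicator_on)


section \<open>Partition-indexed indicators\<close>

text \<open>A primed number \<open>i'\<close> is represented by \<open>i\<close>; so this is \<open>i' \<mapsto> \<pi>\<^sub>f\<^sub>a\<^sub>t(i')\<close>.\<close>

definition fat :: "nat set set \<Rightarrow> nat \<Rightarrow> nat" where
  "fat \<pi> i = (let B = (THE B. B \<in> \<pi> \<and> i \<in> B) in
     if \<exists>j\<in>B. i < j then Min {j \<in> B. i < j} else Min B)"

definition c_shift :: "nat \<Rightarrow> nat \<Rightarrow> nat" where
  "c_shift n k = (if k = 1 then n else k - 1)"

definition fat_perm :: "nat \<Rightarrow> nat set set \<Rightarrow> nat \<Rightarrow> nat" where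
  "fat_perm n \<pi> k = (if k \<in> {1..n} then fat \<pi> (c_shift n k) else k)"

text \<open>
  The cycles of a permutation of \<open>{1..n}\<close> as sets, each listed once, at its least element. The order
  of the list is immaterial.
\<close>

definition cycles_of :: "nat \<Rightarrow> (nat \<Rightarrow> nat) \<Rightarrow> nat set list" where
  "cycles_of n f = [orbit f x. x \<leftarrow> [1..<Suc n], x = Min (orbit f x)]"

definition clockwise_winds :: "(nat \<Rightarrow> nat) \<Rightarrow> nat set \<Rightarrow> nat" where
  "clockwise_winds f b = card {x \<in> b. x \<le> f x}"

definition winding_type :: "nat \<Rightarrow> nat set set \<Rightarrow> nat list" where
  "winding_type n \<pi> =
     (let f = fat_perm n \<pi> in map (\<lambda>b. card b - clockwise_winds f b) (cycles_of n f))"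

text \<open>The order-preserving bijection from a finite set \<open>X\<close> onto \<open>{1..card X}\<close>.\<close>

definition rank_in :: "nat set \<Rightarrow> nat \<Rightarrow> nat" where
  "rank_in X x = card {y \<in> X. y \<le> x}"

text \<open>
  For a partition of an arbitrary finite set of numbers, namely of \<open>\<Union>\<pi>\<close>. The relabelling is the
  identity if \<open>\<Union>\<pi> = {1..n}\<close>.
\<close>

definition partition_indicator :: "nat set set \<Rightarrow> pperm_limit" where
  "partition_indicator \<pi> =
     class_indicator (winding_type (card (\<Union>\<pi>)) ((`) (rank_in (\<Union>\<pi>)) ` \<pi>))"

definition indicator_linear :: "(nat set set \<Rightarrow>\<^sub>0 complex) \<Rightarrow> pperm_limit" where
  "indicator_linear F =
     (\<Sum>\<sigma> \<in> Poly_Mapping.keys F. limit_scale (Poly_Mapping.lookup F \<sigma>) (partition_indicator \<sigma>))"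


section \<open>Non-crossing partitions and the ordered product\<close>

definition noncrossing :: "'a::linorder set set \<Rightarrow> bool" where
  "noncrossing P \<longleftrightarrow>
     \<not> (\<exists>X\<in>P. \<exists>Y\<in>P. X \<noteq> Y \<and>
          (\<exists>a b c d. a < b \<and> b < c \<and> c < d \<and> a \<in> X \<and> c \<in> X \<and> b \<in> Y \<and> d \<in> Y))"

definition NC :: "nat \<Rightarrow> nat set set set" where
  "NC n = {\<tau>. partition_on {1..n} \<tau> \<and> noncrossing \<tau>}"

text \<open>
  The union of \<open>\<tau>\<close> and of a partition of primed numbers on \<open>1 < 1' < 2 < 2' < \<dots> < n < n'\<close>, where
  \<open>i\<close> is encoded as \<open>2 i\<close> and \<open>i'\<close> as \<open>2 i + 1\<close>.
\<close>

definition interleave :: "nat set set \<Rightarrow> nat set set \<Rightarrow> nat set set" where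
  "interleave \<tau> \<kappa> = (`) (\<lambda>i. 2 * i) ` \<tau> \<union> (`) (\<lambda>i. 2 * i + 1) ` \<kappa>"

definition kreweras :: "nat \<Rightarrow> nat set set \<Rightarrow> nat set set" where
  "kreweras n \<tau> =
     (let C = {\<kappa> \<in> NC n. noncrossing (interleave \<tau> \<kappa>)} in
      THE \<kappa>. \<kappa> \<in> C \<and> (\<forall>\<kappa>'\<in>C. refines {1..n} \<kappa>' \<kappa>))"

definition kreweras_inv :: "nat \<Rightarrow> nat set set \<Rightarrow> nat set set" where
  "kreweras_inv n \<rho> = inv_into (NC n) (kreweras n) \<rho>"

definition same_block :: "'a set set \<Rightarrow> 'a \<Rightarrow> 'a \<Rightarrow> bool" where
  "same_block P a b \<longleftrightarrow> (\<exists>B\<in>P. a \<in> B \<and> b \<in> B)"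

text \<open>The partition \<open>\<rho>\<close> of \<open>{1..n}\<close> has the blocks \<open>\<rho> 1, \<dots>, \<rho> r\<close>, and \<open>\<pi> s\<close> is a partition of \<open>\<rho> s\<close>.\<close>

definition ordered_product ::
    "nat \<Rightarrow> nat \<Rightarrow> (nat \<Rightarrow> nat set) \<Rightarrow> (nat \<Rightarrow> nat set set) \<Rightarrow> (nat set set \<Rightarrow>\<^sub>0 complex)" where
  "ordered_product n r \<rho> \<pi> =
     (\<Sum>\<sigma> \<in> {\<sigma>. partition_on {1..n} \<sigma> \<and>
               (\<forall>s\<in>{1..r}. \<forall>a\<in>\<rho> s. \<forall>b\<in>\<rho> s. same_block \<sigma> a b \<longleftrightarrow> same_block (\<pi> s) a b) \<and>
               refines {1..n} (kreweras_inv n (\<rho> ` {1..r})) \<sigma>}.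
        Poly_Mapping.single \<sigma> 1)"

end

theory Submission
  imports Defs
begin

text \<open>
  At level \<open>q\<close> read the blocks of a partition of \<open>{1..n}\<close> as the vertices of a closed walk
  \<open>a\<^sub>1, \<dots>, a\<^sub>n\<close> with letters in \<open>{0..q}\<close>, rooted at \<open>a\<^sub>n = 0\<close>, and let a token slide along the walk,
  each step exchanging it with whatever occupies the next vertex. The resulting permutation of the
  other letters is a first-return map of the fattened permutation, so \<open>\<Sigma>\<^sub>\<pi>\<close> is the sum of the slide
  permutations over all walks whose coincidence pattern is \<open>\<pi>\<close> (walks with a trivial step being
  discarded). The condition \<open>\<sigma> \<ge> \<rho>\<^bsub>comp\<^esub>\<^sup>-\<^sup>1\<close> says that \<open>a x = a y\<close> whenever \<open>{x..<y}\<close> is a union of blocks of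
  \<open>\<rho>\<close>, that is, the walk closes up around every block of \<open>\<rho>\<close>. A block of \<open>\<rho>\<close> that is an interval is
  then an inserted loop, and conjugating this loop by the part of the walk preceding it splits it off
  as a right factor; summing over the loop gives \<open>\<Sigma>\<close> of that block. The theorem follows by removing
  interval blocks one at a time, because the factors are central.
\<close>

section \<open>Sliding permutations of closed walks\<close>

text \<open>The letter \<open>0\<close> lies outside \<open>{1..q}\<close>: it is the token's home,
  so a walk closing up at \<open>0\<close> fixes it and leaves a permutation of
  \<open>{1..q}\<close>. The obstacle is the inserted loop: it is rooted at the label where it is
  inserted, and splitting it off relabels it by a map that depends on the preceding walk and on the
  loop's own last label. Summing over the loop still gives a quantity free of both, because the old
  labels can be recovered from the new ones. Supports must agree along with the permutations; they
  do because the accumulated permutation moves only letters already visited. The gluing condition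
  comes from a closed form of the inverse Kreweras complement: as \<open>i'\<close> lies between
  \<open>i\<close> and \<open>i + 1\<close>, two points share a block exactly when no block of
  \<rho> has points on both sides of the chord joining them. The comparison with \<Sigma> rests on a
  count: the steps of the fattened permutation that are not clockwise start at those
  \<open>x \<ge> 2\<close> for which \<open>x - 1\<close> ends its block, one for each block without
  \<open>n\<close>, hence one for each label left free by \<open>a n = 0\<close>.\<close>

fun slide :: "'a \<Rightarrow> 'a list \<Rightarrow> 'a \<Rightarrow> 'a" where
  "slide v [] = id"
| "slide v (x # xs) = slide x xs \<circ> transpose v x"

lemma slide_append: "slide v (us @ vs) = slide (last (v # us)) vs \<circ> slide v us"
  by (induction us arbitrary: v) (auto simp: comp_assoc)

lemma slide_permutes: "slide v ws permutes insert v (set ws)"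
proof (induction ws arbitrary: v)
  case (Cons x xs)
  have "slide x xs permutes insert v (set (x # xs))"
    using Cons[of x] by (rule permutes_subset) auto
  moreover have "transpose v x permutes insert v (set (x # xs))"
    by (rule permutes_swap_id) auto
  ultimately show ?case
    unfolding slide.simps by (metis permutes_compose)
qed (simp add: permutes_id)

lemma bij_slide: "bij (slide v ws)"
  using slide_permutes by (rule permutes_bij)

lemma slide_apply_start: "slide v ws v = last (v # ws)"
  by (induction ws arbitrary: v) auto

text \<open>Relabelling a walk is conjugation, because it is so for each transposition; this is what
  turns changes of labels into identities in the algebra.\<close>

lemma slide_map:
  assumes "bij g"
  shows "slide (g v) (map g ws) \<circ> g = g \<circ> slide v ws"
proof (induction ws arbitrary: v)
  case (Cons x xs)
  have "transpose (g v) (g x) \<circ> g = g \<circ> transpose v x"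
    using assms by (auto simp: fun_eq_iff transpose_def bij_def inj_eq)
  then have "slide (g v) (map g (x # xs)) \<circ> g = slide (g x) (map g xs) \<circ> g \<circ> transpose v x"
    by (simp only: slide.simps list.map comp_assoc)
  with Cons[of x] show ?case by (simp only: slide.simps comp_assoc)
qed simp

text \<open>Moving the root of a closed walk to the other end of the closing edge conjugates the walk by
  the transposition of that edge; as this is also its first factor, relabelling by the same
  transposition restores the permutation.\<close>

lemma slide_rotate:
  assumes "t = transpose v (last (v # ws))"
  shows "slide v (ws @ [v]) = slide v (map t (v # ws))"
proof -
  let ?l = "last (v # ws)"
  have bij: "bij t" by (simp add: assms)
  have l: "t ?l = v" "t v = ?l" and tt: "t \<circ> t = id" by (simp_all add: assms)
  have "slide v (ws @ [v]) = t \<circ> slide v ws"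
    by (simp add: slide_append assms transpose_commute)
  also have "\<dots> = slide (t v) (map t ws) \<circ> t"
    using slide_map[OF bij, of v ws] by simp
  also have "\<dots> = slide v (map t (v # ws))"
    by (simp add: l) (simp add: assms)
  finally show ?thesis .
qed

text \<open>The walk starts at the root \<open>0\<close>, and the last letter of \<open>ws\<close>
  is its return there; so \<open>0\<close> is fixed and can be left out of the support, which
  otherwise records every visited letter, moved or not. A list that does not return to
  \<open>0\<close> gets the neutral element as a default value.\<close>

lift_definition slide_pperm :: "nat list \<Rightarrow> nat pperm" is
  "\<lambda>ws. if last (0 # ws) = 0 then (set ws - {0}, slide 0 ws) else ({}, id)"
proof -
  fix ws :: "nat list"
  have "slide 0 ws permutes set ws - {0}" if "last (0 # ws) = 0"
  proof (rule permutes_superset[OF slide_permutes])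
    show "slide 0 ws x = x" if "x \<in> insert 0 (set ws) - (set ws - {0})" for x
      using that \<open>last (0 # ws) = 0\<close> slide_apply_start[of 0 ws] by auto
  qed
  then show "(if last (0 # ws) = 0 then (set ws - {0}, slide 0 ws) else ({}, id))
      \<in> {(d, w). finite d \<and> w permutes d}"
    by (auto simp: permutes_id)
qed

text \<open>Giving the value \<open>0\<close> to walks with equal cyclic neighbours mirrors the
  convention that \<Sigma> vanishes as soon as some \<open>k_i\<close> is \<open>0\<close>.\<close>

definition slide_term :: "nat list \<Rightarrow> nat pperm \<Rightarrow>\<^sub>0 complex" where
  "slide_term ws =
     (if distinct_adj (last ws # ws) then Poly_Mapping.single (slide_pperm ws) 1 else 0)"

lemma distinct_adj_rotate:
  "distinct_adj (last (v # ws) # v # ws) \<longleftrightarrow> distinct_adj (v # ws @ [v])"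
  using distinct_adj_append_iff[of "v # ws" "[v]"] by (auto simp: )

text \<open>\<open>V\<close> is the permutation accumulated on arrival at \<open>v\<close>, so
  moving the loop in front of the rest of the walk conjugates it by \<open>V\<close>. The map
  \<open>t\<close> first moves the root of the loop from its front to its end, as in
  \<open>slide_rotate\<close>, so that the relabelled list again ends in \<open>0\<close>.\<close>

lemma slide_pperm_insert_loop:
  assumes v: "last (v # vs) = 0"
    and V: "V = slide 0 (us @ [v])" and t: "t = transpose v (last (v # ms))"
  shows "slide_pperm (us @ (v # ms) @ v # vs) =
      slide_pperm (us @ v # vs) + slide_pperm (map (inv V \<circ> t) (v # ms))"
proof -
  let ?b = "map (inv V \<circ> t) (v # ms)"
  have bij: "bij V" by (simp add: V bij_slide)
  have V0: "V 0 = v" by (simp add: V slide_apply_start)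
  have invV: "inv V v = 0"
    using bij V0 by (metis bij_inv_eq_iff)
  have last_b: "last ?b = 0"
    using invV t by (simp add: last_map)
  have "V \<circ> slide 0 ?b = slide v (map t (v # ms)) \<circ> V"
    using slide_map[OF bij, of 0 ?b] bij V0
    by (simp add: o_def surj_f_inv_f bij_is_surj)
  also have "\<dots> = slide v (ms @ [v]) \<circ> V"
    using slide_rotate[OF t] by simp
  finally have loop: "V \<circ> slide 0 ?b = slide v (ms @ [v]) \<circ> V" .
  have split: "slide 0 (us @ xs @ v # vs) = slide v vs \<circ> slide 0 (us @ xs @ [v])" for xs
    using slide_append[of 0 "us @ xs @ [v]" vs] by simp
  have "slide 0 (us @ (v # ms) @ v # vs) = slide v vs \<circ> slide v (ms @ [v]) \<circ> V"
    using split[of "v # ms"] slide_append[of 0 "us @ [v]" "ms @ [v]"]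
    by (simp add: V comp_assoc)
  also have "\<dots> = slide v vs \<circ> (V \<circ> slide 0 ?b)"
    by (simp only: loop comp_assoc)
  also have "\<dots> = slide 0 (us @ v # vs) \<circ> slide 0 ?b"
    using split[of "[]"] by (simp add: V comp_assoc)
  finally have perm: "slide 0 (us @ (v # ms) @ v # vs) = slide 0 (us @ v # vs) \<circ> slide 0 ?b" .
  have "t ` set (v # ms) = set (v # ms)"
    unfolding t by (rule transpose_image_eq) auto
  then have set_b: "set ?b = inv V ` set (v # ms)"
    by (metis image_comp image_set)
  define L where "L = insert 0 (set (us @ v # vs))"
  have VL: "V permutes L"
    unfolding V L_def by (rule permutes_subset[OF slide_permutes]) auto
  \<comment> \<open>\<open>V\<close> permutes \<open>L\<close>, the letters of the outer walk with
    the root, so pulling the loop's letters back along \<open>V\<close> only reshuffles letters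
    inside \<open>L\<close>. The two supports together therefore cover exactly the letters of the
    whole walk.\<close>
  have inv_eq: "inv V ` set (v # ms) \<union> L = set (v # ms) \<union> L"
  proof -
    have "inv V x = x" if "x \<notin> L" for x
      using VL that by (metis permutes_inv permutes_not_in)
    moreover have "inv V x \<in> L" if "x \<in> L" for x
      using permutes_in_image[OF permutes_inv[OF VL]] that by auto
    ultimately show ?thesis by (auto simp: image_iff) metis+
  qed
  have "set (us @ (v # ms) @ v # vs) - {0} = set (v # ms) \<union> L - {0}"
    by (auto simp: L_def)
  also have "\<dots> = inv V ` set (v # ms) \<union> L - {0}"
    by (simp only: inv_eq)
  also have "\<dots> = (set (us @ v # vs) - {0}) \<union> (set ?b - {0})"
    unfolding set_b L_def by auto
  finally have supp: "set (us @ (v # ms) @ v # vs) - {0} =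
      (set (us @ v # vs) - {0}) \<union> (set ?b - {0})" .
  have lasts: "last (0 # us @ (v # ms) @ v # vs) = 0" "last (0 # us @ v # vs) = 0" "last (0 # ?b) = 0"
    using v last_b by auto
  show ?thesis
    using perm supp lasts by transfer simp
qed

text \<open>Cutting at the two occurrences of \<open>v\<close> distributes the pairs of cyclic
  neighbours over the outer walk and the loop, and an injective relabelling keeps neighbours
  distinct.\<close>

lemma slide_term_insert_loop:
  assumes v: "last (v # vs) = 0"
    and V: "V = slide 0 (us @ [v])" and t: "t = transpose v (last (v # ms))"
  shows "slide_term (us @ (v # ms) @ v # vs) =
      slide_term (us @ v # vs) * slide_term (map (inv V \<circ> t) (v # ms))"
proof -
  let ?h = "inv V \<circ> t"
  have "bij ?h"
    by (auto intro!: bij_comp bij_imp_bij_inv simp: t V bij_slide)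
  then have inj: "inj_on ?h A" for A
    by (metis bij_def inj_on_subset subset_UNIV)
  have "distinct_adj (last (map ?h (v # ms)) # map ?h (v # ms)) \<longleftrightarrow>
      distinct_adj (map ?h (last (v # ms) # v # ms))"
    by (simp add: last_map del: distinct_adj_Cons_Cons)
  also have "\<dots> \<longleftrightarrow> distinct_adj (last (v # ms) # v # ms)"
    by (rule distinct_adj_map_iff[OF inj])
  also have "\<dots> \<longleftrightarrow> distinct_adj (v # ms @ [v])"
    by (rule distinct_adj_rotate)
  finally have b: "distinct_adj (last (map ?h (v # ms)) # map ?h (v # ms)) \<longleftrightarrow> \<dots>" .
  have "distinct_adj (last (us @ (v # ms) @ v # vs) # us @ (v # ms) @ v # vs) \<longleftrightarrow>
      distinct_adj (last (us @ v # vs) # us @ v # vs) \<and> distinct_adj (v # ms @ [v])"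
    using v distinct_adj_append_iff[of "0 # us" "v # ms @ v # vs"]
      distinct_adj_append_iff[of "v # ms" "v # vs"] distinct_adj_append_iff[of "0 # us" "v # vs"]
      distinct_adj_append_iff[of "v # ms" "[v]"]
    by auto
  with b show ?thesis
    unfolding slide_term_def slide_pperm_insert_loop[OF assms] by (simp add: mult_single)
qed

section \<open>Sums over labelled closed walks\<close>

text \<open>The kernel of \<open>a\<close> on \<open>X\<close> has to be \<open>P\<close> itself and
  not just coarser: each labeling then belongs to a single partition, and a sum over partitions
  becomes a sum over labelings.\<close>

definition labelings :: "nat \<Rightarrow> nat set \<Rightarrow> nat set set \<Rightarrow> (nat \<Rightarrow> nat) set" where
  "labelings q X P = {a \<in> X \<rightarrow>\<^sub>E {0..q}. \<forall>x\<in>X. \<forall>y\<in>X. a x = a y \<longleftrightarrow> same_block P x y}"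

text \<open>The root sits at \<open>Max X\<close>, in accordance with \<open>c(1) = n'\<close>: the
  step into the first point comes from the last one.\<close>

definition slide_sum :: "nat \<Rightarrow> nat set \<Rightarrow> nat set set \<Rightarrow> nat pperm \<Rightarrow>\<^sub>0 complex" where
  "slide_sum q X P = (\<Sum>a | a \<in> labelings q X P \<and> a (Max X) = 0.
     slide_term (map a (sorted_list_of_set X)))"

lemma restrict_labelings:
  assumes "a \<in> labelings q X P" "\<And>u. u \<in> {0..q} \<Longrightarrow> g u \<in> {0..q}" "inj g"
  shows "restrict (\<lambda>x. g (a x)) X \<in> labelings q X P"
proof -
  have "restrict (\<lambda>x. g (a x)) X \<in> X \<rightarrow>\<^sub>E {0..q}"
    using assms(1,2) unfolding labelings_def by (auto simp del: atLeastAtMost_iff)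
  then show ?thesis
    using assms(1) inj_eq[OF assms(3)] by (simp add: labelings_def)
qed

text \<open>The relabelling depends on \<open>a\<close> itself through \<open>a (Max X)\<close>, and
  yet it is a bijection onto the labelings rooted at \<open>0\<close>: the new label at
  \<open>Min X\<close> is \<open>inv V (a (Max X))\<close>, so the lost value can be read off from
  the result.\<close>

lemma slide_sum_loop:
  assumes "finite X" "X \<noteq> {}" and V: "V permutes {0..q}" "V 0 = v"
  shows "(\<Sum>a | a \<in> labelings q X P \<and> a (Min X) = v.
      slide_term (map (inv V \<circ> transpose v (a (Max X)) \<circ> a) (sorted_list_of_set X))) = slide_sum q X P"
proof -
  have bij: "bij V" "bij (inv V)"
    using V(1) by (auto intro: permutes_bij bij_imp_bij_inv)
  have VinvV: "V (inv V u) = u" and invVV: "inv V (V u) = u" for u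
    using bij(1) by (auto simp: bij_is_surj surj_f_inv_f bij_is_inj)
  have mem: "Min X \<in> X" "Max X \<in> X" using assms by simp_all
  have invv: "inv V v = 0" using invVV[of 0] V(2) by simp
  have Vin: "V u \<in> {0..q}" "inv V u \<in> {0..q}" if "u \<in> {0..q}" for u
    using that permutes_in_image[OF V(1)] permutes_in_image[OF permutes_inv[OF V(1)]] by blast+
  have tin: "transpose x y u \<in> {0..q}" if "u \<in> {0..q}" "x \<in> {0..q}" "y \<in> {0..q}" for x y u
    using that by (simp add: transpose_def)
  have vin: "v \<in> {0..q}" using Vin(1)[of 0] V(2) by simp
  define F where "F y = inv V \<circ> transpose v y" for y
  define G where "G y = transpose v (V y) \<circ> V" for y
  have inj: "inj (F y)" "inj (G y)" for y
    unfolding F_def G_def by (intro inj_compose bij_is_inj bij; simp)+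
  have FG_in: "F y u \<in> {0..q}" "G y u \<in> {0..q}" if "u \<in> {0..q}" "y \<in> {0..q}" for u y
    unfolding F_def G_def comp_apply by (intro Vin tin that vin)+
  have FG: "F (G y 0) (G y u) = u" "G (F y v) (F y u) = u" "F y y = 0" "G y y = v" for y u
    using V(2) by (simp_all add: F_def G_def VinvV invVV invv)
  define J where "J a = restrict (\<lambda>x. F (a (Max X)) (a x)) X" for a
  define K where "K a = restrict (\<lambda>x. G (a (Min X)) (a x)) X" for a
  have lab: "a x \<in> {0..q}" "a \<in> extensional X" if "a \<in> labelings q X P" "x \<in> X" for a x
    using that by (auto simp: labelings_def PiE_iff)
  have restr: "restrict a X = a" if "a \<in> labelings q X P" for a
    using that by (intro extensional_restrict) (simp add: labelings_def PiE_iff)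
  show ?thesis
    unfolding slide_sum_def
  proof (rule sum.reindex_bij_witness[where i = K and j = J])
    fix a assume a: "a \<in> {a \<in> labelings q X P. a (Min X) = v}"
    then have "J a \<in> labelings q X P"
      unfolding J_def using lab mem by (intro restrict_labelings FG_in inj) auto
    then show "J a \<in> {a \<in> labelings q X P. a (Max X) = 0}"
      using mem FG by (simp add: J_def)
    have "K (J a) = restrict a X"
      using a mem FG by (auto simp: K_def J_def fun_eq_iff restrict_def)
    then show "K (J a) = a"
      using a restr by simp
    show "slide_term (map (J a) (sorted_list_of_set X)) =
        slide_term (map (inv V \<circ> transpose v (a (Max X)) \<circ> a) (sorted_list_of_set X))"
      using assms(1) by (intro arg_cong[where f = slide_term] map_cong) (auto simp: J_def F_def)
  next
    fix b assume b: "b \<in> {a \<in> labelings q X P. a (Max X) = 0}"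
    then have "K b \<in> labelings q X P"
      unfolding K_def using lab mem by (intro restrict_labelings FG_in inj) auto
    then show "K b \<in> {a \<in> labelings q X P. a (Min X) = v}"
      using mem FG by (simp add: K_def)
    have "J (K b) = restrict b X"
      using b mem FG by (auto simp: K_def J_def fun_eq_iff restrict_def)
    then show "J (K b) = b"
      using b restr by simp
  qed
qed

section \<open>Conjugation by partial permutations and centrality of the walk sums\<close>

lift_definition pperm_fun :: "'a pperm \<Rightarrow> 'a \<Rightarrow> 'a" is snd .

lemma pperm_fun_permutes: "pperm_fun p permutes supp p"
  by transfer auto

lemma pperm_eqI: "supp p = supp p' \<Longrightarrow> pperm_fun p = pperm_fun p' \<Longrightarrow> p = p'"
  by transfer auto

lemma pperm_fun_plus: "pperm_fun (p + p') = pperm_fun p \<circ> pperm_fun p'"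
  by transfer auto

lemma supp_slide_pperm: "last (0 # ws) = 0 \<Longrightarrow> supp (slide_pperm ws) = set ws - {0}"
  by transfer simp

lemma pperm_fun_slide_pperm: "last (0 # ws) = 0 \<Longrightarrow> pperm_fun (slide_pperm ws) = slide 0 ws"
  by transfer simp

text \<open>As \<open>p\<close> fixes \<open>0\<close>, relabelling the walk by \<open>p\<close> is
  conjugation that keeps the root. The supports agree because \<open>p\<close> moves letters only
  inside its own support, which is joined to the walk's letters on both sides.\<close>

lemma slide_pperm_conj:
  assumes "0 \<notin> supp p" and last: "last (0 # ws) = 0"
  shows "p + slide_pperm ws = slide_pperm (map (pperm_fun p) ws) + p"
proof (rule pperm_eqI)
  let ?w = "pperm_fun p"
  have bij: "bij ?w" and w0: "?w 0 = 0"
    using permutes_bij[OF pperm_fun_permutes] permutes_not_in[OF pperm_fun_permutes] assms(1) by auto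
  then have last': "last (0 # map ?w ws) = 0"
    using last by (auto simp: last_map split: if_splits)
  show "pperm_fun (p + slide_pperm ws) = pperm_fun (slide_pperm (map ?w ws) + p)"
    using slide_map[OF bij, of 0 ws] w0
    by (simp add: pperm_fun_plus pperm_fun_slide_pperm last last' del: last.simps)
  have out: "?w x = x" if "x \<notin> supp p" for x
    using pperm_fun_permutes that by (rule permutes_not_in)
  have "?w x \<in> supp p \<longleftrightarrow> x \<in> supp p" for x
    using pperm_fun_permutes by (rule permutes_in_image)
  then have "supp p \<union> (set ws - {0}) = (?w ` set ws - {0}) \<union> supp p"
    using out w0 assms(1) by (auto simp: image_iff) metis+
  then show "supp (p + slide_pperm ws) = supp (slide_pperm (map ?w ws) + p)"
    using supp_slide_pperm[OF last] supp_slide_pperm[OF last'] by simp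
qed

lemma slide_term_conj:
  assumes "0 \<notin> supp p" and "last (0 # ws) = 0"
  shows "Poly_Mapping.single p c * slide_term ws =
    slide_term (map (pperm_fun p) ws) * Poly_Mapping.single p c"
proof -
  let ?w = "pperm_fun p"
  have "bij ?w" using pperm_fun_permutes by (rule permutes_bij)
  then have inj: "inj_on ?w A" for A
    by (metis bij_def inj_on_subset subset_UNIV)
  have "distinct_adj (last (map ?w ws) # map ?w ws) \<longleftrightarrow> distinct_adj (last ws # ws)"
  proof (cases "ws = []")
    case False
    then show ?thesis
      using distinct_adj_map_iff[OF inj, of "last ws # ws"] by (simp add: last_map)
  qed simp
  then show ?thesis
    using slide_pperm_conj[OF assms] by (simp add: slide_term_def mult_single)
qed

lemma sorted_list_of_set_eqI:
  fixes X :: "nat set"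
  shows "sorted_wrt (<) xs \<Longrightarrow> set xs = X \<Longrightarrow> sorted_list_of_set X = xs"
  by (metis list.set_finite sorted_list_of_set.sorted_key_list_of_set_unique strict_sorted_equal)

lemma sorted_list_of_set_Icc: "sorted_list_of_set {1..n} = [1..<Suc n]"
  by (rule sorted_list_of_set_eqI) (auto simp del: upt_Suc)

lemma last_sorted_list_of_set:
  fixes X :: "nat set"
  assumes "finite X" "X \<noteq> {}"
  shows "last (sorted_list_of_set X) = Max X"
proof (rule Max_eqI[symmetric])
  have ne: "sorted_list_of_set X \<noteq> []" using assms by simp
  show "last (sorted_list_of_set X) \<in> X"
    using last_in_set[OF ne] assms(1) by simp
  fix y assume "y \<in> X"
  then obtain i where "i < length (sorted_list_of_set X)" "sorted_list_of_set X ! i = y"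
    using assms(1) by (metis in_set_conv_nth set_sorted_list_of_set)
  then show "y \<le> last (sorted_list_of_set X)"
    by (metis One_nat_def Suc_pred last_conv_nth less_Suc_eq_le less_nat_zero_code
        linorder_neqE_nat list.size(3) sorted_list_of_set(2) sorted_nth_mono diff_less zero_less_one)
qed (use assms in simp)

lemma last_map_sorted_list_of_set:
  fixes X :: "nat set"
  assumes "finite X" "X \<noteq> {}"
  shows "last (map a (sorted_list_of_set X)) = a (Max X)"
    and "last (c # map a (sorted_list_of_set X)) = a (Max X)"
  using assms by (simp_all add: last_map last_sorted_list_of_set)

lemma slide_sum_in_pperm_algebra:
  assumes "finite X" "X \<noteq> {}"
  shows "slide_sum q X P \<in> pperm_algebra {1..q}"
proof -
  have "theta {1..q} (slide_term (map a (sorted_list_of_set X))) = slide_term (map a (sorted_list_of_set X))"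
    if "a \<in> labelings q X P" "a (Max X) = 0" for a
  proof -
    have "last (0 # map a (sorted_list_of_set X)) = 0"
      using that(2) last_map_sorted_list_of_set[OF assms] by metis
    note supp = supp_slide_pperm[OF this]
    have "a ` X - {0} \<subseteq> {1..q}"
      using that(1) by (auto simp: labelings_def Suc_le_eq)
    then show ?thesis
      using supp assms(1) by (simp add: slide_term_def theta_single)
  qed
  then show ?thesis
    by (simp add: slide_sum_def in_pperm_algebra_iff theta_sum)
qed

text \<open>Conjugation only permutes the summands: composing with the permutation of
  \<open>p\<close>, which preserves \<open>0\<close> and \<open>{0..q}\<close>, is a bijection of
  the labelings with kernel \<open>P\<close> and root label \<open>0\<close>.\<close>

lemma slide_sum_conj:
  assumes "finite X" "X \<noteq> {}" "supp p \<subseteq> {1..q}"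
  shows "Poly_Mapping.single p c * slide_sum q X P = slide_sum q X P * Poly_Mapping.single p c"
proof -
  let ?w = "pperm_fun p"
  have "?w permutes {0..q}"
    by (rule permutes_subset[OF pperm_fun_permutes]) (use assms(3) in auto)
  then have w_in: "?w u \<in> {0..q} \<longleftrightarrow> u \<in> {0..q}" and invw: "inv ?w permutes {0..q}" for u
    by (auto simp only: permutes_in_image permutes_inv)
  have invw_in: "inv ?w u \<in> {0..q} \<longleftrightarrow> u \<in> {0..q}" for u
    by (rule permutes_in_image[OF invw])
  have bij: "bij ?w" "bij (inv ?w)"
    using permutes_bij[OF pperm_fun_permutes] by (auto intro: bij_imp_bij_inv)
  have wi: "?w (inv ?w u) = u" "inv ?w (?w u) = u" for u
    using bij(1) by (auto simp: bij_is_surj surj_f_inv_f bij_is_inj)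
  have supp0: "0 \<notin> supp p" using assms(3) by auto
  then have w0: "?w 0 = 0" by (rule permutes_not_in[OF pperm_fun_permutes])
  then have iw0: "inv ?w 0 = 0" using wi(2)[of 0] by simp
  have mem: "Max X \<in> X" using assms by simp
  have restr: "restrict a X = a" if "a \<in> labelings q X P" for a
    using that by (intro extensional_restrict) (simp add: labelings_def PiE_iff)
  have "Poly_Mapping.single p c * slide_sum q X P = (\<Sum>a | a \<in> labelings q X P \<and> a (Max X) = 0.
      Poly_Mapping.single p c * slide_term (map a (sorted_list_of_set X)))"
    by (simp add: slide_sum_def sum_distrib_left)
  also have "\<dots> = (\<Sum>a | a \<in> labelings q X P \<and> a (Max X) = 0.
      slide_term (map (?w \<circ> a) (sorted_list_of_set X)) * Poly_Mapping.single p c)"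
  proof (rule sum.cong)
    fix a assume "a \<in> {a \<in> labelings q X P. a (Max X) = 0}"
    then have "last (0 # map a (sorted_list_of_set X)) = 0"
      by (simp add: last_map_sorted_list_of_set(2)[OF assms(1,2)] del: last.simps)
    from slide_term_conj[OF supp0 this]
    show "Poly_Mapping.single p c * slide_term (map a (sorted_list_of_set X)) =
        slide_term (map (?w \<circ> a) (sorted_list_of_set X)) * Poly_Mapping.single p c"
      by simp
  qed simp
  also have "\<dots> = (\<Sum>a | a \<in> labelings q X P \<and> a (Max X) = 0.
      slide_term (map a (sorted_list_of_set X)) * Poly_Mapping.single p c)"
  proof (rule sum.reindex_bij_witness
      [where j = "\<lambda>a. restrict (\<lambda>x. ?w (a x)) X" and i = "\<lambda>a. restrict (\<lambda>x. inv ?w (a x)) X"])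
    fix a assume a: "a \<in> {a \<in> labelings q X P. a (Max X) = 0}"
    then have "restrict (\<lambda>x. ?w (a x)) X \<in> labelings q X P"
      by (intro restrict_labelings) (auto simp only: w_in bij_is_inj bij)
    then show "restrict (\<lambda>x. ?w (a x)) X \<in> {a \<in> labelings q X P. a (Max X) = 0}"
      using a mem w0 by simp
    have "restrict (\<lambda>x. inv ?w (a x)) X \<in> labelings q X P"
      using a by (intro restrict_labelings) (auto simp only: invw_in bij_is_inj bij)
    then show "restrict (\<lambda>x. inv ?w (a x)) X \<in> {a \<in> labelings q X P. a (Max X) = 0}"
      using a mem iw0 by simp
    have "restrict (\<lambda>x. inv ?w ((restrict (\<lambda>x. ?w (a x)) X) x)) X = restrict a X"
      "restrict (\<lambda>x. ?w ((restrict (\<lambda>x. inv ?w (a x)) X) x)) X = restrict a X"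
      by (auto simp: wi)
    then show "restrict (\<lambda>x. inv ?w ((restrict (\<lambda>x. ?w (a x)) X) x)) X = a"
      "restrict (\<lambda>x. ?w ((restrict (\<lambda>x. inv ?w (a x)) X) x)) X = a"
      using a restr by auto
    have "map (restrict (\<lambda>x. ?w (a x)) X) (sorted_list_of_set X) = map (?w \<circ> a) (sorted_list_of_set X)"
      using assms(1) by simp
    then show "slide_term (map (restrict (\<lambda>x. ?w (a x)) X) (sorted_list_of_set X)) * Poly_Mapping.single p c =
        slide_term (map (?w \<circ> a) (sorted_list_of_set X)) * Poly_Mapping.single p c"
      by (simp only:)
  qed
  also have "\<dots> = slide_sum q X P * Poly_Mapping.single p c"
    by (simp add: slide_sum_def sum_distrib_right)
  finally show ?thesis .
qed

lemma slide_sum_commute: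
  assumes "finite X" "X \<noteq> {}" "f \<in> pperm_algebra {1..q}"
  shows "f * slide_sum q X P = slide_sum q X P * f"
proof -
  have f: "(\<Sum>p \<in> Poly_Mapping.keys f. Poly_Mapping.single p (Poly_Mapping.lookup f p)) = f"
  proof -
    have "theta UNIV f = f" by (simp flip: in_pperm_algebra_iff add: pperm_algebra_def)
    then show ?thesis by (simp add: theta_def)
  qed
  have "(\<Sum>p \<in> Poly_Mapping.keys f. Poly_Mapping.single p (Poly_Mapping.lookup f p)) * slide_sum q X P =
      slide_sum q X P * (\<Sum>p \<in> Poly_Mapping.keys f. Poly_Mapping.single p (Poly_Mapping.lookup f p))"
    unfolding sum_distrib_left sum_distrib_right using assms
    by (intro sum.cong slide_sum_conj) (auto simp: pperm_algebra_def)
  then show ?thesis by (simp only: f)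
qed

section \<open>Products over a non-crossing partition\<close>

text \<open>Condition (2) of the ordered product in terms of labels. It avoids the Kreweras
  complement, so that it makes sense on any set \<open>X\<close> of numbers and survives the removal
  of blocks.\<close>

definition glued :: "nat set \<Rightarrow> nat set set \<Rightarrow> (nat \<Rightarrow> nat) \<Rightarrow> bool" where
  "glued X Q a \<longleftrightarrow> (\<forall>x\<in>X. \<forall>y\<in>X. x \<le> y \<longrightarrow>
     (\<forall>B\<in>Q. B \<subseteq> {x..<y} \<or> B \<inter> {x..<y} = {}) \<longrightarrow> a x = a y)"

lemma gluedD:
  "glued X Q a \<Longrightarrow> x \<in> X \<Longrightarrow> y \<in> X \<Longrightarrow> x \<le> y \<Longrightarrow>
    (\<And>B. B \<in> Q \<Longrightarrow> B \<subseteq> {x..<y} \<or> B \<inter> {x..<y} = {}) \<Longrightarrow> a x = a y"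
  unfolding glued_def by blast

lemma glued_cong: "(\<And>x. x \<in> X \<Longrightarrow> a x = b x) \<Longrightarrow> glued X Q a \<longleftrightarrow> glued X Q b"
  by (simp add: glued_def)

text \<open>A non-empty \<open>{x..<y}\<close> contains \<open>x\<close> but not \<open>y\<close>,
  hence cuts the only block.\<close>

lemma glued_single: "glued X {X} a"
  unfolding glued_def
proof (intro ballI impI)
  fix x y assume xy: "x \<in> X" "y \<in> X" "x \<le> y"
    and "\<forall>B\<in>{X}. B \<subseteq> {x..<y} \<or> B \<inter> {x..<y} = {}"
  then have "\<not> x < y" by (metis atLeastLessThan_iff disjoint_iff insertI1 less_irrefl order_refl subsetD)
  with xy show "a x = a y" by simp
qed

text \<open>In the interval block \<open>I\<close> only the minimum can take part in a gluing, since
  any other endpoint in \<open>I\<close> would cut \<open>I\<close>. The minimum in turn is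
  interchangeable with \<open>y0\<close>, the point of \<open>X\<close> following \<open>I\<close>,
  because exactly the block \<open>I\<close> lies between them.\<close>

lemma glued_insert_interval:
  assumes I: "finite I" "I \<noteq> {}" "I \<subseteq> X"
    and interval: "\<And>x. x \<in> X \<Longrightarrow> Min I \<le> x \<Longrightarrow> x \<le> Max I \<Longrightarrow> x \<in> I"
    and y0: "y0 \<in> X" "Max I < y0" "\<And>x. x \<in> X \<Longrightarrow> Max I < x \<Longrightarrow> y0 \<le> x"
    and Q: "\<And>B. B \<in> Q \<Longrightarrow> B \<subseteq> X - I"
  shows "glued X (insert I Q) a \<longleftrightarrow> a (Min I) = a y0 \<and> glued (X - I) Q a"
proof
  have MinI: "Min I \<in> I" and MaxI: "Max I \<in> I" using I by simp_all
  have bnd: "Min I \<le> z \<and> z \<le> Max I" if "z \<in> I" for z using that I by simp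
  have y0I: "y0 \<notin> I" using bnd y0(2) by force
  {
    assume G: "glued X (insert I Q) a"
    have "a (Min I) = a y0"
    proof (rule gluedD[OF G])
      fix B assume "B \<in> insert I Q"
      then show "B \<subseteq> {Min I..<y0} \<or> B \<inter> {Min I..<y0} = {}"
      proof
        assume "B = I" then show ?thesis using bnd y0(2) by force
      next
        assume B: "B \<in> Q"
        have False if "x \<in> B" "Min I \<le> x" "x < y0" for x
          using that Q[OF B] interval[of x] y0(3)[of x] by (cases "x \<le> Max I") auto
        then show ?thesis by auto
      qed
    next
      show "Min I \<in> X" "y0 \<in> X" using MinI I(3) y0 by auto
      show "Min I \<le> y0" using bnd[OF MaxI] y0(2) by linarith
    qed
    moreover have "glued (X - I) Q a"
      unfolding glued_def
    proof (intro ballI impI)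
      fix x y assume xy: "x \<in> X - I" "y \<in> X - I" "x \<le> y"
        and S: "\<forall>B\<in>Q. B \<subseteq> {x..<y} \<or> B \<inter> {x..<y} = {}"
      have "I \<subseteq> {x..<y} \<or> I \<inter> {x..<y} = {}"
      proof (cases "x < Min I \<and> Max I < y")
        case True then show ?thesis using bnd by force
      next
        case False
        then have "Max I < x \<or> y < Min I"
          using xy interval[of x] interval[of y] bnd by (meson DiffD1 DiffD2 MinI linorder_not_le order.trans)
        then show ?thesis using bnd by force
      qed
      then show "a x = a y"
        using xy S by (intro gluedD[OF G]) auto
    qed
    ultimately show "a (Min I) = a y0 \<and> glued (X - I) Q a" ..
  }
  {
    assume "a (Min I) = a y0 \<and> glued (X - I) Q a"
    then have eq: "a (Min I) = a y0" and G: "glued (X - I) Q a" by auto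
    show "glued X (insert I Q) a"
      unfolding glued_def
    proof (intro ballI impI)
      fix x y assume xy: "x \<in> X" "y \<in> X" "x \<le> y"
        and S: "\<forall>B\<in>insert I Q. B \<subseteq> {x..<y} \<or> B \<inter> {x..<y} = {}"
      consider "x = y" | "x \<noteq> y" "x \<in> I" | "x \<noteq> y" "x \<notin> I" "y \<in> I" | "x \<notin> I" "y \<notin> I" by blast
      then show "a x = a y"
      proof cases
        case 2
        then have Isub: "I \<subseteq> {x..<y}" using S xy(3) by force
        then have x: "x = Min I" using bnd[OF 2(2)] MinI by force
        have "Max I < y" using Isub MaxI by auto
        then have y: "y \<notin> I" "y0 \<le> y" using bnd y0(3) xy(2) by force+
        have "a y0 = a y"
        proof (rule gluedD[OF G])
          fix B assume B: "B \<in> Q"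
          have "z \<ge> y0" if "z \<in> B" "x \<le> z" for z
            using that Q[OF B] interval[of z] y0(3)[of z] x by (cases "z \<le> Max I") auto
          moreover have "x \<le> z" if "y0 \<le> z" for z
            using that y0(2) bnd MinI x by (meson less_imp_le order.trans)
          ultimately have "z \<in> {y0..<y} \<longleftrightarrow> z \<in> {x..<y}" if "z \<in> B" for z
            using that by auto
          then show "B \<subseteq> {y0..<y} \<or> B \<inter> {y0..<y} = {}"
            using S B by blast
        qed (use y y0 y0I xy in auto)
        then show ?thesis using eq x by simp
      next
        case 3
        then have disj: "I \<inter> {x..<y} = {}" using S xy(3) by force
        have "x < Min I" using 3 xy interval[of x] bnd by force
        then have y: "y = Min I"
          using disj MinI bnd[OF 3(3)] by force
        have "a x = a y0"
        proof (rule gluedD[OF G])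
          fix B assume B: "B \<in> Q"
          have "z < y" if "z \<in> B" "z < y0" for z
            using that Q[OF B] interval[of z] y0(3)[of z] y
            by (cases "z \<le> Max I"; cases "z < Min I") auto
          moreover have "z < y0" if "z < y" for z
            using that y0(2) bnd MaxI y by force
          ultimately have "z \<in> {x..<y0} \<longleftrightarrow> z \<in> {x..<y}" if "z \<in> B" for z
            using that by auto
          then show "B \<subseteq> {x..<y0} \<or> B \<inter> {x..<y0} = {}"
            using S B by blast
        next
          show "x \<le> y0" using \<open>x < Min I\<close> bnd[OF MaxI] y0(2) by linarith
        qed (use 3 y0 y0I xy in auto)
        then show ?thesis using eq y by simp
      next
        case 4
        then show ?thesis using xy S by (intro gluedD[OF G]) auto
      qed simp
    qed
  }
qed

section \<open>Interval blocks of non-crossing partitions\<close>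

lemma noncrossingD:
  assumes "noncrossing P" "B \<in> P" "C \<in> P" "B \<noteq> C" "a \<in> B" "b \<in> C" "c \<in> B" "d \<in> C"
    "a < b" "b < c" "c < d"
  shows False
proof -
  have "\<exists>X\<in>P. \<exists>Y\<in>P. X \<noteq> Y \<and>
      (\<exists>a b c d. a < b \<and> b < c \<and> c < d \<and> a \<in> X \<and> c \<in> X \<and> b \<in> Y \<and> d \<in> Y)"
    by (rule bexI[of _ B], rule bexI[of _ C], rule conjI,
        rule_tac [2] exI[of _ a], rule_tac [2] exI[of _ b], rule_tac [2] exI[of _ c], rule_tac [2] exI[of _ d])
      (use assms in simp_all)
  with assms(1)[unfolded noncrossing_def] show False
    by (rule notE)
qed

lemma noncrossing_subset:
  assumes "noncrossing P" "Q \<subseteq> P"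
  shows "noncrossing Q"
  unfolding noncrossing_def
proof (rule notI, elim bexE conjE exE)
  fix B C a b c d
  assume "B \<in> Q" "C \<in> Q" "B \<noteq> C" "a \<in> B" "b \<in> C" "c \<in> B" "d \<in> C" "a < b" "b < c" "c < d"
  then show False
    using noncrossingD[OF assms(1), of B C a b c d] subsetD[OF assms(2)] by simp
qed

text \<open>Take a block of least spread among those avoiding \<open>Max X\<close>. A foreign point
  in its range would, by non-crossing, bring its whole block strictly inside, with smaller spread.
  Avoiding \<open>Max X\<close> keeps the root in place and ensures that there is a next point at
  which the loop closes.\<close>

lemma noncrossing_interval_block:
  fixes X :: "nat set"
  assumes "finite X" "partition_on X P" "noncrossing P" "B0 \<in> P" "Max X \<notin> B0"
  obtains I where "I \<in> P" "Max X \<notin> I" "\<And>x. x \<in> X \<Longrightarrow> Min I \<le> x \<Longrightarrow> x \<le> Max I \<Longrightarrow> x \<in> I"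
proof -
  have blocks: "finite B \<and> B \<noteq> {} \<and> B \<subseteq> X" if "B \<in> P" for B
    using that assms(1,2) by (metis Union_upper finite_subset partition_onD1 partition_onD3)
  obtain I where I: "I \<in> P" "Max X \<notin> I"
    and least: "\<And>B. B \<in> P \<Longrightarrow> Max X \<notin> B \<Longrightarrow> Max I - Min I \<le> Max B - Min B"
    using ex_has_least_nat[of "\<lambda>B. B \<in> P \<and> Max X \<notin> B" B0 "\<lambda>B. Max B - Min B"] assms(4,5) by blast
  have mem: "Min I \<in> I" "Max I \<in> I" using blocks[OF I(1)] by auto
  have "x \<in> I" if x: "x \<in> X" "Min I \<le> x" "x \<le> Max I" for x
  proof (rule ccontr)
    assume "x \<notin> I"
    then have lt: "Min I < x" "x < Max I" using x mem by (metis le_neq_implies_less)+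
    obtain J where J: "J \<in> P" "x \<in> J" using x(1) assms(2) by (auto simp: partition_on_def)
    have "J \<noteq> I" using J \<open>x \<notin> I\<close> by auto
    then have disj: "J \<inter> I = {}" using J I assms(2) by (auto simp: partition_on_def disjoint_def)
    have within: "Min I < z \<and> z < Max I" if z: "z \<in> J" for z
    proof -
      have "\<not> z < Min I"
        using noncrossingD[OF assms(3) J(1) I(1) \<open>J \<noteq> I\<close> z mem(1) J(2) mem(2)] lt by blast
      moreover have "\<not> Max I < z"
        using noncrossingD[OF assms(3) I(1) J(1) \<open>J \<noteq> I\<close>[symmetric] mem(1) J(2) mem(2) z] lt by blast
      ultimately show ?thesis using disj z mem by (metis disjoint_iff linorder_neqE_nat)
    qed
    have "Min J \<in> J" "Max J \<in> J" using blocks[OF J(1)] by auto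
    then have MM: "Min I < Min J" "Max J < Max I" "Min J \<le> Max J"
      using blocks[OF J(1)] within by (blast, blast, simp)
    moreover have "Max X \<notin> J"
    proof
      assume "Max X \<in> J"
      then have "Max X < Max I" using within by simp
      moreover have "Max I \<le> Max X" using mem blocks[OF I(1)] assms(1) by auto
      ultimately show False by simp
    qed
    ultimately show False using least[OF J(1)] by linarith
  qed
  with I that show ?thesis by blast
qed

text \<open>Condition (1) of the ordered product, expressed for the kernel of
  \<open>a\<close>.\<close>

definition labels_blocks ::
    "('s \<Rightarrow> nat set) \<Rightarrow> ('s \<Rightarrow> nat set set) \<Rightarrow> 's set \<Rightarrow> (nat \<Rightarrow> nat) \<Rightarrow> bool" where
  "labels_blocks \<rho> \<pi> R a \<longleftrightarrow>
     (\<forall>s\<in>R. \<forall>x\<in>\<rho> s. \<forall>y\<in>\<rho> s. a x = a y \<longleftrightarrow> same_block (\<pi> s) x y)"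

text \<open>A labeling of \<open>X\<close> amounts to one of \<open>X - I\<close> and one of
  \<open>I\<close> whose label at \<open>Min I\<close> is that of the next point \<open>y0\<close>.
  Its walk is the walk of \<open>X - I\<close> with a loop inserted before \<open>y0\<close>;
  \<open>slide_term_insert_loop\<close> factors each term, and by \<open>slide_sum_loop\<close> the
  sum over the loop does not depend on the outer labeling.\<close>

lemma sum_glued_insert:
  fixes X I :: "nat set" and \<rho> :: "nat \<Rightarrow> nat set"
  assumes X: "finite X" and I: "I \<noteq> {}" "I \<subseteq> X" "Max X \<notin> I" "\<rho> i = I"
    and interval: "\<And>x. x \<in> X \<Longrightarrow> Min I \<le> x \<Longrightarrow> x \<le> Max I \<Longrightarrow> x \<in> I"
    and R: "\<And>s. s \<in> R \<Longrightarrow> \<rho> s \<subseteq> X - I"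
  shows "(\<Sum>a | a \<in> X \<rightarrow>\<^sub>E {0..q} \<and> a (Max X) = 0 \<and> glued X (\<rho> ` insert i R) a \<and> labels_blocks \<rho> \<pi> (insert i R) a.
      slide_term (map a (sorted_list_of_set X))) =
    (\<Sum>a | a \<in> (X - I) \<rightarrow>\<^sub>E {0..q} \<and> a (Max (X - I)) = 0 \<and> glued (X - I) (\<rho> ` R) a \<and> labels_blocks \<rho> \<pi> R a.
      slide_term (map a (sorted_list_of_set (X - I)))) * slide_sum q I (\<pi> i)"
    (is "sum ?term ?big = sum ?term' ?small * _")
proof -
  have finI: "finite I" using I X finite_subset by blast
  have MinI: "Min I \<in> I" and MaxI: "Max I \<in> I" using I finI by simp_all
  have bnd: "Min I \<le> z \<and> z \<le> Max I" if "z \<in> I" for z using that finI by simp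
  define us where "us = sorted_list_of_set {x \<in> X. x < Min I}"
  define ws where "ws = sorted_list_of_set {x \<in> X. Max I < x}"
  define y0 where "y0 = Min {x \<in> X. Max I < x}"
  define vs where "vs = sorted_list_of_set ({x \<in> X. Max I < x} - {y0})"
  define ms where "ms = sorted_list_of_set (I - {Min I})"
  have MX: "Max X \<in> {x \<in> X. Max I < x}"
  proof -
    have "Max X \<in> X" using I X by (intro Max_in) auto
    moreover have "Max I \<le> Max X" using I X MaxI by (intro Max_ge) auto
    ultimately show ?thesis using I MaxI by (auto simp: order_le_less)
  qed
  then have ws: "ws = y0 # vs"
    unfolding ws_def vs_def y0_def using X by (intro sorted_list_of_set_nonempty) auto
  have y0: "y0 \<in> X" "Max I < y0" "\<And>x. x \<in> X \<Longrightarrow> Max I < x \<Longrightarrow> y0 \<le> x"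
  proof -
    have "y0 \<in> {x \<in> X. Max I < x}"
      unfolding y0_def using MX X by (intro Min_in) auto
    then show "y0 \<in> X" "Max I < y0" by auto
    show "y0 \<le> x" if "x \<in> X" "Max I < x" for x
      unfolding y0_def using that X by (intro Min_le) auto
  qed
  have ms: "sorted_list_of_set I = Min I # ms"
    unfolding ms_def using finI I(1) by (intro sorted_list_of_set_nonempty) auto
  have sets: "set us = {x \<in> X. x < Min I}" "set ws = {x \<in> X. Max I < x}"
    using X by (auto simp: us_def ws_def)
  have sorted: "sorted_wrt (<) us" "sorted_wrt (<) ws"
    by (simp_all add: us_def ws_def)
  have below: "x < z" if "x < Min I" "z \<in> I" for x z using bnd[OF that(2)] that(1) by simp
  have above: "z < x" if "Max I < x" "z \<in> I" for x z using bnd[OF that(2)] that(1) by simp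
  have across: "x < z" if "x < Min I" "Max I < z" for x z using bnd[OF MaxI] that by linarith
  have trichotomy: "x < Min I \<or> x \<in> I \<or> Max I < x" if "x \<in> X" for x
    using interval[OF that] by linarith
  \<comment> \<open>As \<open>I\<close> is an interval of \<open>X\<close>, its labels form a
    contiguous stretch of the walk, directly followed by the label of \<open>y0\<close>.\<close>
  have sX: "sorted_list_of_set X = us @ sorted_list_of_set I @ ws"
  proof (rule sorted_list_of_set_eqI)
    show "sorted_wrt (<) (us @ sorted_list_of_set I @ ws)"
      unfolding sorted_wrt_append set_append sets
    proof (intro conjI ballI sorted)
      show "x < y" if "x \<in> {x \<in> X. x < Min I}" "y \<in> set (sorted_list_of_set I) \<union> {x \<in> X. Max I < x}" for x y
        using that below[of x y] across[of x y] finI by fastforce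
      show "x < y" if "x \<in> set (sorted_list_of_set I)" "y \<in> {x \<in> X. Max I < x}" for x y
        using that above[of y x] finI by simp
    qed simp
    show "set (us @ sorted_list_of_set I @ ws) = X"
      unfolding set_append sets set_sorted_list_of_set[OF finI] using I(2) trichotomy by blast
  qed
  have sXI: "sorted_list_of_set (X - I) = us @ ws"
  proof (rule sorted_list_of_set_eqI)
    show "sorted_wrt (<) (us @ ws)"
      unfolding sorted_wrt_append sets using across by (intro conjI ballI sorted) blast
    show "set (us @ ws) = X - I"
      unfolding set_append sets using below above trichotomy by blast
  qed
  have MaxXI: "Max (X - I) = Max X"
    using X I MX by (intro Max_eqI) auto
  have lastvs: "last (y0 # vs) = Max X"
  proof -
    have "last (sorted_list_of_set X) = Max X" using X I(1,2) by (intro last_sorted_list_of_set) auto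
    then show ?thesis by (simp add: sX ws)
  qed
  define cmb where "cmb a b = (\<lambda>x. if x \<in> I then b x else a x)" for a b :: "nat \<Rightarrow> nat"
  have glued_iff: "glued X (\<rho> ` insert i R) a \<longleftrightarrow> a (Min I) = a y0 \<and> glued (X - I) (\<rho> ` R) a" for a
    unfolding image_insert I(4) by (rule glued_insert_interval[OF finI I(1,2) interval y0]) (use R in blast)+
  have blocks_iff: "labels_blocks \<rho> \<pi> (insert i R) a \<longleftrightarrow>
      (\<forall>x\<in>I. \<forall>y\<in>I. a x = a y \<longleftrightarrow> same_block (\<pi> i) x y) \<and> labels_blocks \<rho> \<pi> R a" for a
    using I(4) by (auto simp: labels_blocks_def)
  have blocks_cong: "labels_blocks \<rho> \<pi> R a \<longleftrightarrow> labels_blocks \<rho> \<pi> R b"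
    if eq: "\<And>x. x \<in> X - I \<Longrightarrow> a x = b x" for a b
    unfolding labels_blocks_def by (intro ball_cong refl) (metis R eq subsetD)
  have y0I: "y0 \<in> X - I" using y0 bnd by force
  have fin: "finite ?small" "finite {b \<in> labelings q I P. b (Min I) = c}" for P c
  proof -
    show "finite ?small"
      by (rule finite_subset[of _ "(X - I) \<rightarrow>\<^sub>E {0..q}"]) (use X in \<open>auto intro: finite_PiE\<close>)
    show "finite {b \<in> labelings q I P. b (Min I) = c}"
      by (rule finite_subset[of _ "I \<rightarrow>\<^sub>E {0..q}"]) (use finI in \<open>auto simp: labelings_def intro: finite_PiE\<close>)
  qed
  have "sum ?term ?big = (\<Sum>(a, b) \<in> (SIGMA a:?small. {b \<in> labelings q I (\<pi> i). b (Min I) = a y0}).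
      ?term (cmb a b))"
  proof (rule sum.reindex_bij_witness[where i = "\<lambda>(a, b). cmb a b"
        and j = "\<lambda>a. (restrict a (X - I), restrict a I)"])
    fix a assume a: "a \<in> ?big"
    then have aPi: "a \<in> X \<rightarrow>\<^sub>E {0..q}" and a0: "a (Max X) = 0" and "glued X (\<rho> ` insert i R) a"
      and "labels_blocks \<rho> \<pi> (insert i R) a" by auto
    note gl = this(3)[unfolded glued_iff] and bl = this(4)[unfolded blocks_iff]
    show eq: "(case (restrict a (X - I), restrict a I) of (a, b) \<Rightarrow> cmb a b) = a"
    proof
      show "(case (restrict a (X - I), restrict a I) of (a, b) \<Rightarrow> cmb a b) x = a x" for x
        using I(2) PiE_arb[OF aPi, of x] by (cases "x \<in> I"; cases "x \<in> X") (auto simp: cmb_def)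
    qed
    have "glued (X - I) (\<rho> ` R) (restrict a (X - I))"
      using gl glued_cong[of "X - I" "restrict a (X - I)" a] by simp
    moreover have "labels_blocks \<rho> \<pi> R (restrict a (X - I))"
      using bl blocks_cong[of "restrict a (X - I)" a] by simp
    moreover have "restrict a (X - I) \<in> (X - I) \<rightarrow>\<^sub>E {0..q}" "restrict a I \<in> I \<rightarrow>\<^sub>E {0..q}"
      using aPi I(2) by (auto simp del: atLeastAtMost_iff)
    moreover have "restrict a (X - I) (Max (X - I)) = 0"
      using a0 MaxXI MX I(3) by simp
    moreover have "restrict a I \<in> labelings q I (\<pi> i)"
      using calculation(4) bl by (simp add: labelings_def)
    moreover have "restrict a I (Min I) = restrict a (X - I) y0"
      using gl MinI y0I by simp
    ultimately show "(restrict a (X - I), restrict a I) \<in>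
        (SIGMA a:?small. {b \<in> labelings q I (\<pi> i). b (Min I) = a y0})"
      by blast
    show "(case (restrict a (X - I), restrict a I) of (a, b) \<Rightarrow> ?term (cmb a b)) = ?term a"
      using eq by simp
  next
    fix p assume "p \<in> (SIGMA a:?small. {b \<in> labelings q I (\<pi> i). b (Min I) = a y0})"
    then obtain a b where p: "p = (a, b)" and a: "a \<in> ?small" and b: "b \<in> labelings q I (\<pi> i)"
      and ab: "b (Min I) = a y0" by blast
    have aPi: "a \<in> (X - I) \<rightarrow>\<^sub>E {0..q}" and bPi: "b \<in> I \<rightarrow>\<^sub>E {0..q}"
      using a b by (simp_all add: labelings_def)
    have ca: "cmb a b x = a x" if "x \<in> X - I" for x using that by (simp add: cmb_def)
    have cb: "cmb a b x = b x" if "x \<in> I" for x using that by (simp add: cmb_def)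
    have "restrict (cmb a b) (X - I) = a"
    proof
      show "restrict (cmb a b) (X - I) x = a x" for x
        using ca PiE_arb[OF aPi, of x] by (cases "x \<in> X - I") auto
    qed
    moreover have "restrict (cmb a b) I = b"
    proof
      show "restrict (cmb a b) I x = b x" for x
        using cb PiE_arb[OF bPi, of x] by (cases "x \<in> I") auto
    qed
    ultimately show "(restrict (case p of (a, b) \<Rightarrow> cmb a b) (X - I),
        restrict (case p of (a, b) \<Rightarrow> cmb a b) I) = p"
      using p by simp
    have "glued (X - I) (\<rho> ` R) (cmb a b)" "labels_blocks \<rho> \<pi> R (cmb a b)"
      using a glued_cong[of "X - I" "cmb a b" a] blocks_cong[of "cmb a b" a] ca by simp_all
    moreover have "cmb a b \<in> X \<rightarrow>\<^sub>E {0..q}"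
    proof (rule PiE_I)
      show "cmb a b x \<in> {0..q}" if "x \<in> X" for x
        using that PiE_mem[OF aPi, of x] PiE_mem[OF bPi, of x] by (simp add: cmb_def)
      show "cmb a b x = undefined" if "x \<notin> X" for x
        using that I(2) PiE_arb[OF aPi, of x] by (auto simp: cmb_def)
    qed
    moreover have "cmb a b (Max X) = 0" using a MaxXI I(3) by (simp add: cmb_def)
    moreover have "cmb a b (Min I) = cmb a b y0" using ab MinI y0I by (simp add: cmb_def)
    moreover have "\<forall>x\<in>I. \<forall>y\<in>I. cmb a b x = cmb a b y \<longleftrightarrow> same_block (\<pi> i) x y"
      using b by (simp add: cmb_def labelings_def)
    ultimately show "(case p of (a, b) \<Rightarrow> cmb a b) \<in> ?big"
      unfolding p prod.case mem_Collect_eq glued_iff blocks_iff by blast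
  qed
  also have "\<dots> = (\<Sum>a\<in>?small. \<Sum>b | b \<in> labelings q I (\<pi> i) \<and> b (Min I) = a y0. ?term (cmb a b))"
    using fin by (subst sum.Sigma) simp_all
  also have "\<dots> = (\<Sum>a\<in>?small. ?term' a * slide_sum q I (\<pi> i))"
  proof (rule sum.cong[OF refl])
    fix a assume a: "a \<in> ?small"
    \<comment> \<open>\<open>V\<close> involves only the outer labeling, so it stays fixed while the
      loop labels \<open>b\<close> vary.\<close>
    define V where "V = slide 0 (map a us @ [a y0])"
    have V0: "V 0 = a y0" by (simp add: V_def slide_apply_start)
    have a_in: "a x \<in> {0..q}" if "x \<in> X - I" for x using a PiE_mem[of a "X - I" "\<lambda>_. {0..q}"] that by blast
    have "set us \<subseteq> X - I" unfolding sets using below by blast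
    then have "set (map a us @ [a y0]) \<subseteq> a ` (X - I)"
      using y0I by auto
    moreover have "a ` (X - I) \<subseteq> {0..q}"
      using a_in by blast
    ultimately have "insert 0 (set (map a us @ [a y0])) \<subseteq> {0..q}"
      by (meson atLeastAtMost_iff insert_subset order.trans zero_le)
    then have V: "V permutes {0..q}"
      unfolding V_def by (rule permutes_subset[OF slide_permutes])
    have "(\<Sum>b | b \<in> labelings q I (\<pi> i) \<and> b (Min I) = a y0. ?term (cmb a b)) =
      (\<Sum>b | b \<in> labelings q I (\<pi> i) \<and> b (Min I) = a y0.
        ?term' a * slide_term (map (inv V \<circ> transpose (a y0) (b (Max I)) \<circ> b) (sorted_list_of_set I)))"
    proof (rule sum.cong[OF refl])
      fix b assume b: "b \<in> {b \<in> labelings q I (\<pi> i). b (Min I) = a y0}"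
      have "cmb a b x = a x" if "x \<in> set us \<or> x \<in> set ws" for x
        using that below[of x x] above[of x x] unfolding sets cmb_def by auto
      moreover have "cmb a b x = b x" if "x \<in> set (sorted_list_of_set I)" for x
        using that finI by (simp add: cmb_def)
      ultimately have "map (cmb a b) us = map a us" "map (cmb a b) ws = map a ws"
        "map (cmb a b) (sorted_list_of_set I) = map b (sorted_list_of_set I)"
        unfolding map_eq_conv by blast+
      then have "?term (cmb a b) = slide_term (map a us @ map b (sorted_list_of_set I) @ map a ws)"
        by (simp only: sX map_append)
      also have "\<dots> = slide_term (map a us @ (a y0 # map b ms) @ a y0 # map a vs)"
        using b by (simp add: ms ws)
      also have "\<dots> = slide_term (map a us @ a y0 # map a vs) *
          slide_term (map (inv V \<circ> transpose (a y0) (b (Max I))) (a y0 # map b ms))"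
      proof (rule slide_term_insert_loop)
        have "last (a y0 # map a vs) = a (last (y0 # vs))" by (simp add: last_map)
        then show "last (a y0 # map a vs) = 0" using a lastvs MaxXI by simp
        have "last (map b (sorted_list_of_set I)) = b (Max I)"
          by (rule last_map_sorted_list_of_set(1)[OF finI I(1)])
        moreover have "map b (sorted_list_of_set I) = a y0 # map b ms"
          using b by (simp add: ms)
        ultimately show "transpose (a y0) (b (Max I)) = transpose (a y0) (last (a y0 # map b ms))"
          by (simp only:)
      qed (simp add: V_def)
      also have "map (inv V \<circ> transpose (a y0) (b (Max I))) (a y0 # map b ms) =
          map (inv V \<circ> transpose (a y0) (b (Max I)) \<circ> b) (sorted_list_of_set I)"
        using b by (simp add: ms)
      finally show "?term (cmb a b) =
          ?term' a * slide_term (map (inv V \<circ> transpose (a y0) (b (Max I)) \<circ> b) (sorted_list_of_set I))"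
        by (simp add: sXI ws)
    qed
    also have "\<dots> = ?term' a * slide_sum q I (\<pi> i)"
      by (simp add: slide_sum_loop[OF finI I(1) V V0] flip: sum_distrib_left)
    finally show "(\<Sum>b | b \<in> labelings q I (\<pi> i) \<and> b (Min I) = a y0. ?term (cmb a b)) =
        ?term' a * slide_sum q I (\<pi> i)" .
  qed
  also have "\<dots> = sum ?term' ?small * slide_sum q I (\<pi> i)"
    by (simp add: sum_distrib_right)
  finally show ?thesis .
qed

text \<open>Removing an interval block replaces \<open>X\<close> by \<open>X - I\<close>, hence the
  generality of \<open>X\<close>. The block containing \<open>Max X\<close> is never removed and is
  the one that remains at the end of the induction.\<close>

theorem glued_slide_sum:
  fixes \<rho> :: "nat \<Rightarrow> nat set"
  assumes "finite X" "X \<noteq> {}" "distinct ss" "inj_on \<rho> (set ss)"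
    "partition_on X (\<rho> ` set ss)" "noncrossing (\<rho> ` set ss)"
  shows "(\<Sum>a | a \<in> X \<rightarrow>\<^sub>E {0..q} \<and> a (Max X) = 0 \<and> glued X (\<rho> ` set ss) a \<and> labels_blocks \<rho> \<pi> (set ss) a.
      slide_term (map a (sorted_list_of_set X))) = prod_list (map (\<lambda>s. slide_sum q (\<rho> s) (\<pi> s)) ss)"
  using assms
proof (induction "length ss" arbitrary: ss X rule: less_induct)
  case less
  have blocks: "finite (\<rho> s) \<and> \<rho> s \<noteq> {} \<and> \<rho> s \<subseteq> X" if "s \<in> set ss" for s
    using that less.prems(1,5) by (metis Union_upper finite_subset imageI partition_onD1 partition_onD3)
  have disj: "\<rho> s \<inter> \<rho> t = {}" if "s \<in> set ss" "t \<in> set ss" "s \<noteq> t" for s t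
    using that less.prems(4,5) by (metis disjointD imageI inj_on_eq_iff partition_onD2)
  have "Max X \<in> X" using less.prems by simp
  then obtain s0 where s0: "s0 \<in> set ss" "Max X \<in> \<rho> s0"
    using less.prems(5) by (auto simp: partition_on_def)
  show ?case
  proof (cases "set ss = {s0}")
    case True
    then have ss: "ss = [s0]"
      using less.prems(3) distinct_card[OF less.prems(3)] by (cases ss; cases "tl ss") auto
    then have X: "\<rho> s0 = X" using less.prems(5) by (simp add: partition_on_def)
    show ?thesis
      by (simp add: ss X glued_single slide_sum_def labelings_def labels_blocks_def conj_ac)
  next
    case False
    then obtain s1 where s1: "s1 \<in> set ss" "s1 \<noteq> s0" using s0 by blast
    then have "Max X \<notin> \<rho> s1" using disj s0 by blast
    then obtain I where "I \<in> \<rho> ` set ss" and MXI: "Max X \<notin> I"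
      and interval: "\<And>x. x \<in> X \<Longrightarrow> Min I \<le> x \<Longrightarrow> x \<le> Max I \<Longrightarrow> x \<in> I"
      using noncrossing_interval_block[OF less.prems(1,5,6) imageI[OF s1(1)]] by blast
    then obtain i where i: "i \<in> set ss" "\<rho> i = I" by blast
    obtain pre post where ss: "ss = pre @ i # post" using i by (meson split_list)
    define R where "R = set (pre @ post)"
    have R: "set ss = insert i R" "i \<notin> R" using less.prems(3) by (auto simp: ss R_def)
    have img: "\<rho> ` R = \<rho> ` set ss - {I}"
      using R i less.prems(4) by (auto simp: inj_on_def)
    have sub: "\<rho> s \<subseteq> X - I" if "s \<in> R" for s
      using blocks[of s] disj[of s i] R i that by blast
    have part: "partition_on (X - I) (\<rho> ` R)"
    proof -
      have "partition_on X (insert I (\<rho> ` R))" using less.prems(5) R i by simp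
      moreover have "disjnt I (\<Union> (\<rho> ` R))" using sub by (auto simp: disjnt_def)
      ultimately show ?thesis using partition_on_insert by blast
    qed
    have IH: "(\<Sum>a | a \<in> (X - I) \<rightarrow>\<^sub>E {0..q} \<and> a (Max (X - I)) = 0 \<and> glued (X - I) (\<rho> ` set (pre @ post)) a \<and>
          labels_blocks \<rho> \<pi> (set (pre @ post)) a. slide_term (map a (sorted_list_of_set (X - I)))) =
        prod_list (map (\<lambda>s. slide_sum q (\<rho> s) (\<pi> s)) (pre @ post))"
    proof (rule less.hyps)
      show "length (pre @ post) < length ss" by (simp add: ss)
      show "X - I \<noteq> {}" using MXI \<open>Max X \<in> X\<close> by auto
      show "inj_on \<rho> (set (pre @ post))" using less.prems(4) R by (simp add: R_def[symmetric] inj_on_insert del: set_append)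
      show "noncrossing (\<rho> ` set (pre @ post))"
        unfolding R_def[symmetric] img by (rule noncrossing_subset[OF less.prems(6)]) blast
      show "finite (X - I)" "distinct (pre @ post)" using less.prems(1,3) by (simp_all add: ss)
      show "partition_on (X - I) (\<rho> ` set (pre @ post))" using part by (simp only: R_def)
    qed
    let ?S = "\<lambda>s. slide_sum q (\<rho> s) (\<pi> s)"
    have I: "I \<noteq> {}" "I \<subseteq> X" "finite I" using blocks i by auto
    \<comment> \<open>The removed factor appears at the right end, while in \<open>ss\<close> it
      precedes \<open>post\<close>; centrality moves it to its place.\<close>
    have comm: "prod_list (map ?S xs) * ?S i = ?S i * prod_list (map ?S xs)" if "set xs \<subseteq> set ss" for xs
      using that
    proof (induction xs)
      case (Cons s xs)
      have "?S s * ?S i = ?S i * ?S s"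
        using Cons.prems blocks i by (intro slide_sum_commute slide_sum_in_pperm_algebra) auto
      moreover have "prod_list (map ?S xs) * ?S i = ?S i * prod_list (map ?S xs)"
        using Cons by simp
      ultimately show ?case by (metis (no_types, lifting) list.simps(9) mult.assoc prod_list.Cons)
    qed simp
    have "(\<Sum>a | a \<in> X \<rightarrow>\<^sub>E {0..q} \<and> a (Max X) = 0 \<and> glued X (\<rho> ` set ss) a \<and> labels_blocks \<rho> \<pi> (set ss) a.
        slide_term (map a (sorted_list_of_set X))) =
      (\<Sum>a | a \<in> (X - I) \<rightarrow>\<^sub>E {0..q} \<and> a (Max (X - I)) = 0 \<and> glued (X - I) (\<rho> ` R) a \<and> labels_blocks \<rho> \<pi> R a.
        slide_term (map a (sorted_list_of_set (X - I)))) * slide_sum q I (\<pi> i)"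
      unfolding R(1) by (rule sum_glued_insert[where \<rho> = \<rho>, OF less.prems(1) I(1,2) MXI i(2)]) (use interval sub in blast)+
    also have "\<dots> = prod_list (map ?S (pre @ post)) * ?S i"
      by (simp only: IH[folded R_def] i(2))
    also have "\<dots> = prod_list (map ?S ss)"
    proof -
      have "set post \<subseteq> set ss" by (auto simp: ss)
      from comm[OF this] show ?thesis by (simp add: ss mult.assoc)
    qed
    finally show ?thesis .
  qed
qed

section \<open>The Kreweras complement\<close>

lemma noncrossingI:
  assumes "\<And>B C a b c d. B \<in> P \<Longrightarrow> C \<in> P \<Longrightarrow> B \<noteq> C \<Longrightarrow> a \<in> B \<Longrightarrow> b \<in> C \<Longrightarrow> c \<in> B \<Longrightarrow> d \<in> C \<Longrightarrow>
    a < b \<Longrightarrow> b < c \<Longrightarrow> c < d \<Longrightarrow> False"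
  shows "noncrossing P"
  unfolding noncrossing_def by (rule notI, elim bexE conjE exE) (rule assms)

lemma subset_or_disjointI:
  "(\<And>x z. x \<in> A \<Longrightarrow> x \<in> B \<Longrightarrow> z \<in> A \<Longrightarrow> z \<in> B) \<Longrightarrow> A \<subseteq> B \<or> A \<inter> B = {}"
  by blast

text \<open>With \<open>i'\<close> placed between \<open>i\<close> and \<open>i + 1\<close>, this
  says that the chord from \<open>x\<close> to \<open>y\<close> separates no block of primed points.
  The use of \<open>min\<close> and \<open>max\<close> makes the relation symmetric.\<close>

definition tied :: "nat set set \<Rightarrow> nat \<Rightarrow> nat \<Rightarrow> bool" where
  "tied P x y \<longleftrightarrow> (\<forall>B\<in>P. B \<subseteq> {min x y..<max x y} \<or> B \<inter> {min x y..<max x y} = {})"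

lemma tied_refl: "tied P x x"
  by (simp add: tied_def)

lemma tied_commute: "tied P x y \<longleftrightarrow> tied P y x"
  by (simp add: tied_def min.commute max.commute)

lemma tied_le: "x \<le> y \<Longrightarrow> tied P x y \<longleftrightarrow> (\<forall>B\<in>P. B \<subseteq> {x..<y} \<or> B \<inter> {x..<y} = {})"
  by (simp add: tied_def)

text \<open>The segment between \<open>x\<close> and \<open>z\<close> is the symmetric difference of
  the other two, and meeting a block fully or not at all passes to symmetric differences.\<close>

lemma tied_trans:
  assumes "tied P x y" "tied P y z"
  shows "tied P x z"
  unfolding tied_def
proof
  fix B assume B: "B \<in> P"
  have "{min x z..<max x z} = ({min x y..<max x y} - {min y z..<max y z}) \<union> ({min y z..<max y z} - {min x y..<max x y})"
    by (auto simp: min_def max_def)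
  moreover have "B \<subseteq> {min x y..<max x y} \<or> B \<inter> {min x y..<max x y} = {}"
    "B \<subseteq> {min y z..<max y z} \<or> B \<inter> {min y z..<max y z} = {}"
    using assms B by (simp_all add: tied_def)
  ultimately show "B \<subseteq> {min x z..<max x z} \<or> B \<inter> {min x z..<max x z} = {}"
    by blast
qed

lemma tiedD: "tied P x y \<Longrightarrow> B \<in> P \<Longrightarrow> u \<in> B \<Longrightarrow> x \<le> u \<Longrightarrow> u < y \<Longrightarrow> v \<in> B \<Longrightarrow> x \<le> v \<and> v < y"
  unfolding tied_def
  by (drule bspec, assumption, erule disjE) (auto simp: min_absorb1 max_absorb2 disjoint_iff)

text \<open>The overlap of two interlaced segments is their intersection, which again cuts no block.
  This is why the classes of \<open>tied\<close> do not cross.\<close>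

lemma tied_interlaced:
  assumes "tied P a c" "tied P b d" "a \<le> b" "b \<le> c" "c \<le> d"
  shows "tied P b c"
proof -
  have ac: "B \<subseteq> {a..<c} \<or> B \<inter> {a..<c} = {}" and bd: "B \<subseteq> {b..<d} \<or> B \<inter> {b..<d} = {}" if "B \<in> P" for B
    using assms that tied_le[of a c P] tied_le[of b d P] by auto
  have "{b..<c} = {a..<c} \<inter> {b..<d}" using assms by auto
  then have "B \<subseteq> {b..<c} \<or> B \<inter> {b..<c} = {}" if "B \<in> P" for B
    using ac[OF that] bd[OF that] by blast
  then show ?thesis using assms(4) by (simp add: tied_le)
qed

text \<open>For non-crossing \<open>P\<close> this is the explicit inverse Kreweras complement; see
  \<open>kreweras_inv_eq\<close>.\<close>

definition tied_partition :: "nat \<Rightarrow> nat set set \<Rightarrow> nat set set" where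
  "tied_partition n P = (\<lambda>x. {y \<in> {1..n}. tied P x y}) ` {1..n}"

lemma tied_partition_blockD:
  assumes "T \<in> tied_partition n P" "x \<in> T"
  shows "x \<in> {1..n}" "y \<in> T \<longleftrightarrow> y \<in> {1..n} \<and> tied P x y"
  using assms tied_trans tied_commute unfolding tied_partition_def by blast+

lemma partition_on_tied_partition: "partition_on {1..n} (tied_partition n P)"
proof (rule partition_onI)
  show "\<Union> (tied_partition n P) = {1..n}"
    using tied_refl by (auto simp: tied_partition_def)
  show "{} \<notin> tied_partition n P"
    using tied_refl by (auto simp: tied_partition_def)
  fix S T assume S: "S \<in> tied_partition n P" and T: "T \<in> tied_partition n P" and ne: "S \<noteq> T"
  show "disjnt S T"
  proof (rule ccontr)
    assume "\<not> disjnt S T"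
    then obtain x where "x \<in> S" "x \<in> T" by (auto simp: disjnt_def)
    then have "y \<in> S \<longleftrightarrow> y \<in> T" for y
      by (simp only: tied_partition_blockD(2)[OF S \<open>x \<in> S\<close>] tied_partition_blockD(2)[OF T \<open>x \<in> T\<close>])
    then show False using ne by blast
  qed
qed

lemma noncrossing_tied_partition: "noncrossing (tied_partition n P)"
proof (rule noncrossingI)
  fix B C a b c d
  assume B: "B \<in> tied_partition n P" and C: "C \<in> tied_partition n P" and "B \<noteq> C"
    and abcd: "a \<in> B" "b \<in> C" "c \<in> B" "d \<in> C" "a < b" "b < c" "c < d"
  have "tied P a c" "tied P b d"
    using tied_partition_blockD(2)[OF B, of a c] tied_partition_blockD(2)[OF C, of b d] abcd by auto
  then have "tied P b c"
    by (rule tied_interlaced) (use abcd in simp_all)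
  moreover have "c \<in> {1..n}" using tied_partition_blockD(1)[OF B abcd(3)] .
  ultimately have "c \<in> C" using tied_partition_blockD(2)[OF C, of b c] abcd by auto
  then have "B = C"
    using abcd(3) B C partition_on_tied_partition by (metis disjoint_iff disjointD partition_onD2)
  with \<open>B \<noteq> C\<close> show False ..
qed

text \<open>Only mixed crossings need an argument: a block of \<open>P\<close> alternating with two
  points of one class would be cut by a tied pair.\<close>

lemma noncrossing_interleave:
  assumes "noncrossing P"
  shows "noncrossing (interleave (tied_partition n P) P)"
proof (rule noncrossingI)
  let ?T = "tied_partition n P"
  have sep: False
    if T: "T \<in> ?T" and B: "B \<in> P" and "x \<in> T" "y \<in> T" "u \<in> B" "v \<in> B" "x \<le> u" "u < y" "v < x \<or> y \<le> v"
    for T B x y u v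
  proof -
    have "tied P x y" using tied_partition_blockD(2)[OF T that(3), of y] that(4) by blast
    from tiedD[OF this B that(5,7,8,6)] that(9) show False by linarith
  qed
  have split: "(\<exists>B'\<in>?T. B = (\<lambda>i. 2 * i) ` B') \<or> (\<exists>B'\<in>P. B = (\<lambda>i. 2 * i + 1) ` B')"
    if "B \<in> interleave ?T P" for B
    using that unfolding interleave_def by (auto simp only: Un_iff image_iff)
  fix B C a b c d
  assume BC: "B \<in> interleave ?T P" "C \<in> interleave ?T P" "B \<noteq> C"
    and mem: "a \<in> B" "b \<in> C" "c \<in> B" "d \<in> C" and lt: "a < b" "b < c" "c < d"
  consider B' C' where "B' \<in> ?T" "C' \<in> ?T" "B = (\<lambda>i. 2 * i) ` B'" "C = (\<lambda>i. 2 * i) ` C'"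
    | B' C' where "B' \<in> P" "C' \<in> P" "B = (\<lambda>i. 2 * i + 1) ` B'" "C = (\<lambda>i. 2 * i + 1) ` C'"
    | B' C' where "B' \<in> ?T" "C' \<in> P" "B = (\<lambda>i. 2 * i) ` B'" "C = (\<lambda>i. 2 * i + 1) ` C'"
    | B' C' where "B' \<in> P" "C' \<in> ?T" "B = (\<lambda>i. 2 * i + 1) ` B'" "C = (\<lambda>i. 2 * i) ` C'"
    using split[OF BC(1)] split[OF BC(2)] by (elim disjE bexE)
  then show False
  proof cases
    case 1
    obtain a' b' c' d' where "a = 2 * a'" "b = 2 * b'" "c = 2 * c'" "d = 2 * d'"
      "a' \<in> B'" "b' \<in> C'" "c' \<in> B'" "d' \<in> C'" using mem 1 by blast
    then show False
      using noncrossingD[OF noncrossing_tied_partition 1(1,2), of a' b' c' d'] BC(3) 1 lt by auto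
  next
    case 2
    obtain a' b' c' d' where "a = 2 * a' + 1" "b = 2 * b' + 1" "c = 2 * c' + 1" "d = 2 * d' + 1"
      "a' \<in> B'" "b' \<in> C'" "c' \<in> B'" "d' \<in> C'" using mem 2 by blast
    then show False
      using noncrossingD[OF assms 2(1,2), of a' b' c' d'] BC(3) 2 lt by auto
  next
    case 3
    obtain a' b' c' d' where "a = 2 * a'" "b = 2 * b' + 1" "c = 2 * c'" "d = 2 * d' + 1"
      "a' \<in> B'" "b' \<in> C'" "c' \<in> B'" "d' \<in> C'" using mem 3 by blast
    then show False
      using sep[OF 3(1,2), of a' c' b' d'] lt by linarith
  next
    case 4
    obtain a' b' c' d' where "a = 2 * a' + 1" "b = 2 * b'" "c = 2 * c' + 1" "d = 2 * d'"
      "a' \<in> B'" "b' \<in> C'" "c' \<in> B'" "d' \<in> C'" using mem 4 by blast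
    then show False
      using sep[OF 4(2,1), of b' d' c' a'] lt by linarith
  qed
qed

text \<open>This is the maximality in the Kreweras complement. If a block of \<kappa> joined two
  blocks of \<open>P\<close>, some tied pair would separate two of its points, and the class of that
  pair would cross it.\<close>

lemma refines_of_noncrossing_interleave:
  assumes P: "P \<in> NC n" and K: "\<kappa> \<in> NC n" and nc: "noncrossing (interleave (tied_partition n P) \<kappa>)"
  shows "refines {1..n} \<kappa> P"
proof -
  let ?T = "tied_partition n P"
  have partP: "partition_on {1..n} P" and ncP: "noncrossing P" and partK: "partition_on {1..n} \<kappa>"
    using P K by (auto simp: NC_def)
  have disj: "B = C" if "B \<in> P" "C \<in> P" "x \<in> B" "x \<in> C" for B C x
    using that partP by (metis disjoint_iff disjointD partition_onD2)
  have blk: "B \<subseteq> {1..n}" "finite B" if "B \<in> P" for B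
    using that partP by (metis Union_upper partition_onD1, metis Union_upper finite_atLeastAtMost finite_subset partition_onD1)
  \<comment> \<open>If a tied pair separates \<open>u\<close> from \<open>v\<close>, the even images
    of the pair and the odd images of \<open>u\<close> and \<open>v\<close> alternate in the
    interleaved order.\<close>
  have cross: False
    if "D \<in> \<kappa>" "tied P x y" "x \<in> {1..n}" "y \<in> {1..n}" "u \<in> D" "v \<in> D"
      "u < x \<and> x \<le> v \<and> v < y \<or> x \<le> u \<and> u < y \<and> y \<le> v" for D x y u v
  proof -
    define T where "T = {z \<in> {1..n}. tied P x z}"
    have T: "T \<in> ?T" "x \<in> T" "y \<in> T"
      using that tied_refl by (auto simp: T_def tied_partition_def)
    let ?B = "(\<lambda>i. 2 * i) ` T" and ?C = "(\<lambda>i. 2 * i + 1) ` D"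
    have BC: "?B \<in> interleave ?T \<kappa>" "?C \<in> interleave ?T \<kappa>"
      using T that by (auto simp: interleave_def)
    have mem: "2 * x \<in> ?B" "2 * y \<in> ?B" "2 * u + 1 \<in> ?C" "2 * v + 1 \<in> ?C"
      using T that by auto
    have "?B \<noteq> ?C" using mem(1) by (metis (no_types, lifting) double_not_eq_Suc_double Suc_eq_plus1 imageE)
    from that(7) show False
    proof
      assume "u < x \<and> x \<le> v \<and> v < y"
      then show False
        using noncrossingD[OF nc BC(2,1) \<open>?B \<noteq> ?C\<close>[symmetric] mem(3,1,4,2)] by linarith
    next
      assume "x \<le> u \<and> u < y \<and> y \<le> v"
      then show False
        using noncrossingD[OF nc BC \<open>?B \<noteq> ?C\<close> mem(1,3,2,4)] by linarith
    qed
  qed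
  \<comment> \<open>The separating tied pair: if \<open>v\<close> falls in a gap of
    \<open>B\<close>, between consecutive points \<open>b1\<close> and \<open>b2\<close>, take
    \<open>b1 + 1\<close> and \<open>b2\<close>, whose segment excludes both \<open>b1\<close> and
    \<open>b2\<close>; if \<open>v\<close> lies beyond \<open>B\<close>, take \<open>Min B\<close>
    and \<open>Max B + 1\<close>, whose segment includes all of \<open>B\<close>. That no other
    block is cut is the non-crossing of \<open>P\<close>.\<close>
  have same: "v \<in> B" if D: "D \<in> \<kappa>" "u \<in> D" "v \<in> D" and "u < v" and B: "B \<in> P" "u \<in> B" for D u v B
  proof (rule ccontr)
    assume v: "v \<notin> B"
    have vn: "v \<in> {1..n}" using D partK by (metis Union_iff partition_onD1)
    show False
    proof (cases "\<exists>b\<in>B. v < b")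
      case True
      define b1 where "b1 = Max {b \<in> B. b < v}"
      define b2 where "b2 = Min {b \<in> B. v < b}"
      have "b1 \<in> {b \<in> B. b < v}"
        unfolding b1_def using blk[OF B(1)] B \<open>u < v\<close> by (intro Max_in) auto
      moreover have "b2 \<in> {b \<in> B. v < b}"
        unfolding b2_def using blk[OF B(1)] True by (intro Min_in) auto
      ultimately have b: "b1 \<in> B" "b1 < v" "b2 \<in> B" "v < b2" by auto
      have le1: "b \<le> b1" if "b \<in> B" "b < v" for b
        unfolding b1_def using that blk[OF B(1)] by (intro Max_ge) auto
      have le2: "b2 \<le> b" if "b \<in> B" "v < b" for b
        unfolding b2_def using that blk[OF B(1)] by (intro Min_le) auto
      have "C \<subseteq> {b1 + 1..<b2} \<or> C \<inter> {b1 + 1..<b2} = {}" if C: "C \<in> P" for C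
      proof (cases "C = B")
        case True
        have "\<not> (b1 + 1 \<le> x \<and> x < b2)" if "x \<in> B" for x
          using le1[OF that] le2[OF that] v that by (cases x v rule: linorder_cases) auto
        then show ?thesis using True by auto
      next
        case False
        have inside: "b1 < z \<and> z < b2" if x: "x \<in> C" "b1 < x" "x < b2" and z: "z \<in> C" for x z
        proof -
          have "z \<noteq> b1" "z \<noteq> b2" using disj[OF C B(1)] False b z by metis+
          moreover have "\<not> z < b1"
            using noncrossingD[OF ncP C B(1) False z b(1) x(1) b(3)] x by blast
          moreover have "\<not> b2 < z"
            using noncrossingD[OF ncP B(1) C False[symmetric] b(1) x(1) b(3) z] x by blast
          ultimately show ?thesis by linarith
        qed
        show ?thesis
        proof (rule subset_or_disjointI)
          fix x z assume "x \<in> C" "x \<in> {b1 + 1..<b2}" "z \<in> C"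
          then show "z \<in> {b1 + 1..<b2}" using inside[of x z] by auto
        qed
      qed
      moreover have le: "b1 + 1 \<le> b2" using b by linarith
      ultimately have tied: "tied P (b1 + 1) b2" unfolding tied_le[OF le] by blast
      have u: "u \<le> b1" using le1 B \<open>u < v\<close> by blast
      have "b1 + 1 \<in> {1..n}" using b vn by simp
      moreover have "b2 \<in> {1..n}" using b blk(1)[OF B(1)] by blast
      moreover have "u < b1 + 1 \<and> b1 + 1 \<le> v \<and> v < b2" using u b by linarith
      ultimately show False
        using cross[OF D(1) tied _ _ D(2,3)] by blast
    next
      case False
      have mem: "Min B \<in> B" "Max B \<in> B" using blk[OF B(1)] B by (auto intro!: Min_in Max_in)
      have bnd: "Min B \<le> x \<and> x \<le> Max B" if "x \<in> B" for x using blk[OF B(1)] that by simp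
      have "Max B < v" using False mem v by (metis linorder_neqE_nat)
      have "C \<subseteq> {Min B..<Max B + 1} \<or> C \<inter> {Min B..<Max B + 1} = {}" if C: "C \<in> P" for C
      proof (cases "C = B")
        case True
        then show ?thesis using bnd by force
      next
        case False
        have inside: "Min B \<le> z \<and> z \<le> Max B" if x: "x \<in> C" "Min B \<le> x" "x \<le> Max B" and z: "z \<in> C" for x z
        proof -
          have "x \<noteq> Min B" "x \<noteq> Max B" using disj[OF C B(1)] False mem x by metis+
          with x have x': "Min B < x" "x < Max B" by auto
          have "\<not> z < Min B"
            using noncrossingD[OF ncP C B(1) False z mem(1) x(1) mem(2)] x' by blast
          moreover have "\<not> Max B < z"
            using noncrossingD[OF ncP B(1) C False[symmetric] mem(1) x(1) mem(2) z] x' by blast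
          ultimately show ?thesis by linarith
        qed
        show ?thesis
        proof (rule subset_or_disjointI)
          fix x z assume "x \<in> C" "x \<in> {Min B..<Max B + 1}" "z \<in> C"
          then show "z \<in> {Min B..<Max B + 1}" using inside[of x z] by auto
        qed
      qed
      moreover have le: "Min B \<le> Max B + 1" using bnd[OF mem(1)] by linarith
      ultimately have tied: "tied P (Min B) (Max B + 1)" unfolding tied_le[OF le] by blast
      have "Max B + 1 \<in> {1..n}" using \<open>Max B < v\<close> vn by simp
      moreover have "Min B \<in> {1..n}" using mem(1) blk(1)[OF B(1)] by blast
      moreover have "Min B \<le> u \<and> u < Max B + 1 \<and> Max B + 1 \<le> v"
        using \<open>Max B < v\<close> bnd[OF B(2)] by linarith
      ultimately show False
        using cross[OF D(1) tied _ _ D(2,3)] by blast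
    qed
  qed
  have "\<exists>B\<in>P. D \<subseteq> B" if D: "D \<in> \<kappa>" for D
  proof -
    have Dn: "D \<subseteq> {1..n}" "D \<noteq> {}" using D partK by (auto simp: partition_on_def)
    then obtain u where u: "u \<in> D" by blast
    with Dn obtain B where B: "B \<in> P" "u \<in> B" using partP by (auto simp: partition_on_def)
    have "v \<in> B" if v: "v \<in> D" for v
    proof (cases u v rule: linorder_cases)
      case less
      then show ?thesis using same[OF D u v _ B] by simp
    next
      case greater
      obtain C where C: "C \<in> P" "v \<in> C" using Dn v partP by (auto simp: partition_on_def)
      then have "u \<in> C" using same[OF D v u greater C] by simp
      then show ?thesis using disj[OF C(1) B(1) _ B(2)] C by simp
    qed (use B in simp)
    then show ?thesis using B(1) by blast
  qed
  then show ?thesis using partK partP by (simp add: refines_def)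
qed

lemma tied_partition_in_NC: "tied_partition n P \<in> NC n"
  unfolding NC_def using partition_on_tied_partition noncrossing_tied_partition by blast

lemma kreweras_tied_partition:
  assumes "P \<in> NC n"
  shows "kreweras n (tied_partition n P) = P"
  unfolding kreweras_def Let_def
proof (rule the_equality)
  let ?C = "{\<kappa> \<in> NC n. noncrossing (interleave (tied_partition n P) \<kappa>)}"
  have P: "P \<in> ?C"
    using assms noncrossing_interleave by (auto simp: NC_def)
  have max: "\<forall>\<kappa>'\<in>?C. refines {1..n} \<kappa>' P"
    using refines_of_noncrossing_interleave[OF assms] by blast
  from P max show "P \<in> ?C \<and> (\<forall>\<kappa>'\<in>?C. refines {1..n} \<kappa>' P)" ..
  fix \<kappa> assume "\<kappa> \<in> ?C \<and> (\<forall>\<kappa>'\<in>?C. refines {1..n} \<kappa>' \<kappa>)"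
  then show "\<kappa> = P" using P max by (metis refines_asym)
qed

lemma finite_NC: "finite (NC n)"
  by (rule finite_subset[OF _ finitely_many_partition_on[of "{1..n}"]]) (auto simp: NC_def)

text \<open>Every non-crossing partition is a Kreweras complement, so by finiteness the complement is
  injective and the preimage found above is the only one.\<close>

lemma kreweras_inv_eq:
  assumes "P \<in> NC n"
  shows "kreweras_inv n P = tied_partition n P"
proof -
  have "NC n \<subseteq> kreweras n ` NC n"
    using kreweras_tied_partition tied_partition_in_NC by (metis imageI subsetI)
  then have "card (NC n) \<le> card (kreweras n ` NC n)"
    using finite_NC by (intro card_mono) auto
  then have "inj_on (kreweras n) (NC n)"
    using finite_NC card_image_le[OF finite_NC] by (intro eq_card_imp_inj_on) (auto intro: le_antisym)
  then show ?thesis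
    unfolding kreweras_inv_def
    using inv_into_f_f[OF _ tied_partition_in_NC] kreweras_tied_partition[OF assms] by metis
qed

lemma refines_tied_partition_iff:
  assumes "partition_on {1..n} \<sigma>"
  shows "refines {1..n} (tied_partition n P) \<sigma> \<longleftrightarrow>
    (\<forall>x\<in>{1..n}. \<forall>y\<in>{1..n}. x \<le> y \<longrightarrow> tied P x y \<longrightarrow> same_block \<sigma> x y)"
proof
  assume "refines {1..n} (tied_partition n P) \<sigma>"
  then have sub: "\<exists>S\<in>\<sigma>. {y \<in> {1..n}. tied P x y} \<subseteq> S" if "x \<in> {1..n}" for x
    using that by (auto simp: refines_def tied_partition_def)
  show "\<forall>x\<in>{1..n}. \<forall>y\<in>{1..n}. x \<le> y \<longrightarrow> tied P x y \<longrightarrow> same_block \<sigma> x y"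
  proof (intro ballI impI)
    fix x y assume xy: "x \<in> {1..n}" "y \<in> {1..n}" "tied P x y"
    obtain S where "S \<in> \<sigma>" "{y \<in> {1..n}. tied P x y} \<subseteq> S" using sub[OF xy(1)] by blast
    then show "same_block \<sigma> x y" using xy tied_refl[of P x] unfolding same_block_def by blast
  qed
next
  assume *: "\<forall>x\<in>{1..n}. \<forall>y\<in>{1..n}. x \<le> y \<longrightarrow> tied P x y \<longrightarrow> same_block \<sigma> x y"
  have sym: "same_block \<sigma> x y" if xy: "x \<in> {1..n}" "y \<in> {1..n}" "tied P x y" for x y
  proof (cases "x \<le> y")
    case False
    then have "same_block \<sigma> y x"
      using *[rule_format, OF xy(2,1)] xy(3) tied_commute[of P x y] by simp
    then show ?thesis by (auto simp: same_block_def)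
  qed (use * xy in blast)
  have "\<exists>S\<in>\<sigma>. {y \<in> {1..n}. tied P x y} \<subseteq> S" if x: "x \<in> {1..n}" for x
  proof -
    obtain S where S: "S \<in> \<sigma>" "x \<in> S" using x partition_onD1[OF assms] by blast
    have "y \<in> S" if y: "y \<in> {1..n}" "tied P x y" for y
    proof -
      obtain S' where "S' \<in> \<sigma>" "x \<in> S'" "y \<in> S'" using sym[OF x y] by (auto simp: same_block_def)
      then show ?thesis using S assms by (metis disjoint_iff disjointD partition_onD2)
    qed
    then show ?thesis using S by blast
  qed
  then show "refines {1..n} (tied_partition n P) \<sigma>"
    unfolding refines_def using assms partition_on_tied_partition[of n P]
    by (auto simp: tied_partition_def simp del: atLeastAtMost_iff One_nat_def)
qed

section \<open>First returns and products of disjoint cycles\<close>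

definition first_return :: "'a set \<Rightarrow> ('a \<Rightarrow> 'a) \<Rightarrow> 'a \<Rightarrow> 'a" where
  "first_return D f x = (f ^^ (LEAST k. 0 < k \<and> (f ^^ k) x \<in> D)) x"

lemma first_return_eqI:
  assumes "0 < k" "(f ^^ k) x \<in> D" "\<And>j. 0 < j \<Longrightarrow> j < k \<Longrightarrow> (f ^^ j) x \<notin> D"
  shows "first_return D f x = (f ^^ k) x"
proof -
  have "(LEAST k. 0 < k \<and> (f ^^ k) x \<in> D) = k"
    using assms by (intro Least_equality) (auto simp: not_less[symmetric])
  then show ?thesis by (simp add: first_return_def)
qed

text \<open>The first return happens at a time at most \<open>m\<close>; subtracting it leaves a
  shorter trajectory that starts at the returned point.\<close>

lemma funpow_first_return:
  assumes "x \<in> D" "(f ^^ m) x \<in> D"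
  shows "\<exists>i. (f ^^ m) x = (first_return D f ^^ i) x"
  using assms
proof (induction m arbitrary: x rule: less_induct)
  case (less m)
  show ?case
  proof (cases "m = 0")
    case True
    then show ?thesis by (intro exI[of _ 0]) simp
  next
    case False
    let ?P = "\<lambda>k. 0 < k \<and> (f ^^ k) x \<in> D"
    define k where "k = (LEAST k. ?P k)"
    have "?P m" using less.prems False by simp
    then have k: "?P k" "k \<le> m"
      unfolding k_def by (rule LeastI, rule Least_le)
    have ret: "first_return D f x = (f ^^ k) x" by (simp add: first_return_def k_def)
    have "(f ^^ (m - k)) (first_return D f x) = (f ^^ m) x"
      using k(2) by (metis ret comp_apply funpow_add le_add_diff_inverse2)
    moreover have "\<exists>i. (f ^^ (m - k)) (first_return D f x) = (first_return D f ^^ i) (first_return D f x)"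
      using k less.prems calculation ret by (intro less.IH) auto
    ultimately obtain i where "(f ^^ m) x = (first_return D f ^^ i) (first_return D f x)" by auto
    then show ?thesis by (intro exI[of _ "Suc i"]) (simp add: funpow_swap1)
  qed
qed

text \<open>Every visit of the cycle to \<open>D\<close> is an iterate of the first-return map. A
  cycle of \<open>f\<close> meeting \<open>D\<close> thus gives a single cycle, whose length is the
  number of its points in \<open>D\<close>; this is how winding numbers become cycle
  lengths.\<close>

lemma orbit_first_return:
  assumes "x \<in> D" "x \<in> orbit f x"
  shows "orbit (first_return D f) x = D \<inter> orbit f x" "x \<in> orbit (first_return D f) x"
proof -
  let ?g = "first_return D f"
  obtain p where p: "0 < p" "(f ^^ p) x = x"
    using assms(2) by (auto simp: orbit_altdef)
  have ret: "?g y \<in> D \<and> ?g y \<in> orbit f x" if y: "y \<in> D" "y \<in> orbit f x" for y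
  proof -
    have "y \<in> orbit f y" using assms(2) y(2) by (rule self_in_orbit_trans)
    then obtain p where "0 < p" "(f ^^ p) y = y"
      by (auto simp: orbit_altdef)
    then have "0 < p \<and> (f ^^ p) y \<in> D" using y(1) by simp
    then have "(f ^^ (LEAST k. 0 < k \<and> (f ^^ k) y \<in> D)) y \<in> D"
      using LeastI[where P = "\<lambda>k. 0 < k \<and> (f ^^ k) y \<in> D"] by blast
    then show ?thesis
      using funpow_in_orbit[OF y(2)] by (simp add: first_return_def)
  qed
  have gi: "(?g ^^ i) x \<in> D \<inter> orbit f x" for i
    by (induction i) (use assms ret in auto)
  have "\<exists>k. (f ^^ k) (?g x) = x"
  proof -
    let ?P = "\<lambda>k. 0 < k \<and> (f ^^ k) x \<in> D"
    have "?P p" using p assms(1) by simp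
    then have le: "(LEAST k. ?P k) \<le> p" by (rule Least_le)
    have "(f ^^ (p - (LEAST k. ?P k))) (?g x) = (f ^^ (p - (LEAST k. ?P k) + (LEAST k. ?P k))) x"
      by (simp only: first_return_def funpow_add comp_apply)
    then show ?thesis unfolding le_add_diff_inverse2[OF le] p(2) ..
  qed
  then obtain k where k: "(f ^^ k) (?g x) = x" ..
  have "?g x \<in> D" using gi[of 1] by simp
  from funpow_first_return[OF this, where f = f and m = k, unfolded k, OF assms(1)]
  obtain i where i: "x = (?g ^^ i) (?g x)" ..
  have "(?g ^^ Suc i) x = x"
    unfolding funpow_Suc_right comp_apply by (rule i[symmetric])
  then show self: "x \<in> orbit ?g x"
    unfolding orbit_altdef by (metis (mono_tags, lifting) mem_Collect_eq zero_less_Suc)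
  have orb: "orbit ?g x = {(?g ^^ n) x | n. True}"
    by (rule orbit_altdef_self_in[OF self])
  have hit: "\<exists>i. y = (?g ^^ i) x" if "y \<in> D" "y \<in> orbit f x" for y
  proof -
    obtain m where "y = (f ^^ m) x" using \<open>y \<in> orbit f x\<close> unfolding orbit_altdef by blast
    then show ?thesis using funpow_first_return[OF assms(1), where f = f and m = m] that(1) by simp
  qed
  show "orbit ?g x = D \<inter> orbit f x"
    unfolding orb
  proof (intro equalityI subsetI)
    fix y assume "y \<in> {(?g ^^ n) x | n. True}"
    then obtain n where "y = (?g ^^ n) x" by blast
    then show "y \<in> D \<inter> orbit f x" using gi[of n] by simp
  next
    fix y assume "y \<in> D \<inter> orbit f x"
    then show "y \<in> {(?g ^^ n) x | n. True}" using hit[of y] by simp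
  qed
qed

section \<open>Lists of cycles and products of disjoint cycles\<close>

lemma cycles_of_eq: "cycles_of n f = map (orbit f) (filter (\<lambda>x. x = Min (orbit f x)) [1..<Suc n])"
proof -
  have "concat (map (\<lambda>x. if x = Min (orbit f x) then [orbit f x] else []) xs) =
      map (orbit f) (filter (\<lambda>x. x = Min (orbit f x)) xs)" for xs
    by (induction xs) auto
  then show ?thesis by (simp add: cycles_of_def)
qed

lemma distinct_cycles_of: "distinct (cycles_of n f)"
  by (auto simp: cycles_of_eq distinct_map intro!: inj_onI)

lemma set_cycles_of:
  assumes "f permutes {1..n}"
  shows "set (cycles_of n f) = orbit f ` {1..n}"
proof
  show "set (cycles_of n f) \<subseteq> orbit f ` {1..n}"
    by (auto simp: cycles_of_eq)
  have cyc: "cyclic_on f (orbit f x)" for x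
    by (rule cyclic_on_orbit[OF assms]) simp
  have "orbit f x \<in> set (cycles_of n f)" if x: "x \<in> {1..n}" for x
  proof -
    have sub: "orbit f x \<subseteq> {1..n}" using permutes_orbit_subset[OF assms x] .
    then have "finite (orbit f x)" using finite_subset by blast
    then have "Min (orbit f x) \<in> orbit f x" by (simp add: orbit_nonempty)
    moreover from this have "orbit f (Min (orbit f x)) = orbit f x"
      using orbit_cyclic_eq3[OF cyc] by blast
    ultimately show ?thesis
      using sub unfolding cycles_of_eq by (auto intro!: image_eqI[of _ _ "Min (orbit f x)"] simp: subset_iff)
  qed
  then show "orbit f ` {1..n} \<subseteq> set (cycles_of n f)" by blast
qed

text \<open>Factor \<open>r\<close> keeps \<open>x\<close> inside its own support, which all other
  factors fix pointwise.\<close>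

lemma pperm_fun_sum_list_disjoint:
  assumes "\<And>i j. i < j \<Longrightarrow> j < length ps \<Longrightarrow> supp (ps ! i) \<inter> supp (ps ! j) = {}"
    and "r < length ps" "x \<in> supp (ps ! r)"
  shows "pperm_fun (sum_list ps) x = pperm_fun (ps ! r) x"
  using assms
proof (induction ps arbitrary: r)
  case (Cons p ps)
  have disj: "supp p \<inter> supp q = {}" if q: "q \<in> set ps" for q
  proof -
    obtain j where "j < length ps" "ps ! j = q" using q by (auto simp: in_set_conv_nth)
    then show ?thesis using Cons.prems(1)[of 0 "Suc j"] by simp
  qed
  have perm: "pperm_fun q y \<in> supp q \<longleftrightarrow> y \<in> supp q" for q :: "'a pperm" and y
    using pperm_fun_permutes by (rule permutes_in_image)
  show ?case
  proof (cases r)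
    case 0
    then have "x \<in> supp p" using Cons.prems(3) by simp
    then have "x \<notin> supp (sum_list ps)" using disj unfolding supp_sum_list by blast
    then have "pperm_fun (sum_list ps) x = x" by (rule permutes_not_in[OF pperm_fun_permutes])
    then show ?thesis using 0 by (simp add: pperm_fun_plus)
  next
    case (Suc r')
    have "pperm_fun (sum_list ps) x = pperm_fun (ps ! r') x"
    proof (rule Cons.IH)
      show "supp (ps ! i) \<inter> supp (ps ! j) = {}" if "i < j" "j < length ps" for i j
        using Cons.prems(1)[of "Suc i" "Suc j"] that by simp
    qed (use Cons.prems Suc in auto)
    moreover have "pperm_fun (ps ! r') x \<notin> supp p"
      using disj[of "ps ! r'"] Cons.prems Suc perm[of "ps ! r'" x] by auto
    then have "pperm_fun p (pperm_fun (ps ! r') x) = pperm_fun (ps ! r') x"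
      by (rule permutes_not_in[OF pperm_fun_permutes])
    ultimately show ?thesis using Suc by (simp add: pperm_fun_plus)
  qed
qed simp

lemma pperm_fun_cycle_pperm: "pperm_fun (cycle_pperm cs) = cycle_of_list cs"
  by transfer simp

lemma cycle_of_list_nth:
  assumes "distinct cs" "s < length cs"
  shows "cycle_of_list cs (cs ! s) = cs ! (Suc s mod length cs)"
proof -
  have "map (cycle_of_list cs) cs = rotate 1 cs"
    using cyclic_rotation[OF assms(1), of 1] by simp
  then have "map (cycle_of_list cs) cs ! s = rotate 1 cs ! s" by simp
  then show ?thesis using assms(2) nth_rotate[of s cs 1] by simp
qed

lemma pperm_fun_family_pperm:
  assumes inj: "inj_on a (family_index ks)" and rs: "r < length ks" "s < ks ! r"
  shows "pperm_fun (family_pperm ks a) (a (r, s)) = a (r, Suc s mod ks ! r)"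
proof -
  define ps where "ps = map (\<lambda>r. cycle_pperm (map (\<lambda>s. a (r, s)) [0..<ks ! r])) [0..<length ks]"
  let ?cs = "map (\<lambda>s. a (r, s)) [0..<ks ! r]"
  have nth: "ps ! i = cycle_pperm (map (\<lambda>s. a (i, s)) [0..<ks ! i])" if "i < length ks" for i
    using that by (simp add: ps_def)
  have "pperm_fun (sum_list ps) (a (r, s)) = pperm_fun (ps ! r) (a (r, s))"
  proof (rule pperm_fun_sum_list_disjoint)
    fix i j assume ij: "i < j" "j < length ps"
    then have "i < length ks" "j < length ks" by (simp_all add: ps_def)
    then have "supp (ps ! i) = a ` {(i, s) | s. s < ks ! i}" "supp (ps ! j) = a ` {(j, s) | s. s < ks ! j}"
      by (auto simp: nth)
    moreover have "a ` {(i, s) | s. s < ks ! i} \<inter> a ` {(j, s) | s. s < ks ! j} =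
        a ` ({(i, s) | s. s < ks ! i} \<inter> {(j, s) | s. s < ks ! j})"
      using \<open>i < length ks\<close> \<open>j < length ks\<close>
      by (intro inj_on_image_Int[OF inj, symmetric]) (auto simp: family_index_def)
    ultimately show "supp (ps ! i) \<inter> supp (ps ! j) = {}"
      using ij by auto
  qed (use rs in \<open>auto simp: ps_def\<close>)
  also have "\<dots> = cycle_of_list ?cs (?cs ! s)"
    using rs by (simp add: nth pperm_fun_cycle_pperm)
  also have "\<dots> = ?cs ! (Suc s mod length ?cs)"
  proof (rule cycle_of_list_nth)
    show "distinct ?cs"
      using inj rs by (auto simp: distinct_map inj_on_def family_index_def)
  qed (use rs in simp)
  also have "\<dots> = a (r, Suc s mod ks ! r)"
  proof -
    have "Suc s mod ks ! r < ks ! r" using rs by simp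
    then show ?thesis by simp
  qed
  finally show ?thesis by (simp add: family_pperm_def ps_def)
qed

section \<open>The fattened permutation of a partition\<close>

locale fattened =
  fixes n :: nat and \<pi> :: "nat set set"
  assumes n_pos: "0 < n" and part: "partition_on {1..n} \<pi>"
begin

abbreviation sim (infix "\<sim>" 50) where "i \<sim> j \<equiv> same_block \<pi> i j"
abbreviation f where "f \<equiv> fat_perm n \<pi>"

lemma the_block: "B \<in> \<pi> \<Longrightarrow> i \<in> B \<Longrightarrow> (THE B. B \<in> \<pi> \<and> i \<in> B) = B"
  using part by (intro the_equality) (auto dest: partition_onD2 disjointD)

lemma sim_iff: "B \<in> \<pi> \<Longrightarrow> i \<in> B \<Longrightarrow> i \<sim> j \<longleftrightarrow> j \<in> B"
  using the_block unfolding same_block_def by metis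

lemma obtain_block:
  assumes "i \<in> {1..n}"
  obtains B where "B \<in> \<pi>" "i \<in> B" "B \<subseteq> {1..n}" "finite B" "\<And>j. i \<sim> j \<longleftrightarrow> j \<in> B"
proof -
  obtain B where B: "B \<in> \<pi>" "i \<in> B" using assms partition_onD1[OF part] by blast
  moreover have "B \<subseteq> {1..n}" using B partition_onD1[OF part] by blast
  ultimately show ?thesis using that sim_iff finite_subset by blast
qed

lemma sim_refl: "i \<in> {1..n} \<Longrightarrow> i \<sim> i"
  by (metis obtain_block)

lemma sim_sym: "i \<sim> j \<Longrightarrow> j \<sim> i"
  by (auto simp: same_block_def)

lemma sim_trans: "i \<sim> j \<Longrightarrow> j \<sim> k \<Longrightarrow> i \<sim> k"
  using sim_iff by (metis same_block_def)

lemma sim_in: "i \<sim> j \<Longrightarrow> i \<in> {1..n} \<and> j \<in> {1..n}"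
  using partition_onD1[OF part] by (auto simp: same_block_def)

lemma fat_next:
  assumes "i < j" "i \<sim> j" "\<And>k. i < k \<Longrightarrow> k < j \<Longrightarrow> \<not> i \<sim> k"
  shows "fat \<pi> i = j"
proof -
  obtain B where B: "B \<in> \<pi>" "i \<in> B" "finite B" "\<And>j. i \<sim> j \<longleftrightarrow> j \<in> B"
    using assms(2) sim_in obtain_block by metis
  have "Min {j \<in> B. i < j} = j"
    using assms B by (intro Min_eqI) (auto simp: not_less[symmetric])
  then show ?thesis
    using assms B by (auto simp: fat_def the_block[OF B(1,2)])
qed

lemma fat_wrap:
  assumes "\<And>k. i < k \<Longrightarrow> \<not> i \<sim> k" "i \<sim> j" "\<And>k. k < j \<Longrightarrow> \<not> i \<sim> k"
  shows "fat \<pi> i = j"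
proof -
  obtain B where B: "B \<in> \<pi>" "i \<in> B" "finite B" "\<And>j. i \<sim> j \<longleftrightarrow> j \<in> B"
    using assms(2) sim_in obtain_block by metis
  have "Min B = j"
    using assms B by (intro Min_eqI) (auto simp: not_less[symmetric])
  then show ?thesis
    using assms B by (auto simp: fat_def the_block[OF B(1,2)])
qed

lemma fat_cases:
  assumes "i \<in> {1..n}"
  obtains (succ) "i < fat \<pi> i" "i \<sim> fat \<pi> i" "\<And>k. i < k \<Longrightarrow> k < fat \<pi> i \<Longrightarrow> \<not> i \<sim> k"
    | (wrap) "fat \<pi> i \<le> i" "i \<sim> fat \<pi> i" "\<And>k. i < k \<Longrightarrow> \<not> i \<sim> k" "\<And>k. k < fat \<pi> i \<Longrightarrow> \<not> i \<sim> k"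
proof (cases "\<exists>j. i < j \<and> i \<sim> j")
  case True
  define j where "j = (LEAST j. i < j \<and> i \<sim> j)"
  have j: "i < j" "i \<sim> j" using LeastI_ex[OF True] by (simp_all add: j_def)
  have "\<not> i \<sim> k" if "i < k" "k < j" for k
    using not_less_Least[of k "\<lambda>j. i < j \<and> i \<sim> j"] that by (simp add: j_def)
  with j show ?thesis using succ fat_next by metis
next
  case False
  define j where "j = (LEAST j. i \<sim> j)"
  have j: "i \<sim> j" using sim_refl[OF assms] unfolding j_def by (rule LeastI)
  have min: "\<not> i \<sim> k" if "k < j" for k
    using not_less_Least[of k "\<lambda>j. i \<sim> j"] that by (simp add: j_def)
  have "j \<le> i" using sim_refl[OF assms] unfolding j_def by (rule Least_le)
  moreover have "fat \<pi> i = j" using False j min by (intro fat_wrap) auto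
  ultimately show ?thesis using wrap False j min by metis
qed

lemma fat_sim: "i \<in> {1..n} \<Longrightarrow> i \<sim> fat \<pi> i"
  by (rule fat_cases)

lemma c_shift_in: "x \<in> {1..n} \<Longrightarrow> c_shift n x \<in> {1..n}"
  by (auto simp: c_shift_def)

lemma f_eq: "x \<in> {1..n} \<Longrightarrow> f x = fat \<pi> (c_shift n x)"
  by (simp add: fat_perm_def)

lemma f_sim: "x \<in> {1..n} \<Longrightarrow> c_shift n x \<sim> f x"
  using fat_sim c_shift_in f_eq by simp

lemma f_permutes: "f permutes {1..n}"
proof (rule bij_imp_permutes)
  show "f x = x" if "x \<notin> {1..n}" for x using that by (auto simp: fat_perm_def)
  have "f ` {1..n} \<subseteq> {1..n}" using f_sim sim_in by blast
  moreover have "y \<in> f ` {1..n}" if y: "y \<in> {1..n}" for y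
  proof -
    \<comment> \<open>Surjectivity: \<open>y\<close> is reached from the preceding point of its
      block, or from the last point if \<open>y\<close> is the first.\<close>
    have "\<exists>i \<in> {1..n}. fat \<pi> i = y"
    proof (cases "\<exists>i. i < y \<and> i \<sim> y")
      case True
      define i where "i = (GREATEST i. i < y \<and> i \<sim> y)"
      have i: "i < y" "i \<sim> y"
        using GreatestI_ex_nat[OF True, of y] by (auto simp: i_def)
      have "\<not> i \<sim> k" if "i < k" "k < y" for k
      proof
        assume "i \<sim> k"
        then have "k < y \<and> k \<sim> y" using that i sim_sym sim_trans by blast
        then have "k \<le> i" unfolding i_def by (rule Greatest_le_nat[where b = y]) simp
        with that show False by simp
      qed
      then show ?thesis using fat_next i sim_in by blast
    next
      case False
      define i where "i = (GREATEST i. y \<sim> i)"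
      have bound: "k \<le> n" if "y \<sim> k" for k using sim_in[OF that] by simp
      have i: "y \<sim> i"
        unfolding i_def by (rule GreatestI_nat[where b = n]) (use sim_refl[OF y] bound in auto)
      have max: "k \<le> i" if "y \<sim> k" for k
        unfolding i_def using that bound by (rule Greatest_le_nat)
      have "fat \<pi> i = y"
      proof (rule fat_wrap)
        show "\<not> i \<sim> k" if "i < k" for k using max[of k] sim_trans[OF i] that by (meson not_less)
        show "i \<sim> y" using i by (rule sim_sym)
        show "\<not> i \<sim> k" if "k < y" for k using False that sim_sym sim_trans[OF i] by blast
      qed
      then show ?thesis using i sim_in by blast
    qed
    then obtain i where i: "i \<in> {1..n}" "fat \<pi> i = y" ..
    define x where "x = (if i = n then 1 else i + 1)"
    have "x \<in> {1..n}" "c_shift n x = i" using i(1) by (auto simp: x_def c_shift_def)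
    then show ?thesis using f_eq i(2) by (metis imageI)
  qed
  ultimately have img: "f ` {1..n} = {1..n}" by blast
  then have "inj_on f {1..n}" by (intro eq_card_imp_inj_on) auto
  with img show "bij_betw f {1..n} {1..n}" by (simp add: bij_betw_def)
qed

text \<open>The steps that are not clockwise winds, so that \<open>k_s\<close> is their number in
  the cycle \<open>b_s\<close>.\<close>

definition descents where "descents = {x \<in> {1..n}. f x < x}"

text \<open>For \<open>x \<ge> 2\<close>, \<open>f x\<close> is the next point after
  \<open>x - 1\<close> in its block, hence at least \<open>x\<close>, unless \<open>x - 1\<close> is
  the last point and \<open>f\<close> wraps around. At \<open>x = 1\<close> nothing lies below. So
  descents correspond to the blocks not containing \<open>n\<close>.\<close>

lemma in_descents_iff:
  "x \<in> descents \<longleftrightarrow> x \<in> {2..n} \<and> (\<forall>k. x - 1 < k \<longrightarrow> \<not> x - 1 \<sim> k)"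
proof (cases "x \<in> {2..n}")
  case True
  then have x: "x \<in> {1..n}" "x - 1 \<in> {1..n}" "f x = fat \<pi> (x - 1)"
    by (auto simp: f_eq c_shift_def)
  from x(2) show ?thesis
  proof (cases rule: fat_cases)
    case succ
    then show ?thesis using x True by (auto simp: descents_def)
  next
    case wrap
    then show ?thesis using x True by (auto simp: descents_def)
  qed
next
  case False
  have "\<not> f 1 < 1" using permutes_in_image[OF f_permutes, of 1] n_pos by auto
  then have "x \<noteq> 1" if "x \<in> descents" using that by (auto simp: descents_def)
  then show ?thesis using False by (auto simp: descents_def)
qed

text \<open>Fixed points of \<open>f\<close> are the trivial steps of the walk. Together with
  \<open>zero_in_winding_type_iff\<close> this matches the two conventions for the value
  zero.\<close>

lemma f_fixpoint_iff:
  assumes "x \<in> {1..n}"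
  shows "f x = x \<longleftrightarrow> c_shift n x \<sim> x"
proof
  assume "f x = x"
  then show "c_shift n x \<sim> x" using f_sim[OF assms] by simp
next
  assume sim: "c_shift n x \<sim> x"
  show "f x = x"
  proof (cases "x = 1")
    case True
    have "\<not> n \<sim> k" if "n < k \<or> k < 1" for k
      using sim_in[of n k] that by auto
    then have "fat \<pi> n = 1"
      using sim True by (intro fat_wrap) (auto simp: c_shift_def)
    then show ?thesis using True f_eq[OF assms] by (simp add: c_shift_def)
  next
    case False
    then have "fat \<pi> (x - 1) = x"
      using sim assms by (intro fat_next) (auto simp: c_shift_def)
    then show ?thesis using False f_eq[OF assms] by (simp add: c_shift_def)
  qed
qed

lemma orbit_subset_carrier: "x \<in> {1..n} \<Longrightarrow> orbit f x \<subseteq> {1..n}"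
  using permutes_orbit_subset[OF f_permutes] .

lemma self_in_orbit: "x \<in> orbit f x"
  using f_permutes by (intro permutation_self_in_orbit) (auto simp: permutation_permutes)

text \<open>The largest point of a cycle is mapped to at most itself, so it is a descent unless it
  is fixed.\<close>

lemma descents_orbit_empty_iff:
  "(\<exists>x\<in>{1..n}. descents \<inter> orbit f x = {}) \<longleftrightarrow> (\<exists>x\<in>{1..n}. f x = x)"
proof
  assume "\<exists>x\<in>{1..n}. descents \<inter> orbit f x = {}"
  then obtain x where x: "x \<in> {1..n}" "descents \<inter> orbit f x = {}" ..
  define m where "m = Max (orbit f x)"
  have fin: "finite (orbit f x)" using orbit_subset_carrier[OF x(1)] finite_subset by blast
  then have m: "m \<in> orbit f x" using orbit_nonempty unfolding m_def by (intro Max_in)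
  then have mn: "m \<in> {1..n}" using orbit_subset_carrier[OF x(1)] by blast
  have "f m \<le> m" unfolding m_def using fin m by (intro Max_ge) (auto simp: m_def intro: orbit.step)
  moreover have "\<not> f m < m" using x(2) m mn by (auto simp: descents_def)
  ultimately have "f m = m" by simp
  then show "\<exists>x\<in>{1..n}. f x = x" using mn by blast
next
  assume "\<exists>x\<in>{1..n}. f x = x"
  then obtain x where x: "x \<in> {1..n}" "f x = x" ..
  then have "orbit f x = {x}" by (simp add: orbit_eq_singleton_iff)
  moreover have "x \<notin> descents" using x by (simp add: descents_def)
  ultimately show "\<exists>x\<in>{1..n}. descents \<inter> orbit f x = {}" using x(1) by auto
qed

lemma winding_type_nth:
  assumes "r < length (winding_type n \<pi>)"
  shows "winding_type n \<pi> ! r = card (descents \<inter> cycles_of n f ! r)"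
proof -
  let ?b = "cycles_of n f ! r"
  have r: "r < length (cycles_of n f)" using assms by (simp add: winding_type_def Let_def)
  then have "?b \<in> orbit f ` {1..n}" using set_cycles_of[OF f_permutes] nth_mem by blast
  then have b: "?b \<subseteq> {1..n}" using orbit_subset_carrier by blast
  then have fin: "finite ?b" using finite_subset by blast
  have "winding_type n \<pi> ! r = card ?b - card {x \<in> ?b. x \<le> f x}"
    using r by (simp add: winding_type_def Let_def clockwise_winds_def)
  also have "\<dots> = card (?b - {x \<in> ?b. x \<le> f x})"
    using fin by (intro card_Diff_subset[symmetric]) auto
  also have "?b - {x \<in> ?b. x \<le> f x} = descents \<inter> ?b"
    using b by (auto simp: descents_def)
  finally show ?thesis .
qed

lemma zero_in_winding_type_iff:
  "0 \<in> set (winding_type n \<pi>) \<longleftrightarrow> (\<exists>x\<in>{1..n}. f x = x)"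
proof -
  have fin: "finite (descents \<inter> b)" for b by (simp add: descents_def)
  have "0 \<in> set (winding_type n \<pi>) \<longleftrightarrow> (\<exists>r < length (winding_type n \<pi>). winding_type n \<pi> ! r = 0)"
    by (simp add: in_set_conv_nth)
  also have "\<dots> \<longleftrightarrow> (\<exists>r < length (winding_type n \<pi>). descents \<inter> cycles_of n f ! r = {})"
    using winding_type_nth fin by (metis card_0_eq)
  also have "\<dots> \<longleftrightarrow> (\<exists>b \<in> set (cycles_of n f). descents \<inter> b = {})"
    by (simp add: winding_type_def Let_def) (metis in_set_conv_nth)
  also have "\<dots> \<longleftrightarrow> (\<exists>x\<in>{1..n}. f x = x)"
    unfolding set_cycles_of[OF f_permutes] bex_simps(7) by (rule descents_orbit_empty_iff)
  finally show ?thesis .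
qed

abbreviation ks where "ks \<equiv> winding_type n \<pi>"

text \<open>Pick a descent in each cycle and iterate the first-return map from it: by
  \<open>orbit_first_return\<close> this lists the descents of the cycle, \<open>ks ! r\<close> in
  number, and then closes up. The index set of \<Sigma> becomes the set of descents, with the first
  return as cyclic shift.\<close>

lemma descents_enumeration:
  assumes "0 \<notin> set ks"
  obtains e where "bij_betw e (family_index ks) descents"
    "\<And>r s. r < length ks \<Longrightarrow> s < ks ! r \<Longrightarrow>
      first_return descents f (e (r, s)) = e (r, Suc s mod ks ! r)"
proof -
  let ?g = "first_return descents f" and ?bs = "cycles_of n f"
  have len: "length ks = length ?bs" by (simp add: winding_type_def Let_def)
  have bs: "\<exists>x\<in>{1..n}. ?bs ! r = orbit f x" if "r < length ks" for r
    using that len set_cycles_of[OF f_permutes] nth_mem[of r ?bs] by auto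
  have "descents \<inter> ?bs ! r \<noteq> {}" if "r < length ks" for r
    using assms winding_type_nth[OF that] that by (metis card.empty nth_mem)
  then have "\<forall>r. \<exists>d. r < length ks \<longrightarrow> d \<in> descents \<inter> ?bs ! r" by blast
  then obtain d where d: "\<And>r. r < length ks \<Longrightarrow> d r \<in> descents \<inter> ?bs ! r"
    using choice[of "\<lambda>r d. r < length ks \<longrightarrow> d \<in> descents \<inter> ?bs ! r"] by blast
  have orb_f: "orbit f (d r) = ?bs ! r" if "r < length ks" for r
    using d[OF that] bs[OF that] orbit_cyclic_eq3 cyclic_on_orbit[OF f_permutes] by (metis IntD2 finite_atLeastAtMost)
  have orb: "orbit ?g (d r) = descents \<inter> ?bs ! r" "d r \<in> orbit ?g (d r)" if "r < length ks" for r
    using orbit_first_return[of "d r" descents f] d[OF that] orb_f[OF that] self_in_orbit by auto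
  have k: "ks ! r = funpow_dist1 ?g (d r) (d r)" if "r < length ks" for r
  proof -
    have "card (orbit ?g (d r)) = card {0..<funpow_dist1 ?g (d r) (d r)}"
      unfolding orbit_conv_funpow_dist1[OF orb(2)[OF that]]
      by (intro card_image inj_on_funpow_dist1 orb(2)[OF that])
    then show ?thesis using winding_type_nth[OF that] orb(1)[OF that] by simp
  qed
  have bij: "bij_betw (\<lambda>s. (?g ^^ s) (d r)) {0..<ks ! r} (descents \<inter> ?bs ! r)" if "r < length ks" for r
    unfolding k[OF that] orb(1)[OF that, symmetric] bij_betw_def
    using inj_on_funpow_dist1[OF orb(2)[OF that]] orbit_conv_funpow_dist1[OF orb(2)[OF that]] by simp
  define e where "e = (\<lambda>(r, s). (?g ^^ s) (d r))"
  have e_in: "e (r, s) \<in> descents \<inter> ?bs ! r" if "r < length ks" "s < ks ! r" for r s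
    using bij_betwE[OF bij[OF that(1)]] that(2) by (simp add: e_def)
  have "bij_betw e (family_index ks) descents"
    unfolding bij_betw_def
  proof
    show "inj_on e (family_index ks)"
    proof (rule inj_onI, clarsimp simp: family_index_def)
      fix r s r' s' assume r: "r < length ks" "s < ks ! r" "r' < length ks" "s' < ks ! r'"
        and eq: "e (r, s) = e (r', s')"
      have "e (r, s) \<in> ?bs ! r" "e (r, s) \<in> ?bs ! r'"
        using e_in[OF r(1,2)] e_in[OF r(3,4)] eq by auto
      then have "?bs ! r = ?bs ! r'"
        using bs r orbit_cyclic_eq3 cyclic_on_orbit[OF f_permutes] by (metis finite_atLeastAtMost)
      then have "r = r'"
        using distinct_cycles_of len r by (metis nth_eq_iff_index_eq)
      moreover from this have "s = s'"
        using eq r bij_betw_imp_inj_on[OF bij[OF r(1)]] by (auto simp: e_def inj_on_def)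
      ultimately show "r = r' \<and> s = s'" ..
    qed
    show "e ` family_index ks = descents"
    proof
      show "e ` family_index ks \<subseteq> descents" using e_in by (auto simp: family_index_def)
      show "descents \<subseteq> e ` family_index ks"
      proof
        fix y assume y: "y \<in> descents"
        then have "orbit f y \<in> set ?bs"
          unfolding set_cycles_of[OF f_permutes] by (intro imageI) (simp add: descents_def)
        then obtain r where r: "r < length ks" "?bs ! r = orbit f y"
          unfolding len in_set_conv_nth by blast
        then have "y \<in> descents \<inter> ?bs ! r" using y self_in_orbit by auto
        then have "y \<in> (\<lambda>s. (?g ^^ s) (d r)) ` {0..<ks ! r}"
          by (simp only: bij_betw_imp_surj_on[OF bij[OF r(1)]])
        then obtain s where "s < ks ! r" "y = (?g ^^ s) (d r)" by (auto simp only: atLeastLessThan_iff)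
        then show "y \<in> e ` family_index ks"
          using r(1) by (intro image_eqI[of _ _ "(r, s)"]) (auto simp: e_def family_index_def)
      qed
    qed
  qed
  moreover have "?g (e (r, s)) = e (r, Suc s mod ks ! r)" if r: "r < length ks" and s: "s < ks ! r" for r s
  proof (cases "Suc s = ks ! r")
    case True
    then have "(?g ^^ Suc s) (d r) = d r"
      using funpow_dist1_prop[OF orb(2)[OF r]] k[OF r] by simp
    then show ?thesis using True[symmetric] by (simp add: e_def)
  next
    case False
    then show ?thesis using s by (simp add: e_def)
  qed
  ultimately show ?thesis using that by blast
qed


section \<open>The slide permutation of a labelled walk\<close>

lemma distinct_adj_labels_iff:
  "distinct_adj (a n # map a [1..<Suc n]) \<longleftrightarrow> (\<forall>x\<in>{1..n}. a (c_shift n x) \<noteq> a x)"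
proof -
  let ?L = "a n # map a [1..<Suc n]"
  have nth: "?L ! i = a (c_shift n (Suc i))" "?L ! Suc i = a (Suc i)" if "i < n" for i
    using that by (cases i; simp add: c_shift_def del: upt_Suc)+
  have "distinct_adj ?L \<longleftrightarrow> (\<forall>i<n. ?L ! i \<noteq> ?L ! Suc i)"
    by (simp add: distinct_adj_conv_nth del: upt_Suc)
  also have "\<dots> \<longleftrightarrow> (\<forall>i<n. a (c_shift n (Suc i)) \<noteq> a (Suc i))"
    using nth by simp
  also have "\<dots> \<longleftrightarrow> (\<forall>x\<in>{1..n}. a (c_shift n x) \<noteq> a x)"
    by (metis Suc_le_D Suc_le_eq atLeastAtMost_iff One_nat_def Suc_leI zero_less_Suc)
  finally show ?thesis .
qed

lemma slide_Suc:
  "slide (a n) (map a [1..<Suc (Suc t)]) =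
    transpose (a (c_shift n (Suc t))) (a (Suc t)) \<circ> slide (a n) (map a [1..<Suc t])"
proof -
  have "last (a n # map a [1..<Suc t]) = a (c_shift n (Suc t))"
    by (simp add: c_shift_def)
  moreover have "map a [1..<Suc (Suc t)] = map a [1..<Suc t] @ [a (Suc t)]" by simp
  ultimately show ?thesis by (simp only: slide_append slide.simps id_comp)
qed

text \<open>The element labelled by the block with maximum \<open>d - 1\<close> rests until time \<open>f d\<close>; whenever it
  moves at time \<open>x\<close>, it takes the place labelled by the block of \<open>c_shift n x\<close>. So its successive
  moves trace the \<open>f\<close>-orbit of \<open>d\<close> until that block has no later element.\<close>

lemma slide_descent:
  assumes lab: "\<And>i j. i \<in> {1..n} \<Longrightarrow> j \<in> {1..n} \<Longrightarrow> a i = a j \<longleftrightarrow> i \<sim> j"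
    and proper: "\<And>x. x \<in> {1..n} \<Longrightarrow> a (c_shift n x) \<noteq> a x"
    and d: "d \<in> descents"
  shows "slide (a n) (map a [1..<Suc n]) (a (d - 1)) = a (first_return descents f d - 1)"
    and "first_return descents f d \<in> descents"
proof -
  define T where "T t = slide (a n) (map a [1..<Suc t]) (a (d - 1))" for t
  have T_Suc: "T (Suc t) = transpose (a (c_shift n (Suc t))) (a (Suc t)) (T t)" for t
    by (simp only: T_def slide_Suc comp_apply)
  have d2: "d \<in> {2..n}" and dmax: "\<And>k. d - 1 < k \<Longrightarrow> \<not> d - 1 \<sim> k"
    using d in_descents_iff by auto
  have dn: "d - 1 \<in> {1..n}" "d \<in> {1..n}" using d2 by auto
  have nn: "n \<in> {1..n}" using n_pos by simp
  define y where "y = f d"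
  have y_fat: "y = fat \<pi> (d - 1)" using d2 dn by (simp add: y_def f_eq c_shift_def)
  have y: "d - 1 \<sim> y" "\<And>k. k < y \<Longrightarrow> \<not> d - 1 \<sim> k"
    using dn(1) by (cases rule: fat_cases; use dmax y_fat in auto)+
  have yn: "y \<in> {1..n}" using y(1) sim_in by blast
  have ay: "a y = a (d - 1)" using lab[OF dn(1) yn] y(1) by simp
  have ne: "a (d - 1) \<noteq> a k" if "k \<in> {1..n}" "k < y \<or> d - 1 < k" for k
    using lab[OF dn(1) that(1)] that(2) y(2) dmax by blast
  \<comment> \<open>For \<open>t = 0\<close> the predecessor is \<open>n\<close>, which exceeds
    \<open>d - 1\<close>; otherwise it is \<open>t\<close>, which lies before \<open>y\<close>.
    Neither belongs to the block of \<open>d - 1\<close>.\<close>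
  have ne_c: "a (d - 1) \<noteq> a (c_shift n (Suc t))" if "Suc t \<le> y" for t
  proof (rule ne)
    show "c_shift n (Suc t) \<in> {1..n}" using that yn by (intro c_shift_in) auto
    show "c_shift n (Suc t) < y \<or> d - 1 < c_shift n (Suc t)"
      using that d2 by (auto simp: c_shift_def)
  qed
  have before: "T t = a (d - 1)" if "t < y" for t
    using that
  proof (induction t)
    case 0
    then show ?case by (simp add: T_def)
  next
    case (Suc t)
    have "Suc t \<in> {1..n}" using Suc.prems yn by auto
    then have "a (d - 1) \<noteq> a (Suc t)" using ne Suc.prems by blast
    then show ?case using Suc ne_c[of t] by (simp add: T_Suc)
  qed
  \<comment> \<open>Invariant after time \<open>t\<close>: the element was last moved at time
    \<open>(f ^^ k) d\<close>, to the label of the preceding point; that label has not been visited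
    since, and none of the intermediate times was a descent.\<close>
  have inv: "\<exists>k. 0 < k \<and> (f ^^ k) d \<in> {1..t} \<and> T t = a (c_shift n ((f ^^ k) d)) \<and>
      (\<forall>s\<in>{(f ^^ k) d..t}. a s \<noteq> a (c_shift n ((f ^^ k) d))) \<and> (\<forall>j. 0 < j \<longrightarrow> j < k \<longrightarrow> (f ^^ j) d \<notin> descents)"
    if "y \<le> t" "t \<le> n" for t
    using that
  proof (induction t rule: dec_induct)
    case base
    obtain y' where y': "y = Suc y'" using yn by (cases y) auto
    have "T y = a (c_shift n y)"
      using before[of y'] ay by (simp add: y' T_Suc)
    moreover have "a y \<noteq> a (c_shift n y)" using proper[OF yn] by simp
    ultimately show ?case using yn by (intro exI[of _ 1]) (auto simp: y_def)
  next
    case (step t)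
    then obtain k where k: "0 < k" "(f ^^ k) d \<in> {1..t}" "T t = a (c_shift n ((f ^^ k) d))"
      "\<forall>s\<in>{(f ^^ k) d..t}. a s \<noteq> a (c_shift n ((f ^^ k) d))"
      "\<forall>j. 0 < j \<longrightarrow> j < k \<longrightarrow> (f ^^ j) d \<notin> descents" by auto
    define x where "x = (f ^^ k) d"
    have x: "x \<in> {1..n}" "x \<le> t" using k(2) step by (auto simp: x_def)
    have t: "Suc t \<in> {1..n}" "t \<in> {1..n}" using step x by auto
    have ct: "c_shift n (Suc t) = t" using t by (simp add: c_shift_def)
    have cx: "c_shift n x \<in> {1..n}" using x c_shift_in by blast
    have at: "a t \<noteq> a (c_shift n x)" using k(4) x by (auto simp: x_def)
    show ?case
    proof (cases "a (Suc t) = a (c_shift n x)")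
      case False
      have "T (Suc t) = a (c_shift n x)"
        using k(3) at False by (simp add: T_Suc ct x_def[symmetric])
      moreover have "a s \<noteq> a (c_shift n x)" if "s \<in> {x..Suc t}" for s
        using that k(4) False by (cases "s = Suc t") (auto simp: x_def)
      ultimately show ?thesis
        using k x by (intro exI[of _ k]) (auto simp: x_def[symmetric])
    next
      case True
      have TS: "T (Suc t) = a (c_shift n (Suc t))"
        using k(3) True by (simp add: T_Suc ct x_def[symmetric])
      have sim: "c_shift n x \<sim> Suc t" using lab[OF cx t(1)] True by simp
      have nsim: "\<not> c_shift n x \<sim> s" if "x \<le> s" "s \<le> t" for s
        using that lab[OF cx, of s] k(4) x t by (force simp: x_def[symmetric])
      \<comment> \<open>The label is visited again at the next point of its block, which is
        \<open>f x\<close>; if \<open>x = 1\<close>, the preceding point is \<open>n\<close> and the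
        next one is the first point of the block.\<close>
      have fx: "f x = Suc t"
      proof (cases "x = 1")
        case True
        then have "c_shift n x = n" by (simp add: c_shift_def)
        have "fat \<pi> (c_shift n x) = Suc t"
        proof (rule fat_wrap)
          show "\<not> c_shift n x \<sim> l" if "c_shift n x < l" for l
            using that \<open>c_shift n x = n\<close> sim_in[of n l] by auto
          show "\<not> c_shift n x \<sim> l" if "l < Suc t" for l
            using that nsim[of l] sim_in[of "c_shift n x" l] True by auto
        qed (rule sim)
        then show ?thesis using f_eq[OF x(1)] by simp
      next
        case False
        then have c: "c_shift n x = x - 1" by (simp add: c_shift_def)
        have "fat \<pi> (c_shift n x) = Suc t"
          using nsim sim c x by (intro fat_next) auto
        then show ?thesis using f_eq[OF x(1)] by simp
      qed
      have "x \<notin> descents" using fx x by (auto simp: descents_def)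
      then have "\<forall>j. 0 < j \<longrightarrow> j < Suc k \<longrightarrow> (f ^^ j) d \<notin> descents"
        using k(5) by (auto simp: x_def less_Suc_eq)
      moreover have "(f ^^ Suc k) d = Suc t" using fx by (simp add: x_def)
      moreover have "a (Suc t) \<noteq> a (c_shift n (Suc t))" using proper[OF t(1)] by simp
      ultimately show ?thesis using TS by (intro exI[of _ "Suc k"]) auto
    qed
  qed
  obtain k where k: "0 < k" "(f ^^ k) d \<in> {1..n}" "T n = a (c_shift n ((f ^^ k) d))"
      "\<forall>s\<in>{(f ^^ k) d..n}. a s \<noteq> a (c_shift n ((f ^^ k) d))"
      "\<And>j. 0 < j \<Longrightarrow> j < k \<Longrightarrow> (f ^^ j) d \<notin> descents"
    using inv[of n] yn by auto
  define x where "x = (f ^^ k) d"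
  have x: "x \<in> {1..n}" using k(2) by (simp add: x_def)
  \<comment> \<open>For \<open>x = 1\<close> the element would rest at the label of
    \<open>n\<close>, which is visited at time \<open>n\<close>.\<close>
  have "x \<noteq> 1"
  proof
    assume "x = 1"
    then have "a n \<noteq> a (c_shift n x)" using k(4) n_pos by (auto simp: x_def)
    then show False using \<open>x = 1\<close> by (simp add: c_shift_def)
  qed
  then have c: "c_shift n x = x - 1" by (simp add: c_shift_def)
  have "\<not> x - 1 \<sim> s" if "x - 1 < s" for s
  proof
    assume "x - 1 \<sim> s"
    moreover from this have "s \<in> {1..n}" "x - 1 \<in> {1..n}" using sim_in by blast+
    ultimately show False using lab[of "x - 1" s] k(4) that c by (auto simp: x_def)
  qed
  then have xD: "x \<in> descents" using x \<open>x \<noteq> 1\<close> in_descents_iff by auto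
  have ret: "first_return descents f d = x"
    unfolding x_def using k(1,5) xD by (intro first_return_eqI) (auto simp: x_def)
  show "slide (a n) (map a [1..<Suc n]) (a (d - 1)) = a (first_return descents f d - 1)"
    using k(3) c by (simp only: T_def ret x_def[symmetric])
  show "first_return descents f d \<in> descents" using ret xD by simp
qed

section \<open>Descents as names of the blocks without \<open>n\<close>, and labelings as injective
  families\<close>

lemma descents_cover:
  assumes "x \<in> {1..n}" "\<not> x \<sim> n"
  shows "\<exists>d\<in>descents. x \<sim> d - 1"
proof -
  define m where "m = (GREATEST m. x \<sim> m)"
  have bound: "k \<le> n" if "x \<sim> k" for k using sim_in[OF that] by simp
  have m: "x \<sim> m"
    unfolding m_def by (rule GreatestI_nat[where b = n]) (use sim_refl[OF assms(1)] bound in auto)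
  have max: "k \<le> m" if "x \<sim> k" for k
    unfolding m_def using that bound by (rule Greatest_le_nat)
  have "m \<in> {1..n}" "m \<noteq> n" using m sim_in assms(2) by blast+
  then have "Suc m \<in> descents"
    unfolding in_descents_iff using max sim_trans[OF m] by (force simp: not_less[symmetric])
  then show ?thesis using m by force
qed

lemma descents_unique:
  assumes "d \<in> descents" "d' \<in> descents" "d - 1 \<sim> d' - 1"
  shows "d = d'"
proof -
  have "\<not> d - 1 < d' - 1" "\<not> d' - 1 < d - 1"
    using assms sim_sym unfolding in_descents_iff by blast+
  moreover have "2 \<le> d" "2 \<le> d'" using assms unfolding in_descents_iff by auto
  ultimately show ?thesis by linarith
qed

lemma descents_pred: "d \<in> descents \<Longrightarrow> d - 1 \<in> {1..n} \<and> \<not> d - 1 \<sim> n"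
  unfolding in_descents_iff by auto


lemma labelingsD:
  assumes "a \<in> labelings q {1..n} \<pi>"
  shows "i \<in> {1..n} \<Longrightarrow> j \<in> {1..n} \<Longrightarrow> a i = a j \<longleftrightarrow> i \<sim> j"
    and "i \<in> {1..n} \<Longrightarrow> a i \<in> {0..q}" and "restrict a {1..n} = a"
proof -
  have a: "a \<in> {1..n} \<rightarrow>\<^sub>E {0..q}" "\<forall>x\<in>{1..n}. \<forall>y\<in>{1..n}. a x = a y \<longleftrightarrow> x \<sim> y"
    using assms unfolding labelings_def by blast+
  show "i \<in> {1..n} \<Longrightarrow> j \<in> {1..n} \<Longrightarrow> a i = a j \<longleftrightarrow> i \<sim> j" using a(2) by blast
  show "i \<in> {1..n} \<Longrightarrow> a i \<in> {0..q}" using a(1) by blast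
  show "restrict a {1..n} = a" using a(1) by (rule PiE_restrict)
qed

lemma n_in: "n \<in> {1..n}"
  using n_pos by simp

text \<open>Once \<open>a n = 0\<close>, a labeling is determined by one label for each other block,
  read at its last point \<open>d - 1\<close>. These labels are distinct and non-zero and otherwise
  arbitrary.\<close>

lemma bij_betw_labelings_families:
  assumes e: "bij_betw e (family_index ks) descents"
  shows "bij_betw (\<lambda>a. restrict (\<lambda>i. a (e i - 1)) (family_index ks))
    {a \<in> labelings q {1..n} \<pi>. a n = 0} (injective_families ks {1..q})"
    (is "bij_betw ?\<Phi> ?A ?B")
proof -
  let ?FI = "family_index ks"
  have ein: "e i \<in> descents" if "i \<in> ?FI" for i using e that by (rule bij_betw_apply)
  note lab = labelingsD
  have into: "?\<Phi> a \<in> ?B" if a: "a \<in> ?A" for a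
  proof -
    have aL: "a \<in> labelings q {1..n} \<pi>" and an: "a n = 0" using a by auto
    have "a (e i - 1) \<in> {1..q}" if "i \<in> ?FI" for i
    proof -
      have "a (e i - 1) \<in> {0..q}" "a (e i - 1) \<noteq> a n"
        using descents_pred[OF ein[OF that]] lab(2)[OF aL] lab(1)[OF aL _ n_in] by auto
      then show ?thesis using an by auto
    qed
    moreover have "inj_on (\<lambda>i. a (e i - 1)) ?FI"
    proof (rule inj_onI)
      fix i j assume ij: "i \<in> ?FI" "j \<in> ?FI" and "a (e i - 1) = a (e j - 1)"
      then have "e i - 1 \<sim> e j - 1"
        using lab(1)[OF aL] descents_pred[OF ein] by blast
      then have "e i = e j" using descents_unique ein ij by blast
      then show "i = j" using bij_betw_imp_inj_on[OF e] ij by (meson inj_onD)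
    qed
    ultimately show ?thesis by (auto simp: injective_families_def inj_on_def)
  qed
  have inj: "inj_on ?\<Phi> ?A"
  proof (rule inj_onI)
    fix a b assume a: "a \<in> ?A" and b: "b \<in> ?A" and eq: "?\<Phi> a = ?\<Phi> b"
    have aL: "a \<in> labelings q {1..n} \<pi>" "a n = 0" and bL: "b \<in> labelings q {1..n} \<pi>" "b n = 0"
      using a b by auto
    have "a x = b x" if x: "x \<in> {1..n}" for x
    proof (cases "x \<sim> n")
      case True
      then show ?thesis using lab(1)[OF aL(1) x n_in] lab(1)[OF bL(1) x n_in] aL(2) bL(2) by simp
    next
      case False
      then obtain d where d: "d \<in> descents" "x \<sim> d - 1" using descents_cover[OF x] by blast
      then obtain i where i: "i \<in> ?FI" "d = e i" using e by (metis bij_betw_imp_surj_on imageE)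
      have "?\<Phi> a i = ?\<Phi> b i" using eq by simp
      then have "a (d - 1) = b (d - 1)" using i by simp
      then show ?thesis
        using lab(1)[OF aL(1) x] lab(1)[OF bL(1) x] d descents_pred[OF d(1)] by metis
    qed
    then have "restrict a {1..n} = restrict b {1..n}" by (auto simp: restrict_def)
    then show "a = b" using lab(3)[OF aL(1)] lab(3)[OF bL(1)] by metis
  qed
  have surj: "b \<in> ?\<Phi> ` ?A" if b: "b \<in> ?B" for b
  proof -
    have bPi: "b \<in> ?FI \<rightarrow>\<^sub>E {1..q}" and binj: "inj_on b ?FI"
      using b by (auto simp: injective_families_def)
    \<comment> \<open>\<open>top x\<close> is the descent that names the block of
      \<open>x\<close>.\<close>
    define top where "top x = (SOME d. d \<in> descents \<and> x \<sim> d - 1)" for x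
    have top: "top x \<in> descents \<and> x \<sim> top x - 1" if "x \<in> {1..n}" "\<not> x \<sim> n" for x
    proof -
      have "\<exists>d. d \<in> descents \<and> x \<sim> d - 1" using descents_cover[OF that] by blast
      then show ?thesis unfolding top_def by (rule someI_ex)
    qed
    define e' where "e' = the_inv_into ?FI e"
    have e': "e' d \<in> ?FI \<and> e (e' d) = d" if "d \<in> descents" for d
    proof -
      have "inj_on e ?FI" "d \<in> e ` ?FI" using e that by (simp_all add: bij_betw_def)
      then show ?thesis
        unfolding e'_def by (simp add: f_the_inv_into_f the_inv_into_into)
    qed
    define a where "a = restrict (\<lambda>x. if x \<sim> n then 0 else b (e' (top x))) {1..n}"
    have a_in: "b (e' (top x)) \<in> {1..q}" if "x \<in> {1..n}" "\<not> x \<sim> n" for x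
      using PiE_mem[OF bPi] e' top[OF that] by blast
    have ker: "a x = a y \<longleftrightarrow> x \<sim> y" if x: "x \<in> {1..n}" and y: "y \<in> {1..n}" for x y
    proof (cases "x \<sim> n \<or> y \<sim> n")
      case True
      then consider "x \<sim> n" "y \<sim> n" | "x \<sim> n" "\<not> y \<sim> n" | "\<not> x \<sim> n" "y \<sim> n" by blast
      then show ?thesis
      proof cases
        case 1
        then have "x \<sim> y" using sim_sym sim_trans by blast
        then show ?thesis using 1 x y by (simp add: a_def)
      next
        case 2
        then have "\<not> x \<sim> y" using sim_sym sim_trans by blast
        then show ?thesis using 2 x y a_in[OF y 2(2)] by (simp add: a_def)
      next
        case 3
        then have "\<not> x \<sim> y" using sim_sym sim_trans by blast
        then show ?thesis using 3 x y a_in[OF x 3(1)] by (simp add: a_def)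
      qed
    next
      case False
      then have nx: "\<not> x \<sim> n" and ny: "\<not> y \<sim> n" by auto
      note tx = top[OF x nx] and ty = top[OF y ny]
      have "a x = a y \<longleftrightarrow> b (e' (top x)) = b (e' (top y))"
        using nx ny x y by (simp add: a_def)
      also have "\<dots> \<longleftrightarrow> top x = top y"
        using inj_on_eq_iff[OF binj] e' tx ty by metis
      also have "\<dots> \<longleftrightarrow> x \<sim> y"
      proof
        assume "top x = top y"
        then show "x \<sim> y" using tx ty sim_sym sim_trans by metis
      next
        assume "x \<sim> y"
        then have "top x - 1 \<sim> top y - 1" using tx ty sim_sym sim_trans by metis
        then show "top x = top y" using tx ty descents_unique by blast
      qed
      finally show ?thesis .
    qed
    have "a \<in> {1..n} \<rightarrow>\<^sub>E {0..q}"
    proof (rule PiE_I)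
      show "a x \<in> {0..q}" if x: "x \<in> {1..n}" for x
        using a_in[OF x] x by (cases "x \<sim> n") (auto simp: a_def)
      show "a x = undefined" if "x \<notin> {1..n}" for x using that by (auto simp: a_def)
    qed
    then have "a \<in> labelings q {1..n} \<pi>" using ker unfolding labelings_def by blast
    moreover have "a n = 0" using n_in sim_refl[OF n_in] by (simp add: a_def)
    ultimately have aA: "a \<in> ?A" by blast
    have "?\<Phi> a = b"
    proof
      fix i show "?\<Phi> a i = b i"
      proof (cases "i \<in> ?FI")
        case True
        note p = descents_pred[OF ein[OF True]]
        then have "top (e i - 1) \<in> descents \<and> e i - 1 \<sim> top (e i - 1) - 1" using top by blast
        then have "top (e i - 1) = e i" using descents_unique ein[OF True] by metis
        moreover have "e' (e i) = i"
          unfolding e'_def using bij_betw_imp_inj_on[OF e] True by (rule the_inv_into_f_f)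
        ultimately show ?thesis using True p by (simp add: a_def del: One_nat_def)
      next
        case False
        then show ?thesis using PiE_arb[OF bPi] by simp
      qed
    qed
    then show ?thesis using aA by blast
  qed
  show ?thesis
    unfolding bij_betw_def using inj into surj by blast
qed

text \<open>Both supports consist of the labels \<open>a (d - 1)\<close> of descents. There the
  slide follows the first-return map by \<open>slide_descent\<close>, and the cycles follow it by
  the choice of \<open>e\<close>.\<close>

lemma slide_pperm_eq_family_pperm:
  assumes aL: "a \<in> labelings q {1..n} \<pi>" "a n = 0"
    and proper: "\<And>x. x \<in> {1..n} \<Longrightarrow> a (c_shift n x) \<noteq> a x"
    and e: "bij_betw e (family_index ks) descents"
    and ret: "\<And>r s. r < length ks \<Longrightarrow> s < ks ! r \<Longrightarrow>
      first_return descents f (e (r, s)) = e (r, Suc s mod ks ! r)"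
  shows "slide_pperm (map a [1..<Suc n]) =
    family_pperm ks (restrict (\<lambda>i. a (e i - 1)) (family_index ks))"
    (is "?L = family_pperm ks ?\<phi>")
proof (rule pperm_eqI)
  let ?FI = "family_index ks"
  note lab = labelingsD(1)[OF aL(1)]
  have ein: "e i \<in> descents" if "i \<in> ?FI" for i using e that by (rule bij_betw_apply)
  have last: "last (0 # map a [1..<Suc n]) = 0" using aL(2) n_pos by (simp add: last_map)
  have suppL: "supp ?L = a ` {1..n} - {0}"
    unfolding supp_slide_pperm[OF last] by (simp add: atLeastLessThanSuc_atLeastAtMost del: upt_Suc)
  have "a ` {1..n} - {0} = (\<lambda>d. a (d - 1)) ` descents"
  proof (intro equalityI subsetI)
    fix u assume "u \<in> a ` {1..n} - {0}"
    then obtain x where x: "x \<in> {1..n}" "u = a x" "a x \<noteq> a n" using aL(2) by auto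
    then have "\<not> x \<sim> n" using lab n_in by blast
    then obtain d where "d \<in> descents" "x \<sim> d - 1" using descents_cover x(1) by blast
    then show "u \<in> (\<lambda>d. a (d - 1)) ` descents"
      using lab[OF x(1), of "d - 1"] descents_pred x(2) by blast
  next
    fix u assume "u \<in> (\<lambda>d. a (d - 1)) ` descents"
    then obtain d where d: "d \<in> descents" "u = a (d - 1)" by blast
    then have "a (d - 1) \<noteq> a n" using lab n_in descents_pred by blast
    then show "u \<in> a ` {1..n} - {0}" using d descents_pred aL(2) by auto
  qed
  also have "\<dots> = ?\<phi> ` ?FI"
    unfolding bij_betw_imp_surj_on[OF e, symmetric] image_image by (rule image_cong) simp_all
  finally show supp: "supp ?L = supp (family_pperm ks ?\<phi>)"
    by (simp only: suppL supp_family_pperm)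
  have "?\<phi> \<in> injective_families ks {1..q}"
    using bij_betw_apply[OF bij_betw_labelings_families[OF e]] aL by blast
  then have inj: "inj_on ?\<phi> ?FI" by (simp add: injective_families_def)
  show "pperm_fun ?L = pperm_fun (family_pperm ks ?\<phi>)"
  proof
    fix u
    show "pperm_fun ?L u = pperm_fun (family_pperm ks ?\<phi>) u"
    proof (cases "u \<in> supp ?L")
      case False
      then show ?thesis
        using permutes_not_in[OF pperm_fun_permutes] supp by metis
    next
      case True
      then obtain r s where rs: "(r, s) \<in> ?FI" "u = ?\<phi> (r, s)"
        unfolding supp supp_family_pperm by auto
      then have r: "r < length ks" "s < ks ! r" by (auto simp: family_index_def)
      then have next_in: "(r, Suc s mod ks ! r) \<in> ?FI" by (simp add: family_index_def)
      have u: "u = a (e (r, s) - 1)" using rs by simp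
      have "pperm_fun ?L u = slide (a n) (map a [1..<Suc n]) (a (e (r, s) - 1))"
        unfolding pperm_fun_slide_pperm[OF last] u aL(2) ..
      also have "\<dots> = a (first_return descents f (e (r, s)) - 1)"
        by (rule slide_descent(1)[OF lab proper ein[OF rs(1)]])
      also have "\<dots> = ?\<phi> (r, Suc s mod ks ! r)"
        using ret[OF r] next_in by simp
      also have "\<dots> = pperm_fun (family_pperm ks ?\<phi>) u"
        unfolding rs(2) by (rule pperm_fun_family_pperm[OF inj r, symmetric])
      finally show ?thesis .
    qed
  qed
qed

text \<open>Whether a step is trivial depends on \<pi> alone, so either all labelings are discarded,
  exactly when \<open>0 \<in> set ks\<close>, or none is and the bijection with injective families
  applies.\<close>

theorem slide_sum_eq_class_indicator_on: "slide_sum q {1..n} \<pi> = class_indicator_on {1..q} ks"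
proof -
  let ?A = "{a \<in> labelings q {1..n} \<pi>. a n = 0}"
  have max: "Max {1..n} = n" using n_pos by (intro Max_eqI) auto
  have sum: "slide_sum q {1..n} \<pi> = (\<Sum>a\<in>?A. slide_term (map a [1..<Suc n]))"
    unfolding slide_sum_def sorted_list_of_set_Icc max ..
  have last: "last (map a [1..<Suc n]) = a n" for a :: "nat \<Rightarrow> nat"
    using n_pos by (simp add: last_map)
  have term_eq: "slide_term (map a [1..<Suc n]) =
      (if \<forall>x\<in>{1..n}. a (c_shift n x) \<noteq> a x then Poly_Mapping.single (slide_pperm (map a [1..<Suc n])) 1 else 0)" for a
    unfolding slide_term_def last distinct_adj_labels_iff ..
  have proper: "(\<forall>x\<in>{1..n}. a (c_shift n x) \<noteq> a x) \<longleftrightarrow> 0 \<notin> set ks" if "a \<in> ?A" for a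
  proof -
    have "a (c_shift n x) = a x \<longleftrightarrow> f x = x" if "x \<in> {1..n}" for x
      using labelingsD(1)[of a q] \<open>a \<in> ?A\<close> f_fixpoint_iff[OF that] c_shift_in[OF that] that by blast
    then show ?thesis unfolding zero_in_winding_type_iff by blast
  qed
  show ?thesis
  proof (cases "0 \<in> set ks")
    case True
    have "(\<Sum>a\<in>?A. slide_term (map a [1..<Suc n])) = 0"
    proof (rule sum.neutral, rule ballI)
      fix a assume "a \<in> ?A"
      then show "slide_term (map a [1..<Suc n]) = 0"
        unfolding term_eq using proper True by (simp only: if_False not_True_eq_False)
    qed
    with True show ?thesis by (simp only: sum class_indicator_on_def if_True)
  next
    case False
    obtain e where e: "bij_betw e (family_index ks) descents"
      "\<And>r s. r < length ks \<Longrightarrow> s < ks ! r \<Longrightarrow>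
        first_return descents f (e (r, s)) = e (r, Suc s mod ks ! r)"
      using descents_enumeration[OF False] by blast
    let ?\<Phi> = "\<lambda>a. restrict (\<lambda>i. a (e i - 1)) (family_index ks)"
    have "slide_sum q {1..n} \<pi> = (\<Sum>a\<in>?A. Poly_Mapping.single (family_pperm ks (?\<Phi> a)) 1)"
      unfolding sum
    proof (rule sum.cong[OF refl])
      fix a assume a: "a \<in> ?A"
      then have pr: "\<forall>x\<in>{1..n}. a (c_shift n x) \<noteq> a x" using proper False by blast
      have "slide_pperm (map a [1..<Suc n]) = family_pperm ks (?\<Phi> a)"
        by (rule slide_pperm_eq_family_pperm[OF _ _ _ e, where q = q]) (use a pr in blast)+
      then show "slide_term (map a [1..<Suc n]) = Poly_Mapping.single (family_pperm ks (?\<Phi> a)) 1"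
        unfolding term_eq if_P[OF pr] by (simp only:)
    qed
    also have "\<dots> = (\<Sum>b\<in>injective_families ks {1..q}. Poly_Mapping.single (family_pperm ks b) 1)"
      by (rule sum.reindex_bij_betw[OF bij_betw_labelings_families[OF e(1)],
            where g = "\<lambda>b. Poly_Mapping.single (family_pperm ks b) 1"])
    also have "\<dots> = class_indicator_on {1..q} ks"
      using False by (simp add: class_indicator_on_def)
    finally show ?thesis .
  qed
qed

end

section \<open>The ordered product\<close>

text \<open>Only the order of the points enters a walk sum, so it is insensitive to the relabelling
  by ranks in \<open>partition_indicator\<close>.\<close>

lemma slide_sum_relabel:
  assumes X: "finite X" "X \<noteq> {}" and part: "partition_on X P" and h: "strict_mono_on X h"
  shows "slide_sum q (h ` X) ((`) h ` P) = slide_sum q X P"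
proof -
  have inj: "inj_on h X" using h by (rule strict_mono_on_imp_inj_on)
  have sorted: "sorted_list_of_set (h ` X) = map h (sorted_list_of_set X)"
  proof (rule sorted_list_of_set_eqI)
    have "sorted_wrt (\<lambda>x y. x \<in> X \<and> y \<in> X \<and> x < y) (sorted_list_of_set X)"
      using X(1) by (intro sorted_wrt_mono_rel[OF _ strict_sorted_list_of_set]) auto
    then show "sorted_wrt (<) (map h (sorted_list_of_set X))"
      unfolding sorted_wrt_map by (rule sorted_wrt_mono_rel[rotated]) (use strict_mono_onD[OF h] in blast)
  qed (use X in simp)
  have max: "Max (h ` X) = h (Max X)"
    using X last_sorted_list_of_set[of "h ` X"] last_sorted_list_of_set[OF X]
    by (simp add: sorted last_map)
  have sub: "B \<subseteq> X" if "B \<in> P" for B using that partition_onD1[OF part] by blast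
  have block: "same_block ((`) h ` P) (h x) (h y) \<longleftrightarrow> same_block P x y" if "x \<in> X" "y \<in> X" for x y
  proof -
    have "h z \<in> h ` B \<longleftrightarrow> z \<in> B" if "B \<in> P" "z \<in> X" for B z
      using inj_on_image_mem_iff[OF inj that(2) sub[OF that(1)]] .
    then show ?thesis using that by (auto simp: same_block_def)
  qed
  define h' where "h' = the_inv_into X h"
  have h'h: "h' (h x) = x" if "x \<in> X" for x
    unfolding h'_def using inj that by (rule the_inv_into_f_f)
  have mX: "Max X \<in> X" using X by simp
  show ?thesis
    unfolding slide_sum_def sorted max
  proof (rule sum.reindex_bij_witness
      [where i = "\<lambda>a. restrict (\<lambda>y. a (h' y)) (h ` X)" and j = "\<lambda>b. restrict (\<lambda>x. b (h x)) X"])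
    fix b assume b: "b \<in> {a \<in> labelings q (h ` X) ((`) h ` P). a (h (Max X)) = 0}"
    then have bP: "b \<in> h ` X \<rightarrow>\<^sub>E {0..q}"
      and bk: "\<forall>x\<in>X. \<forall>y\<in>X. b (h x) = b (h y) \<longleftrightarrow> same_block P x y"
      using block unfolding labelings_def by (blast, simp)
    show "restrict (\<lambda>y. restrict (\<lambda>x. b (h x)) X (h' y)) (h ` X) = b"
    proof
      show "restrict (\<lambda>y. restrict (\<lambda>x. b (h x)) X (h' y)) (h ` X) y = b y" for y
        using h'h PiE_arb[OF bP, of y] by (cases "y \<in> h ` X") auto
    qed
    have "restrict (\<lambda>x. b (h x)) X \<in> X \<rightarrow>\<^sub>E {0..q}"
      using PiE_mem[OF bP] by (intro PiE_I) auto
    then show "restrict (\<lambda>x. b (h x)) X \<in> {a \<in> labelings q X P. a (Max X) = 0}"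
      using b bk mX by (simp add: labelings_def)
    have "map (restrict (\<lambda>x. b (h x)) X) (sorted_list_of_set X) = map b (map h (sorted_list_of_set X))"
      using X(1) by simp
    then show "slide_term (map (restrict (\<lambda>x. b (h x)) X) (sorted_list_of_set X)) =
        slide_term (map b (map h (sorted_list_of_set X)))" by (simp only:)
  next
    fix a assume a: "a \<in> {a \<in> labelings q X P. a (Max X) = 0}"
    then have aP: "a \<in> X \<rightarrow>\<^sub>E {0..q}" and ak: "\<forall>x\<in>X. \<forall>y\<in>X. a x = a y \<longleftrightarrow> same_block P x y"
      unfolding labelings_def by blast+
    show "restrict (\<lambda>x. restrict (\<lambda>y. a (h' y)) (h ` X) (h x)) X = a"
    proof
      show "restrict (\<lambda>x. restrict (\<lambda>y. a (h' y)) (h ` X) (h x)) X x = a x" for x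
        using h'h PiE_arb[OF aP, of x] by (cases "x \<in> X") auto
    qed
    have "restrict (\<lambda>y. a (h' y)) (h ` X) \<in> h ` X \<rightarrow>\<^sub>E {0..q}"
      using PiE_mem[OF aP] h'h by (intro PiE_I) auto
    then show "restrict (\<lambda>y. a (h' y)) (h ` X) \<in> {a \<in> labelings q (h ` X) ((`) h ` P). a (h (Max X)) = 0}"
      using a ak mX h'h block by (simp add: labelings_def)
  qed
qed

lemma strict_mono_on_rank_in:
  assumes "finite X"
  shows "strict_mono_on X (rank_in X)"
proof (rule strict_mono_onI)
  fix x y assume xy: "x \<in> X" "y \<in> X" "x < y"
  have "{z \<in> X. z \<le> x} \<subset> {z \<in> X. z \<le> y}"
  proof
    show "{z \<in> X. z \<le> x} \<subseteq> {z \<in> X. z \<le> y}" using xy by auto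
    have "y \<in> {z \<in> X. z \<le> y} - {z \<in> X. z \<le> x}" using xy by simp
    then show "{z \<in> X. z \<le> x} \<noteq> {z \<in> X. z \<le> y}" by blast
  qed
  then show "rank_in X x < rank_in X y"
    unfolding rank_in_def using assms by (intro psubset_card_mono) auto
qed

lemma rank_in_image:
  assumes "finite X"
  shows "rank_in X ` X = {1..card X}"
proof (rule card_subset_eq)
  show "rank_in X ` X \<subseteq> {1..card X}"
  proof
    fix k assume "k \<in> rank_in X ` X"
    then obtain x where x: "x \<in> X" "k = card {y \<in> X. y \<le> x}" by (auto simp: rank_in_def)
    have "{y \<in> X. y \<le> x} \<noteq> {}" using x(1) by blast
    then have "0 < k" using x assms by (simp add: card_gt_0_iff)
    moreover have "k \<le> card X" unfolding x(2) using assms by (intro card_mono) auto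
    ultimately show "k \<in> {1..card X}" by simp
  qed
  have "inj_on (rank_in X) X"
    using strict_mono_on_rank_in[OF assms] by (rule strict_mono_on_imp_inj_on)
  then show "card (rank_in X ` X) = card {1..card X}" by (simp add: card_image)
qed simp

lemma Rep_partition_indicator:
  assumes X: "finite X" "X \<noteq> {}" and partP: "partition_on X P"
  shows "Rep_pperm_limit (partition_indicator P) q = slide_sum q X P"
proof -
  have UP: "\<Union>P = X" using partition_onD1[OF partP] by simp
  let ?Q = "(`) (rank_in X) ` P"
  have inj: "inj_on (rank_in X) X"
    using strict_mono_on_rank_in[OF X(1)] by (rule strict_mono_on_imp_inj_on)
  have "partition_on (rank_in X ` X) (?Q - {{}})"
    by (rule partition_on_inj_image[OF partP inj])
  moreover have "?Q - {{}} = ?Q" using partition_onD3[OF partP] by auto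
  ultimately have "partition_on {1..card X} ?Q" by (simp only: rank_in_image[OF X(1)])
  then interpret fattened "card X" ?Q
    using X by unfold_locales (simp_all add: card_gt_0_iff)
  have "Rep_pperm_limit (partition_indicator P) q = class_indicator_on {1..q} (winding_type (card X) ?Q)"
    by (simp only: partition_indicator_def UP class_indicator.rep_eq)
  also have "\<dots> = slide_sum q (rank_in X ` X) ?Q"
    by (simp only: slide_sum_eq_class_indicator_on rank_in_image[OF X(1)])
  also have "\<dots> = slide_sum q X P"
    by (rule slide_sum_relabel[OF X partP strict_mono_on_rank_in[OF X(1)]])
  finally show ?thesis .
qed

lemma Rep_pperm_limit_sum: "Rep_pperm_limit (\<Sum>i\<in>I. x i) q = (\<Sum>i\<in>I. Rep_pperm_limit (x i) q)"
  by (induction I rule: infinite_finite_induct) (simp_all add: zero_pperm_limit.rep_eq plus_pperm_limit.rep_eq)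

lemma Rep_pperm_limit_prod_list:
  "Rep_pperm_limit (prod_list (map x is)) q = prod_list (map (\<lambda>i. Rep_pperm_limit (x i) q) is)"
  by (induction "is") (simp_all add: one_pperm_limit.rep_eq times_pperm_limit.rep_eq)

lemma limit_scale_one: "limit_scale 1 x = x"
proof -
  have "scale 1 f = f" for f :: "nat pperm \<Rightarrow>\<^sub>0 complex"
    by (rule poly_mapping_eqI) simp
  then show ?thesis by transfer simp
qed

lemma indicator_linear_sum_single:
  assumes "finite S"
  shows "indicator_linear (\<Sum>\<sigma>\<in>S. Poly_Mapping.single \<sigma> 1) = (\<Sum>\<sigma>\<in>S. partition_indicator \<sigma>)"
proof -
  let ?F = "\<Sum>\<sigma>\<in>S. Poly_Mapping.single \<sigma> (1::complex)"
  have lookup: "Poly_Mapping.lookup ?F \<sigma> = (if \<sigma> \<in> S then 1 else 0)" for \<sigma>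
    using assms by (simp add: lookup_sum lookup_single when_def)
  then have "Poly_Mapping.keys ?F = S" by (auto simp: in_keys_iff split: if_splits)
  then show ?thesis
    unfolding indicator_linear_def using lookup by (intro sum.cong) (simp_all add: limit_scale_one)
qed

lemma partition_indicator_empty: "partition_indicator {} = 1"
proof -
  have "class_indicator_on {1..q} [] = 1" for q :: nat
    by (simp add: class_indicator_on_def injective_families_def family_index_def family_pperm_def)
  then have "class_indicator [] = 1" by transfer simp
  then show ?thesis by (simp add: partition_indicator_def winding_type_def cycles_of_def)
qed

lemma partition_on_eqI:
  assumes "partition_on X P" "partition_on X Q"
    and "\<And>x y. x \<in> X \<Longrightarrow> y \<in> X \<Longrightarrow> same_block P x y \<longleftrightarrow> same_block Q x y"
  shows "P = Q"
proof -
  have sub: "P \<subseteq> Q" if P: "partition_on X P" and Q: "partition_on X Q"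
    and eq: "\<And>x y. x \<in> X \<Longrightarrow> y \<in> X \<Longrightarrow> same_block P x y \<longleftrightarrow> same_block Q x y" for P Q :: "'a set set"
  proof
    fix B assume B: "B \<in> P"
    have "B \<noteq> {}" using B partition_onD3[OF P] by (cases "B = {}") simp_all
    then obtain x where x: "x \<in> B" by fast
    then have xX: "x \<in> X" using B partition_onD1[OF P] by blast
    then obtain C where C: "C \<in> Q" "x \<in> C" using partition_onD1[OF Q] by blast
    have BX: "B \<subseteq> X" "C \<subseteq> X" using B C partition_onD1[OF P] partition_onD1[OF Q] by blast+
    have "y \<in> B \<longleftrightarrow> same_block P x y" for y
      using disjointD[OF partition_onD2[OF P]] B x unfolding same_block_def by blast
    moreover have "y \<in> C \<longleftrightarrow> same_block Q x y" for y
      using disjointD[OF partition_onD2[OF Q]] C unfolding same_block_def by blast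
    ultimately have "B = C" using eq[OF xX] BX by blast
    then show "B \<in> Q" using C(1) by simp
  qed
  show ?thesis
    using sub[OF assms(1,2)] sub[OF assms(2,1)] assms(3) by blast
qed

lemma kernel_partition:
  fixes a :: "'a \<Rightarrow> 'b"
  obtains P where "partition_on X P" "\<And>x y. x \<in> X \<Longrightarrow> y \<in> X \<Longrightarrow> same_block P x y \<longleftrightarrow> a x = a y"
proof
  show "partition_on X ((\<lambda>x. {y \<in> X. a y = a x}) ` X)"
    by (rule partition_onI) (auto simp: disjnt_def)
  show "same_block ((\<lambda>x. {y \<in> X. a y = a x}) ` X) x y \<longleftrightarrow> a x = a y" if "x \<in> X" "y \<in> X" for x y
    using that by (auto simp: same_block_def)
qed

text \<open>Every labeling has exactly one kernel partition, and conditions (1) and (2) for this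
  \<sigma> are \<open>labels_blocks\<close> and \<open>glued\<close> for the labeling; so the sets
  of labelings for the various \<sigma> partition the index set on the right.\<close>

lemma slide_sum_ordered_product:
  fixes \<rho> :: "nat \<Rightarrow> nat set"
  assumes n: "0 < n" and Q: "\<rho> ` R \<in> NC n"
  shows "(\<Sum>\<sigma> \<in> {\<sigma>. partition_on {1..n} \<sigma> \<and>
      (\<forall>s\<in>R. \<forall>a\<in>\<rho> s. \<forall>b\<in>\<rho> s. same_block \<sigma> a b \<longleftrightarrow> same_block (\<pi> s) a b) \<and>
      refines {1..n} (kreweras_inv n (\<rho> ` R)) \<sigma>}. slide_sum q {1..n} \<sigma>) =
    (\<Sum>a | a \<in> {1..n} \<rightarrow>\<^sub>E {0..q} \<and> a (Max {1..n}) = 0 \<and> glued {1..n} (\<rho> ` R) a \<and> labels_blocks \<rho> \<pi> R a.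
      slide_term (map a (sorted_list_of_set {1..n})))"
    (is "sum _ ?S = sum ?term ?big")
proof -
  let ?X = "{1..n}" and ?A = "\<lambda>\<sigma>. {a. a \<in> labelings q {1..n} \<sigma> \<and> a (Max {1..n}) = 0}"
  have sub: "\<rho> s \<subseteq> ?X" if "s \<in> R" for s
    using that Q by (auto simp: NC_def dest!: partition_onD1 simp del: atLeastAtMost_iff)
  have finS: "finite ?S"
    by (rule finite_subset[OF _ finitely_many_partition_on[of ?X]]) auto
  have finA: "finite (?A \<sigma>)" for \<sigma>
    by (rule finite_subset[of _ "?X \<rightarrow>\<^sub>E {0..q}"]) (auto simp: labelings_def intro: finite_PiE)
  have labD: "a \<in> ?X \<rightarrow>\<^sub>E {0..q}" "\<And>x y. x \<in> ?X \<Longrightarrow> y \<in> ?X \<Longrightarrow> a x = a y \<longleftrightarrow> same_block \<sigma> x y"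
    if "a \<in> labelings q ?X \<sigma>" for a \<sigma>
    using that unfolding labelings_def by blast+
  have mem: "\<sigma> \<in> ?S \<longleftrightarrow> glued ?X (\<rho> ` R) a \<and> labels_blocks \<rho> \<pi> R a"
    if part: "partition_on ?X \<sigma>" and lab: "\<And>x y. x \<in> ?X \<Longrightarrow> y \<in> ?X \<Longrightarrow> a x = a y \<longleftrightarrow> same_block \<sigma> x y" for \<sigma> a
  proof -
    have "refines ?X (kreweras_inv n (\<rho> ` R)) \<sigma> \<longleftrightarrow> glued ?X (\<rho> ` R) a"
      unfolding kreweras_inv_eq[OF Q] refines_tied_partition_iff[OF part] glued_def
      using lab tied_le by (intro ball_cong refl) (metis (no_types, lifting))
    moreover have "(\<forall>s\<in>R. \<forall>x\<in>\<rho> s. \<forall>y\<in>\<rho> s. same_block \<sigma> x y \<longleftrightarrow> same_block (\<pi> s) x y) \<longleftrightarrow> labels_blocks \<rho> \<pi> R a"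
      unfolding labels_blocks_def using lab sub by (intro ball_cong refl) (metis subsetD)
    ultimately show ?thesis using part by blast
  qed
  have "(\<Union>\<sigma>\<in>?S. ?A \<sigma>) = ?big"
  proof (intro equalityI subsetI)
    fix a assume "a \<in> (\<Union>\<sigma>\<in>?S. ?A \<sigma>)"
    then obtain \<sigma> where \<sigma>: "\<sigma> \<in> ?S" "a \<in> labelings q ?X \<sigma>" "a (Max ?X) = 0" by blast
    have "partition_on ?X \<sigma>" using \<sigma>(1) by blast
    from mem[OF this labD(2)[OF \<sigma>(2)]] show "a \<in> ?big" using \<sigma> labD(1)[OF \<sigma>(2)] by blast
  next
    fix a assume a: "a \<in> ?big"
    obtain \<sigma> where \<sigma>: "partition_on ?X \<sigma>"
      and lab: "\<And>x y. x \<in> ?X \<Longrightarrow> y \<in> ?X \<Longrightarrow> same_block \<sigma> x y \<longleftrightarrow> a x = a y"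
      using kernel_partition[of ?X a] by blast
    have "\<sigma> \<in> ?S" using mem[OF \<sigma> lab[symmetric]] a by blast
    moreover have "a \<in> ?A \<sigma>" using a lab unfolding labelings_def by blast
    ultimately show "a \<in> (\<Union>\<sigma>\<in>?S. ?A \<sigma>)" by blast
  qed
  moreover have "sum ?term (\<Union>\<sigma>\<in>?S. ?A \<sigma>) = (\<Sum>\<sigma>\<in>?S. sum ?term (?A \<sigma>))"
  proof (rule sum.UNION_disjoint[OF finS])
    show "\<forall>\<sigma>\<in>?S. finite (?A \<sigma>)" using finA by blast
    show "\<forall>\<sigma>\<in>?S. \<forall>\<tau>\<in>?S. \<sigma> \<noteq> \<tau> \<longrightarrow> ?A \<sigma> \<inter> ?A \<tau> = {}"
    proof (intro ballI impI equals0I)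
      fix \<sigma> \<tau> a assume \<sigma>\<tau>: "\<sigma> \<in> ?S" "\<tau> \<in> ?S" "\<sigma> \<noteq> \<tau>" and a: "a \<in> ?A \<sigma> \<inter> ?A \<tau>"
      have "\<sigma> = \<tau>"
      proof (rule partition_on_eqI[of ?X])
        show "partition_on ?X \<sigma>" "partition_on ?X \<tau>" using \<sigma>\<tau> by blast+
        show "same_block \<sigma> x y \<longleftrightarrow> same_block \<tau> x y" if "x \<in> ?X" "y \<in> ?X" for x y
          using labD(2)[of a \<sigma>] labD(2)[of a \<tau>] a that by blast
      qed
      with \<sigma>\<tau>(3) show False ..
    qed
  qed
  ultimately show ?thesis by (simp only: slide_sum_def)
qed

theorem theorem5p11:
  fixes n r :: nat
    and \<rho> :: "nat \<Rightarrow> nat set"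
    and \<pi> :: "nat \<Rightarrow> nat set set"
  assumes "partition_on {1..n} (\<rho> ` {1..r})"
    and "inj_on \<rho> {1..r}"
    and "noncrossing (\<rho> ` {1..r})"
    and "\<forall>s\<in>{1..r}. partition_on (\<rho> s) (\<pi> s)"
  shows "indicator_linear (ordered_product n r \<rho> \<pi>) =
           prod_list (map (\<lambda>s. partition_indicator (\<pi> s)) [1..<Suc r])"
proof -
  define S where "S = {\<sigma>. partition_on {1..n} \<sigma> \<and>
      (\<forall>s\<in>{1..r}. \<forall>a\<in>\<rho> s. \<forall>b\<in>\<rho> s. same_block \<sigma> a b \<longleftrightarrow> same_block (\<pi> s) a b) \<and>
      refines {1..n} (kreweras_inv n (\<rho> ` {1..r})) \<sigma>}"
  have NC: "\<rho> ` {1..r} \<in> NC n" using assms by (simp add: NC_def)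
  have finS: "finite S"
    unfolding S_def by (rule finite_subset[OF _ finitely_many_partition_on[of "{1..n}"]]) auto
  have LHS: "indicator_linear (ordered_product n r \<rho> \<pi>) = (\<Sum>\<sigma>\<in>S. partition_indicator \<sigma>)"
    unfolding ordered_product_def S_def[symmetric] by (rule indicator_linear_sum_single[OF finS])
  show ?thesis
  proof (cases "n = 0")
    \<comment> \<open>Without points there is no root for a walk. The ordered product is then the
      empty partition alone, and both sides are \<open>1\<close>.\<close>
    case True
    then have "\<rho> ` {1..r} = {}" using assms(1) by (simp add: partition_on_empty)
    then have r: "r = 0" by simp
    have "kreweras_inv n (\<rho> ` {1..r}) = {}"
      using kreweras_inv_eq[OF NC] True by (simp add: tied_partition_def)
    then have "S = {{}}"
      using True r by (auto simp: S_def refines_def partition_on_empty)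
    then show ?thesis using LHS r by (simp add: partition_indicator_empty)
  next
    case False
    have block: "finite (\<rho> s) \<and> \<rho> s \<noteq> {}" if "s \<in> {1..r}" for s
      using that assms(1) by (metis Union_upper finite_atLeastAtMost finite_subset imageI partition_onD1 partition_onD3)
    have set: "set [1..<Suc r] = {1..r}" by auto
    have ne: "{1..n} \<noteq> {}" using False by simp
    have "Rep_pperm_limit (indicator_linear (ordered_product n r \<rho> \<pi>)) q =
        Rep_pperm_limit (prod_list (map (\<lambda>s. partition_indicator (\<pi> s)) [1..<Suc r])) q" for q
    proof -
      have "Rep_pperm_limit (indicator_linear (ordered_product n r \<rho> \<pi>)) q =
          (\<Sum>\<sigma>\<in>S. Rep_pperm_limit (partition_indicator \<sigma>) q)"
        unfolding LHS by (rule Rep_pperm_limit_sum)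
      also have "\<dots> = (\<Sum>\<sigma>\<in>S. slide_sum q {1..n} \<sigma>)"
        by (intro sum.cong refl Rep_partition_indicator ne) (simp_all add: S_def)
      also have "\<dots> = (\<Sum>a | a \<in> {1..n} \<rightarrow>\<^sub>E {0..q} \<and> a (Max {1..n}) = 0 \<and>
          glued {1..n} (\<rho> ` {1..r}) a \<and> labels_blocks \<rho> \<pi> {1..r} a.
          slide_term (map a (sorted_list_of_set {1..n})))"
        unfolding S_def using False by (intro slide_sum_ordered_product[OF _ NC]) simp
      also have "\<dots> = prod_list (map (\<lambda>s. slide_sum q (\<rho> s) (\<pi> s)) [1..<Suc r])"
        using glued_slide_sum[of "{1..n}" "[1..<Suc r]" \<rho>, unfolded set] assms ne by simp
      also have "\<dots> = prod_list (map (\<lambda>s. Rep_pperm_limit (partition_indicator (\<pi> s)) q) [1..<Suc r])"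
      proof -
        have "slide_sum q (\<rho> s) (\<pi> s) = Rep_pperm_limit (partition_indicator (\<pi> s)) q" if "s \<in> {1..r}" for s
          using Rep_partition_indicator block[OF that] assms(4) that by metis
        then show ?thesis by (intro arg_cong[where f = prod_list] map_cong refl) (simp add: set del: upt_Suc)
      qed
      also have "\<dots> = Rep_pperm_limit (prod_list (map (\<lambda>s. partition_indicator (\<pi> s)) [1..<Suc r])) q"
        by (rule Rep_pperm_limit_prod_list[symmetric])
      finally show ?thesis .
    qed
    then show ?thesis by (simp add: Rep_pperm_limit_inject[symmetric] fun_eq_iff)
  qed
qed

end
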